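(* Let $G$ be a finite group acting (by ring automorphisms) on a commutative noetherian local ring $(Q,\mathfrak{m})$ such that $Q$ is finitely generated as a module over the invariant subring $Q^G$, and let $f \in \mathfrak{m}$ be an element fixed by $G$. If $Q$ is henselian, then the homotopy category $[\mathrm{mf}_G(Q,f)]$ of $G$-equivariant matrix factorizations of $f$ is idempotent complete.
   Context: Twisted group ring: for a commutative ring $Q$ with an action of a finite group $G$ (write $b^g$ for the result of acting by $g$ on $b$), $Q \# G$ is the set of formal sums $\sum_{g\in G} a_g g$ with $a_g \in Q$, with multiplication determined by $ag\cdot bh = a b^g gh$. A left $Q\# G$-module is the same as a $Q$-module $M$ with a left $G$-action such that $g(am) = a^g(gm)$. Equivariant matrix factorizations: for $f\in Q$ fixed by $G$, the objects of $\mathrm{mf}_G(Q,f)$ are pairs $(P,d)$, where $P$ is a $\mathbb{Z}/2$-graded left $Q\# G$-module that is finitely generated and projective as a $Q$-module, and $d$ is a $Q\# G$-linear endomorphism of $P$ of odd degree with $d^2 = f\cdot \mathrm{id}_P$. (It is not assumed that $|G|$ is a unit in $Q$.) Morphisms in the additive category $\mathrm{mf}_G(Q,f)$ are the even-degree $Q\# G$-linear maps commuting with the differentials. The category $[\mathrm{mf}_G(Q,f)]$ is the quotient with the same objects and with morphisms taken modulo homotopy: $\alpha,\beta:(P,d)\to(P',d')$ are homotopic if $\alpha-\beta = d'h+hd$ for some odd-degree $Q\# G$-linear map $h:P\to P'$. An additive category is idempotent complete if for every object $X$ and idempotent endomorphism $e$ of $X$ there exist an object $Y$ and morphisms $\pi:X\to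 Y$, $\iota:Y\to X$ with $\pi\iota=\mathrm{id}_Y$ and $\iota\pi=e$. *)

theory Defs
  imports
    "HOL-Algebra.Group_Action"
    "HOL-Algebra.Module"
    "HOL-Algebra.QuotRing"
    "HOL-Algebra.Ring_Divisibility"
    "HOL-Algebra.UnivPoly"
begin

section \<open>Categories and idempotent completeness\<close>

text \<open>\<open>Comp C X Y Z g f\<close> is the composite of \<open>f : X \<rightarrow> Y\<close> followed by \<open>g : Y \<rightarrow> Z\<close>.\<close>

record ('o, 'a) category =
  Ob :: "'o set"
  Hom :: "'o \<Rightarrow> 'o \<Rightarrow> 'a set"
  Id :: "'o \<Rightarrow> 'a"
  Comp :: "'o \<Rightarrow> 'o \<Rightarrow> 'o \<Rightarrow> 'a \<Rightarrow> 'a \<Rightarrow> 'a"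

definition idempotent_complete :: "('o, 'a) category \<Rightarrow> bool" where
  "idempotent_complete C \<longleftrightarrow>
     (\<forall>X \<in> Ob C. \<forall>e \<in> Hom C X X. Comp C X X X e e = e \<longrightarrow>
        (\<exists>Y \<in> Ob C. \<exists>\<pi> \<in> Hom C X Y. \<exists>\<iota> \<in> Hom C Y X.
           Comp C Y X Y \<pi> \<iota> = Id C Y \<and> Comp C X Y X \<iota> \<pi> = e))"

text \<open>The quotient of a category by a family \<open>r X Y\<close> of equivalence relations on the
  morphism sets.\<close>

definition quotient_category ::
  "('o, 'a) category \<Rightarrow> ('o \<Rightarrow> 'o \<Rightarrow> ('a \<times> 'a) set) \<Rightarrow> ('o, 'a set) category" where
  "quotient_category C r =
    \<lparr>Ob = Ob C,
     Hom = (\<lambda>X Y. Hom C X Y // r X Y),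
     Id = (\<lambda>X. r X X `` {Id C X}),
     Comp = (\<lambda>X Y Z B A. \<Union>\<beta>\<in>B. \<Union>\<alpha>\<in>A. r X Z `` {Comp C X Y Z \<beta> \<alpha>})\<rparr>"


section \<open>Modules\<close>

definition linear_maps ::
  "('a, 'r) ring_scheme \<Rightarrow> ('a, 'b, 'm) module_scheme \<Rightarrow> ('a, 'c, 'n) module_scheme
     \<Rightarrow> ('b \<Rightarrow> 'c) set" where
  "linear_maps R M N =
    {h \<in> carrier M \<rightarrow>\<^sub>E carrier N.
       (\<forall>x \<in> carrier M. \<forall>y \<in> carrier M. h (x \<oplus>\<^bsub>M\<^esub> y) = h x \<oplus>\<^bsub>N\<^esub> h y) \<and>
       (\<forall>a \<in> carrier R. \<forall>x \<in> carrier M. h (a \<odot>\<^bsub>M\<^esub> x) = a \<odot>\<^bsub>N\<^esub> h x)}"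

definition finitely_generated ::
  "('a, 'r) ring_scheme \<Rightarrow> ('a, 'b, 'm) module_scheme \<Rightarrow> bool" where
  "finitely_generated R M \<longleftrightarrow>
    (\<exists>A \<subseteq> carrier M. finite A \<and>
       (\<forall>x \<in> carrier M. \<exists>c \<in> A \<rightarrow> carrier R. x = (\<Oplus>\<^bsub>M\<^esub>a\<in>A. c a \<odot>\<^bsub>M\<^esub> a)))"

text \<open>The free module with basis indexed by \<open>I\<close>: finitely supported functions on \<open>I\<close>.
  The \<open>mult\<close> and \<open>one\<close> fields of a module record are irrelevant.\<close>

definition free_module :: "('a, 'r) ring_scheme \<Rightarrow> 'i set \<Rightarrow> ('a, 'i \<Rightarrow> 'a) module" where
  "free_module R I =
    \<lparr>carrier = {v \<in> I \<rightarrow>\<^sub>E carrier R. finite {i \<in> I. v i \<noteq> \<zero>\<^bsub>R\<^esub>}},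
     monoid.mult = (\<lambda>_ _. undefined), one = undefined,
     zero = (\<lambda>i\<in>I. \<zero>\<^bsub>R\<^esub>),
     add = (\<lambda>u v. \<lambda>i\<in>I. u i \<oplus>\<^bsub>R\<^esub> v i),
     smult = (\<lambda>a v. \<lambda>i\<in>I. a \<otimes>\<^bsub>R\<^esub> v i)\<rparr>"

text \<open>Projective means: a direct summand of a free module.  Taking the basis in the element
  type of \<open>P\<close> is no restriction, because a projective \<open>P\<close> is a direct summand of the free
  module on its own carrier.\<close>

definition projective ::
  "('a, 'r) ring_scheme \<Rightarrow> ('a, 'b, 'm) module_scheme \<Rightarrow> bool" where
  "projective R P \<longleftrightarrow>
    (\<exists>I :: 'b set.
       \<exists>i \<in> linear_maps R P (free_module R I). \<exists>p \<in> linear_maps R (free_module R I) P.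
         \<forall>x \<in> carrier P. p (i x) = x)"

definition regular_module :: "('a, 'r) ring_scheme \<Rightarrow> ('a, 'a) module" where
  "regular_module R =
    \<lparr>carrier = carrier R, monoid.mult = monoid.mult R, one = one R, zero = zero R, add = add R,
     smult = monoid.mult R\<rparr>"


section \<open>Henselian local rings\<close>

definition local_ring :: "('a, 'r) ring_scheme \<Rightarrow> 'a set \<Rightarrow> bool" where
  "local_ring R \<mm> \<longleftrightarrow>
     cring R \<and> maximalideal \<mm> R \<and> (\<forall>J. maximalideal J R \<longrightarrow> J = \<mm>)"

definition monic :: "('a, 'r) ring_scheme \<Rightarrow> (nat \<Rightarrow> 'a) \<Rightarrow> bool" where
  "monic R p \<longleftrightarrow> coeff (UP R) p (deg R p) = \<one>\<^bsub>R\<^esub>"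

definition reduce_poly :: "('a, 'r) ring_scheme \<Rightarrow> 'a set \<Rightarrow> (nat \<Rightarrow> 'a) \<Rightarrow> nat \<Rightarrow> 'a set" where
  "reduce_poly R I p = (\<lambda>n. I +>\<^bsub>R\<^esub> coeff (UP R) p n)"

text \<open>A local ring is henselian if Hensel's lemma holds: a factorization of the reduction of a
  monic polynomial into coprime monic factors over the residue field lifts to a factorization
  into monic factors.\<close>

definition henselian :: "('a, 'r) ring_scheme \<Rightarrow> 'a set \<Rightarrow> bool" where
  "henselian R \<mm> \<longleftrightarrow> local_ring R \<mm> \<and>
    (let k = R Quot \<mm> in
     \<forall>p \<in> carrier (UP R). \<forall>g \<in> carrier (UP k). \<forall>h \<in> carrier (UP k).
       monic R p \<and> monic k g \<and> monic k h \<and>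
       genideal (UP k) {g, h} = carrier (UP k) \<and>
       reduce_poly R \<mm> p = g \<otimes>\<^bsub>UP k\<^esub> h \<longrightarrow>
       (\<exists>g' \<in> carrier (UP R). \<exists>h' \<in> carrier (UP R).
          monic R g' \<and> monic R h' \<and> p = g' \<otimes>\<^bsub>UP R\<^esub> h' \<and>
          reduce_poly R \<mm> g' = g \<and> reduce_poly R \<mm> h' = h))"


section \<open>Group actions on rings and modules\<close>

text \<open>\<open>\<phi> g b\<close> is the element written $b^g$; this is a left action.\<close>

locale ring_action = group_action G "carrier Q" \<phi> + cring Q
  for G :: "('g, 'x) monoid_scheme" and Q :: "('q, 'y) ring_scheme" and \<phi> +
  assumes act_ring_hom: "g \<in> carrier G \<Longrightarrow> \<phi> g \<in> ring_hom Q Q"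

definition invariant_ring ::
  "('g, 'x) monoid_scheme \<Rightarrow> ('q, 'y) ring_scheme \<Rightarrow> ('g \<Rightarrow> 'q \<Rightarrow> 'q) \<Rightarrow> ('q, 'y) ring_scheme"
  where
  "invariant_ring G Q \<phi> = Q\<lparr>carrier := {a \<in> carrier Q. \<forall>g \<in> carrier G. \<phi> g a = a}\<rparr>"

text \<open>Left modules over the twisted group ring $Q \# G$, presented as \<open>Q\<close>-modules with a
  semilinear action of \<open>G\<close>.\<close>

locale twisted_module =
  ring_action G Q \<phi> + Mod?: module Q M + Act?: group_action G "carrier M" \<rho>
  for G :: "('g, 'x) monoid_scheme" and Q :: "('q, 'y) ring_scheme" and \<phi>
    and M :: "('q, 'm, 'z) module_scheme" and \<rho> +
  assumes act_add: "\<lbrakk>g \<in> carrier G; x \<in> carrier M; y \<in> carrier M\<rbrakk>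
      \<Longrightarrow> \<rho> g (x \<oplus>\<^bsub>M\<^esub> y) = \<rho> g x \<oplus>\<^bsub>M\<^esub> \<rho> g y"
    and act_smult: "\<lbrakk>g \<in> carrier G; a \<in> carrier Q; x \<in> carrier M\<rbrakk>
      \<Longrightarrow> \<rho> g (a \<odot>\<^bsub>M\<^esub> x) = \<phi> g a \<odot>\<^bsub>M\<^esub> \<rho> g x"


section \<open>Equivariant matrix factorizations\<close>

text \<open>Underlying \<open>Q\<close>-module, action of \<open>G\<close> on it, even part, odd part, and differential.\<close>

record ('q, 'g, 'm) eqmf =
  und :: "('q, 'm) module"
  act :: "'g \<Rightarrow> 'm \<Rightarrow> 'm"
  ev :: "'m set"
  od :: "'m set"
  diff :: "'m \<Rightarrow> 'm"

definition twisted_linear_maps ::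
  "('g, 'x) monoid_scheme \<Rightarrow> ('q, 'y) ring_scheme
     \<Rightarrow> ('q, 'g, 'm) eqmf \<Rightarrow> ('q, 'g, 'm) eqmf \<Rightarrow> ('m \<Rightarrow> 'm) set" where
  "twisted_linear_maps G Q P P' =
    {h \<in> linear_maps Q (und P) (und P').
       \<forall>g \<in> carrier G. \<forall>x \<in> carrier (und P). h (act P g x) = act P' g (h x)}"

definition even_maps ::
  "('g, 'x) monoid_scheme \<Rightarrow> ('q, 'y) ring_scheme
     \<Rightarrow> ('q, 'g, 'm) eqmf \<Rightarrow> ('q, 'g, 'm) eqmf \<Rightarrow> ('m \<Rightarrow> 'm) set" where
  "even_maps G Q P P' =
    {h \<in> twisted_linear_maps G Q P P'. h ` ev P \<subseteq> ev P' \<and> h ` od P \<subseteq> od P'}"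

definition odd_maps ::
  "('g, 'x) monoid_scheme \<Rightarrow> ('q, 'y) ring_scheme
     \<Rightarrow> ('q, 'g, 'm) eqmf \<Rightarrow> ('q, 'g, 'm) eqmf \<Rightarrow> ('m \<Rightarrow> 'm) set" where
  "odd_maps G Q P P' =
    {h \<in> twisted_linear_maps G Q P P'. h ` ev P \<subseteq> od P' \<and> h ` od P \<subseteq> ev P'}"

definition graded ::
  "('g, 'x) monoid_scheme \<Rightarrow> ('q, 'y) ring_scheme \<Rightarrow> ('q, 'g, 'm) eqmf \<Rightarrow> bool" where
  "graded G Q P \<longleftrightarrow>
     submodule (ev P) Q (und P) \<and> submodule (od P) Q (und P) \<and>
     (\<forall>g \<in> carrier G. act P g ` ev P \<subseteq> ev P \<and> act P g ` od P \<subseteq> od P) \<and>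
     ev P \<inter> od P = {\<zero>\<^bsub>und P\<^esub>} \<and> ev P <+>\<^bsub>und P\<^esub> od P = carrier (und P)"

definition matrix_factorization ::
  "('g, 'x) monoid_scheme \<Rightarrow> ('q, 'y) ring_scheme \<Rightarrow> ('g \<Rightarrow> 'q \<Rightarrow> 'q) \<Rightarrow> 'q
     \<Rightarrow> ('q, 'g, 'm) eqmf \<Rightarrow> bool" where
  "matrix_factorization G Q \<phi> f P \<longleftrightarrow>
     twisted_module G Q \<phi> (und P) (act P) \<and> graded G Q P \<and>
     finitely_generated Q (und P) \<and> projective Q (und P) \<and>
     diff P \<in> odd_maps G Q P P \<and>
     (\<forall>x \<in> carrier (und P). diff P (diff P x) = f \<odot>\<^bsub>und P\<^esub> x)"

text \<open>HOL cannot quantify over all modules at once: for each type \<open>'m\<close> this is the full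
  subcategory on the matrix factorizations whose underlying set is a subset of \<open>'m\<close>.  A result
  stated for a type variable \<open>'m\<close> covers every object.\<close>

definition mf ::
  "('g, 'x) monoid_scheme \<Rightarrow> ('q, 'y) ring_scheme \<Rightarrow> ('g \<Rightarrow> 'q \<Rightarrow> 'q) \<Rightarrow> 'q
     \<Rightarrow> (('q, 'g, 'm) eqmf, 'm \<Rightarrow> 'm) category" where
  "mf G Q \<phi> f =
    \<lparr>Ob = {P. matrix_factorization G Q \<phi> f P},
     Hom = (\<lambda>P P'. {\<alpha> \<in> even_maps G Q P P'.
              \<forall>x \<in> carrier (und P). \<alpha> (diff P x) = diff P' (\<alpha> x)}),
     Id = (\<lambda>P. \<lambda>x \<in> carrier (und P). x),
     Comp = (\<lambda>P P' P'' \<beta> \<alpha>. compose (carrier (und P)) \<beta> \<alpha>)\<rparr>"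

definition homotopy_rel ::
  "('g, 'x) monoid_scheme \<Rightarrow> ('q, 'y) ring_scheme \<Rightarrow> ('g \<Rightarrow> 'q \<Rightarrow> 'q) \<Rightarrow> 'q
     \<Rightarrow> ('q, 'g, 'm) eqmf \<Rightarrow> ('q, 'g, 'm) eqmf \<Rightarrow> (('m \<Rightarrow> 'm) \<times> ('m \<Rightarrow> 'm)) set" where
  "homotopy_rel G Q \<phi> f P P' =
    {(\<alpha>, \<beta>). \<alpha> \<in> Hom (mf G Q \<phi> f) P P' \<and> \<beta> \<in> Hom (mf G Q \<phi> f) P P' \<and>
       (\<exists>h \<in> odd_maps G Q P P'. \<forall>x \<in> carrier (und P).
          \<alpha> x \<ominus>\<^bsub>und P'\<^esub> \<beta> x = diff P' (h x) \<oplus>\<^bsub>und P'\<^esub> h (diff P x))}"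

definition homotopy_mf ::
  "('g, 'x) monoid_scheme \<Rightarrow> ('q, 'y) ring_scheme \<Rightarrow> ('g \<Rightarrow> 'q \<Rightarrow> 'q) \<Rightarrow> 'q
     \<Rightarrow> (('q, 'g, 'm) eqmf, ('m \<Rightarrow> 'm) set) category" where
  "homotopy_mf G Q \<phi> f = quotient_category (mf G Q \<phi> f) (homotopy_rel G Q \<phi> f)"

end

theory Submission
  imports Defs "HOL-Algebra.Subrings"
begin

text \<open>
  An idempotent endomorphism of \<open>(P, d)\<close> in the homotopy category is represented by a morphism
  \<open>e\<close> such that \<open>e\<^sup>2 - e\<close> is null-homotopic.  The null-homotopic endomorphisms form an ideal.  Once
  \<open>e\<close> is replaced by a homotopic \<open>\<epsilon>\<close> with \<open>\<epsilon>\<^sup>2 = \<epsilon>\<close> on the nose, the grading, the action and the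
  differential restrict to the image of \<open>\<epsilon>\<close>, which is a retract of \<open>P\<close>, hence again finitely
  generated and projective; this image splits the idempotent
  (\<open>mf_object.split_idempotent\<close>).  So everything comes down to lifting an idempotent along
  an ideal (\<open>mf_object.lift_homotopy_idempotent\<close>).

  The lifting happens in a commutative ring, the bicommutant \<open>S\<close> of \<open>e\<close> in the \<open>Q\<close>-linear
  endomorphisms of \<open>P\<close>.  It contains \<open>e\<close> and the scalars, and its elements commute with every
  linear map that commutes with \<open>e\<close>, in particular with \<open>d\<close> and with the projection of \<open>P\<close> onto
  its even part.  The group acts on \<open>S\<close> by conjugation, and the elements fixed by it are
  endomorphisms of \<open>(P, d)\<close> in the equivariant category.

  As \<open>P\<close> is finitely generated, \<open>e\<close> is a root of a monic polynomial \<open>p\<close> over \<open>Q\<close>.  Over the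
  residue field \<open>p\<close> is \<open>X\<^sup>n\<close> times a polynomial that does not vanish at \<open>0\<close>; these factors are coprime,
  and Hensel's lemma lifts the factorization.  Evaluating the lifted factors at \<open>e\<close> gives,
  after division by a unit, two elements \<open>a\<close> and \<open>b\<close> of \<open>S\<close> with \<open>a b = 0\<close>, with \<open>b = 1 - e w\<close>
  for some \<open>w\<close>, and with \<open>a - e\<^sup>n\<close> in the ideal \<open>J\<close> of those operators that map \<open>P\<close> into
  \<open>\<mm>P\<close>.  By Nakayama's lemma \<open>1 - J\<close> consists of units.

  Conjugation by elements of \<open>G\<close> fixes \<open>e\<close> and preserves \<open>J\<close>.  Therefore the product of all
  conjugates of \<open>a\<close> and the product of all conjugates of \<open>b\<close> have the same shape as \<open>a\<close> and \<open>b\<close>,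
  and they are invariant.  This multiplicative norm takes the place of an average over \<open>G\<close>
  (\<open>finite_group_acting.equivariant_idempotent_lift\<close>).

  Now let \<open>a = e\<^sup>n - y\<close> and \<open>b = 1 - e w\<close> be invariant with \<open>a b = 0\<close> and \<open>y\<close> in \<open>J\<close>.  Modulo \<open>a\<close>
  and \<open>b\<close> one has \<open>1 = (e w)\<^sup>n = y w\<^sup>n\<close>, and \<open>1 - y w\<^sup>n\<close> is a unit, so \<open>a u + b v = 1\<close>
  for some \<open>u\<close> and \<open>v\<close>, and \<open>\<epsilon> = a u\<close> is an idempotent.  Modulo the null-homotopic maps \<open>e\<close> is
  idempotent.  There \<open>b\<close> is \<open>1\<close> on the image of \<open>1 - e\<close>, so \<open>a\<close> vanishes on it, and \<open>a\<close> is the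
  unit \<open>1 - y\<close> on the image of \<open>e\<close>, so \<open>b\<close> vanishes on that one; hence \<open>\<epsilon>\<close> agrees with \<open>e\<close>
  (\<open>cring.idempotent_lift\<close>).
\<close>

section \<open>Linear maps and retracts\<close>

locale linear_map = M: module Q M + N: module Q N
  for Q :: "('q, 'y) ring_scheme" and M :: "('q, 'm, 'z) module_scheme"
    and N :: "('q, 'n, 'w) module_scheme" +
  fixes h assumes linear: "h \<in> linear_maps Q M N"
begin

lemma closed [simp]: "x \<in> carrier M \<Longrightarrow> h x \<in> carrier N"
  and add: "\<lbrakk>x \<in> carrier M; y \<in> carrier M\<rbrakk> \<Longrightarrow> h (x \<oplus>\<^bsub>M\<^esub> y) = h x \<oplus>\<^bsub>N\<^esub> h y"
  and smult: "\<lbrakk>a \<in> carrier Q; x \<in> carrier M\<rbrakk> \<Longrightarrow> h (a \<odot>\<^bsub>M\<^esub> x) = a \<odot>\<^bsub>N\<^esub> h x"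
  and ext: "h \<in> extensional (carrier M)"
  using linear by (auto simp: linear_maps_def PiE_def)

lemma zero [simp]: "h \<zero>\<^bsub>M\<^esub> = \<zero>\<^bsub>N\<^esub>"
  using smult[OF M.R.zero_closed M.M.zero_closed] by simp

lemma neg: "x \<in> carrier M \<Longrightarrow> h (\<ominus>\<^bsub>M\<^esub> x) = \<ominus>\<^bsub>N\<^esub> h x"
  using add[of "\<ominus>\<^bsub>M\<^esub> x" x] by (simp add: M.M.l_neg N.M.minus_equality)

lemma minus: "\<lbrakk>x \<in> carrier M; y \<in> carrier M\<rbrakk> \<Longrightarrow> h (x \<ominus>\<^bsub>M\<^esub> y) = h x \<ominus>\<^bsub>N\<^esub> h y"
  by (simp add: a_minus_def add neg)

lemma finsum:
  assumes "finite A" "u \<in> A \<rightarrow> carrier M"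
  shows "h (\<Oplus>\<^bsub>M\<^esub>i\<in>A. u i) = (\<Oplus>\<^bsub>N\<^esub>i\<in>A. h (u i))"
  using assms
proof (induction A rule: finite_induct)
  case (insert i A)
  then have "u \<in> A \<rightarrow> carrier M" "u i \<in> carrier M" "(\<lambda>i. h (u i)) \<in> A \<rightarrow> carrier N"
    by (auto simp: Pi_def)
  then show ?case using insert by (simp add: add)
qed simp

end

lemma linear_mapsI:
  assumes "h \<in> extensional (carrier M)" and "\<And>x. x \<in> carrier M \<Longrightarrow> h x \<in> carrier N"
    and "\<And>x y. \<lbrakk>x \<in> carrier M; y \<in> carrier M\<rbrakk> \<Longrightarrow> h (x \<oplus>\<^bsub>M\<^esub> y) = h x \<oplus>\<^bsub>N\<^esub> h y"
    and "\<And>a x. \<lbrakk>a \<in> carrier Q; x \<in> carrier M\<rbrakk> \<Longrightarrow> h (a \<odot>\<^bsub>M\<^esub> x) = a \<odot>\<^bsub>N\<^esub> h x"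
  shows "h \<in> linear_maps Q M N"
  using assms unfolding linear_maps_def PiE_def by blast

lemma linear_maps_compose:
  assumes h: "h \<in> linear_maps Q M N" and k: "k \<in> linear_maps Q N L" and "module Q M"
  shows "compose (carrier M) k h \<in> linear_maps Q M L"
proof -
  interpret M: module Q M by fact
  have hM: "h x \<in> carrier N" if "x \<in> carrier M" for x
    using h that by (auto simp: linear_maps_def)
  show ?thesis
    using h k hM by (intro linear_mapsI) (auto simp: compose_def linear_maps_def)
qed

context module
begin

definition span where
  "span B = {x. \<exists>c \<in> B \<rightarrow> carrier R. x = (\<Oplus>\<^bsub>M\<^esub>b\<in>B. c b \<odot>\<^bsub>M\<^esub> b)}"

lemma spanI: "c \<in> B \<rightarrow> carrier R \<Longrightarrow> (\<Oplus>\<^bsub>M\<^esub>b\<in>B. c b \<odot>\<^bsub>M\<^esub> b) \<in> span B"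
  unfolding span_def by (intro CollectI bexI[of _ c] refl)

lemma span_smult_generator:
  assumes B: "finite B" "B \<subseteq> carrier M" and b: "b \<in> B" and a: "a \<in> carrier R"
  shows "a \<odot>\<^bsub>M\<^esub> b \<in> span B"
proof -
  have "(\<Oplus>\<^bsub>M\<^esub>i\<in>B. (if b = i then a else \<zero>) \<odot>\<^bsub>M\<^esub> i) = (\<Oplus>\<^bsub>M\<^esub>i\<in>B. if b = i then a \<odot>\<^bsub>M\<^esub> i else \<zero>\<^bsub>M\<^esub>)"
    using B a by (intro M.finsum_cong') auto
  also have "\<dots> = a \<odot>\<^bsub>M\<^esub> b" using B a b by (intro M.finsum_singleton) auto
  finally have "a \<odot>\<^bsub>M\<^esub> b = (\<Oplus>\<^bsub>M\<^esub>i\<in>B. (if b = i then a else \<zero>) \<odot>\<^bsub>M\<^esub> i)" by simp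
  moreover have "(\<lambda>i. if b = i then a else \<zero>) \<in> B \<rightarrow> carrier R" using a by simp
  ultimately show ?thesis using spanI[of "\<lambda>i. if b = i then a else \<zero>" B] by simp
qed

lemma span_add:
  assumes B: "finite B" "B \<subseteq> carrier M" and "x \<in> span B" "y \<in> span B"
  shows "x \<oplus>\<^bsub>M\<^esub> y \<in> span B"
proof -
  obtain c d where c: "c \<in> B \<rightarrow> carrier R" "x = (\<Oplus>\<^bsub>M\<^esub>i\<in>B. c i \<odot>\<^bsub>M\<^esub> i)"
    and d: "d \<in> B \<rightarrow> carrier R" "y = (\<Oplus>\<^bsub>M\<^esub>i\<in>B. d i \<odot>\<^bsub>M\<^esub> i)"
    using assms(3,4) by (auto simp: span_def)
  have m: "c i \<in> carrier R" "d i \<in> carrier R" "i \<in> carrier M" if "i \<in> B" for i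
    using c d B that by auto
  have "x \<oplus>\<^bsub>M\<^esub> y = (\<Oplus>\<^bsub>M\<^esub>i\<in>B. c i \<odot>\<^bsub>M\<^esub> i \<oplus>\<^bsub>M\<^esub> d i \<odot>\<^bsub>M\<^esub> i)"
    unfolding c(2) d(2) using m by (intro M.finsum_addf[symmetric]) auto
  also have "\<dots> = (\<Oplus>\<^bsub>M\<^esub>i\<in>B. (c i \<oplus> d i) \<odot>\<^bsub>M\<^esub> i)"
    using m by (intro M.finsum_cong') (auto simp: smult_l_distr)
  finally have "x \<oplus>\<^bsub>M\<^esub> y = (\<Oplus>\<^bsub>M\<^esub>i\<in>B. (c i \<oplus> d i) \<odot>\<^bsub>M\<^esub> i)" .
  moreover have "(\<lambda>i. c i \<oplus> d i) \<in> B \<rightarrow> carrier R" using m by (intro Pi_I R.add.m_closed)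
  ultimately show ?thesis using spanI[of "\<lambda>i. c i \<oplus> d i" B] by simp
qed

lemma span_zero: assumes "finite B" "B \<subseteq> carrier M" shows "\<zero>\<^bsub>M\<^esub> \<in> span B"
proof -
  have "(\<Oplus>\<^bsub>M\<^esub>i\<in>B. \<zero> \<odot>\<^bsub>M\<^esub> i) = \<zero>\<^bsub>M\<^esub>"
    using assms by (intro M.add.finprod_one_eqI) auto
  then show ?thesis using spanI[of "\<lambda>_. \<zero>" B] by simp
qed

end

text \<open>\<open>h\<close> may identify generators, so the image of a combination of generators is not directly a
  combination indexed by the image of the generating set; membership in the span is therefore
  carried through the partial sums.\<close>
lemma finitely_generated_image:
  assumes "module Q M" "module Q N" and h: "h \<in> linear_maps Q M N"
    and surj: "\<And>y. y \<in> carrier N \<Longrightarrow> \<exists>x \<in> carrier M. h x = y"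
    and fg: "finitely_generated Q M"
  shows "finitely_generated Q N"
proof -
  interpret h: linear_map Q M N h
    using assms(1,2) h by (intro linear_map.intro linear_map_axioms.intro)
  obtain A where A: "A \<subseteq> carrier M" "finite A"
    and gen: "\<And>x. x \<in> carrier M \<Longrightarrow> \<exists>c \<in> A \<rightarrow> carrier Q. x = (\<Oplus>\<^bsub>M\<^esub>a\<in>A. c a \<odot>\<^bsub>M\<^esub> a)"
    using fg unfolding finitely_generated_def by blast
  let ?B = "h ` A"
  have B: "finite ?B" "?B \<subseteq> carrier N" using A by auto
  have "y \<in> h.N.span ?B" if y: "y \<in> carrier N" for y
  proof -
    obtain x where x: "x \<in> carrier M" "h x = y" using surj[OF y] by blast
    from gen[OF x(1)] obtain c where c: "c \<in> A \<rightarrow> carrier Q" "x = (\<Oplus>\<^bsub>M\<^esub>a\<in>A. c a \<odot>\<^bsub>M\<^esub> a)"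
      by (elim bexE)
    have "(\<Oplus>\<^bsub>N\<^esub>a\<in>A'. h (c a \<odot>\<^bsub>M\<^esub> a)) \<in> h.N.span ?B" if "finite A'" "A' \<subseteq> A" for A'
      using that
    proof (induction A' rule: finite_induct)
      case empty then show ?case using h.N.span_zero[OF B] by simp
    next
      case (insert a A')
      have ca: "c i \<in> carrier Q" "i \<in> carrier M" if "i \<in> A" for i using c A that by auto
      have "h (c a \<odot>\<^bsub>M\<^esub> a) \<in> h.N.span ?B"
        using ca insert.prems h.N.span_smult_generator[OF B, of "h a" "c a"] by (simp add: h.smult)
      moreover have "(\<lambda>a. h (c a \<odot>\<^bsub>M\<^esub> a)) \<in> A' \<rightarrow> carrier N" "h (c a \<odot>\<^bsub>M\<^esub> a) \<in> carrier N"
        using ca insert.prems by auto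
      ultimately show ?case using insert h.N.span_add[OF B] by simp
    qed
    from this[OF A(2)] show ?thesis
      using x c A h.finsum[OF A(2), of "\<lambda>a. c a \<odot>\<^bsub>M\<^esub> a"] by (auto simp: Pi_def subset_iff)
  qed
  then show ?thesis unfolding finitely_generated_def h.N.span_def using B by blast
qed

lemma projective_retract:
  fixes M :: "('q, 'm, 'z) module_scheme" and N :: "('q, 'm, 'w) module_scheme"
  assumes M: "module Q M" and N: "module Q N" and \<pi>: "\<pi> \<in> linear_maps Q M N" and \<iota>: "\<iota> \<in> linear_maps Q N M"
    and ret: "\<And>y. y \<in> carrier N \<Longrightarrow> \<pi> (\<iota> y) = y" and proj: "projective Q M"
  shows "projective Q N"
proof -
  obtain I :: "'m set" and i p where i: "i \<in> linear_maps Q M (free_module Q I)"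
    and p: "p \<in> linear_maps Q (free_module Q I) M" and pi: "\<And>x. x \<in> carrier M \<Longrightarrow> p (i x) = x"
    using proj unfolding projective_def by blast
  have \<iota>M: "\<iota> y \<in> carrier M" if "y \<in> carrier N" for y using \<iota> that by (auto simp: linear_maps_def)
  have iF: "i x \<in> carrier (free_module Q I)" if "x \<in> carrier M" for x
    using i that by (auto simp: linear_maps_def)
  have 1: "compose (carrier N) i \<iota> \<in> linear_maps Q N (free_module Q I)"
    by (rule linear_maps_compose[OF \<iota> i N])
  have 2: "compose (carrier (free_module Q I)) \<pi> p \<in> linear_maps Q (free_module Q I) N"
  proof -
    interpret Q: cring Q using M by (rule module.axioms)
    have cl: "u \<oplus>\<^bsub>free_module Q I\<^esub> v \<in> carrier (free_module Q I)"
      if uv: "u \<in> carrier (free_module Q I)" "v \<in> carrier (free_module Q I)" for u v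
    proof -
      have fin: "finite {i \<in> I. u i \<noteq> \<zero>\<^bsub>Q\<^esub>}" "finite {i \<in> I. v i \<noteq> \<zero>\<^bsub>Q\<^esub>}"
        using uv by (auto simp: free_module_def)
      have "{i \<in> I. (u \<oplus>\<^bsub>free_module Q I\<^esub> v) i \<noteq> \<zero>\<^bsub>Q\<^esub>} \<subseteq> {i \<in> I. u i \<noteq> \<zero>\<^bsub>Q\<^esub>} \<union> {i \<in> I. v i \<noteq> \<zero>\<^bsub>Q\<^esub>}"
        by (auto simp: free_module_def)
      then have "finite {i \<in> I. (u \<oplus>\<^bsub>free_module Q I\<^esub> v) i \<noteq> \<zero>\<^bsub>Q\<^esub>}"
        using fin by (meson finite_UnI finite_subset)
      then show ?thesis using uv by (auto simp: free_module_def PiE_iff)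
    qed
    have cl': "a \<odot>\<^bsub>free_module Q I\<^esub> u \<in> carrier (free_module Q I)"
      if u: "u \<in> carrier (free_module Q I)" and a: "a \<in> carrier Q" for a u
    proof -
      have fin: "finite {i \<in> I. u i \<noteq> \<zero>\<^bsub>Q\<^esub>}" using u by (auto simp: free_module_def)
      have "{i \<in> I. (a \<odot>\<^bsub>free_module Q I\<^esub> u) i \<noteq> \<zero>\<^bsub>Q\<^esub>} \<subseteq> {i \<in> I. u i \<noteq> \<zero>\<^bsub>Q\<^esub>}"
        using a by (auto simp: free_module_def)
      then have "finite {i \<in> I. (a \<odot>\<^bsub>free_module Q I\<^esub> u) i \<noteq> \<zero>\<^bsub>Q\<^esub>}"
        using fin by (meson finite_subset)
      then show ?thesis using u a by (auto simp: free_module_def PiE_iff)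
    qed
    have pM: "p u \<in> carrier M" if "u \<in> carrier (free_module Q I)" for u
      using p that by (auto simp: linear_maps_def)
    show ?thesis
      using p \<pi> pM cl cl' by (intro linear_mapsI) (auto simp: compose_def linear_maps_def)
  qed
  have "compose (carrier (free_module Q I)) \<pi> p (compose (carrier N) i \<iota> y) = y" if "y \<in> carrier N" for y
    using that \<iota>M iF pi ret by (simp add: compose_def)
  then show ?thesis unfolding projective_def using 1 2 by blast
qed

text \<open>The projection onto a direct summand is a linear map, and it commutes with every linear map
  that preserves both summands.  For the parity decomposition this is what turns the commutation
  property of the bicommutant into preservation of the grading.\<close>
lemma (in module) exists_projection:
  assumes E: "submodule E R M" and F: "submodule F R M"
    and disj: "E \<inter> F = {\<zero>\<^bsub>M\<^esub>}" and sum: "E <+>\<^bsub>M\<^esub> F = carrier M"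
  shows "\<exists>p \<in> linear_maps R M M. (\<forall>x \<in> carrier M. p x = x \<longleftrightarrow> x \<in> E) \<and>
    (\<forall>x \<in> carrier M. p x = \<zero>\<^bsub>M\<^esub> \<longleftrightarrow> x \<in> F)"
proof -
  note E' = submoduleE[OF E] and F' = submoduleE[OF F]
  have EM: "u \<in> carrier M" if "u \<in> E" for u using E'(1) that by blast
  have FM: "u \<in> carrier M" if "u \<in> F" for u using F'(1) that by blast
  have z: "\<zero>\<^bsub>M\<^esub> \<in> E" "\<zero>\<^bsub>M\<^esub> \<in> F" using disj by auto
  have dec: "\<exists>u. u \<in> E \<and> (\<exists>v \<in> F. x = u \<oplus>\<^bsub>M\<^esub> v)" if "x \<in> carrier M" for x
    using that unfolding sum[symmetric] set_add_def' by blast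
  have unique: "u = u'" if "u \<in> E" "v \<in> F" "u' \<in> E" "v' \<in> F" "u \<oplus>\<^bsub>M\<^esub> v = u' \<oplus>\<^bsub>M\<^esub> v'" for u v u' v'
  proof -
    have c: "u \<in> carrier M" "v \<in> carrier M" "u' \<in> carrier M" "v' \<in> carrier M"
      using that EM FM by blast+
    have "u = (u' \<oplus>\<^bsub>M\<^esub> v') \<oplus>\<^bsub>M\<^esub> \<ominus>\<^bsub>M\<^esub> v"
      unfolding that(5)[symmetric] using c by (simp add: M.a_assoc M.r_neg)
    then have "u \<oplus>\<^bsub>M\<^esub> \<ominus>\<^bsub>M\<^esub> u' = v' \<oplus>\<^bsub>M\<^esub> \<ominus>\<^bsub>M\<^esub> v"
      using c by (simp add: M.a_assoc M.a_comm[of u'] M.r_neg M.l_neg)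
    moreover have "u \<oplus>\<^bsub>M\<^esub> \<ominus>\<^bsub>M\<^esub> u' \<in> E" using that by (intro E'(3,5))
    moreover have "v' \<oplus>\<^bsub>M\<^esub> \<ominus>\<^bsub>M\<^esub> v \<in> F" using that by (intro F'(3,5))
    ultimately have "u \<oplus>\<^bsub>M\<^esub> \<ominus>\<^bsub>M\<^esub> u' = \<zero>\<^bsub>M\<^esub>" using disj by auto
    then show "u = u'" using c by (metis M.minus_equality M.minus_minus M.a_inv_closed M.a_comm)
  qed
  obtain p0 where p0: "\<And>x. x \<in> carrier M \<Longrightarrow> p0 x \<in> E \<and> (\<exists>v \<in> F. x = p0 x \<oplus>\<^bsub>M\<^esub> v)"
    using dec by metis
  define p where "p = (\<lambda>x\<in>carrier M. p0 x)"
  have pE: "p x \<in> E" if "x \<in> carrier M" for x using p0[OF that] that by (simp add: p_def)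
  have pI: "p x = u" if "u \<in> E" "v \<in> F" "x = u \<oplus>\<^bsub>M\<^esub> v" for x u v
  proof -
    have x: "x \<in> carrier M" using that EM FM by simp
    obtain w where "w \<in> F" "x = p0 x \<oplus>\<^bsub>M\<^esub> w" using p0[OF x] by blast
    then show ?thesis using unique[of "p0 x" w u v] that p0[OF x] x by (simp add: p_def)
  qed
  have pD: "\<exists>v \<in> F. x = p x \<oplus>\<^bsub>M\<^esub> v" if "x \<in> carrier M" for x
    using p0[OF that] that by (simp add: p_def)
  have "p \<in> linear_maps R M M"
  proof (rule linear_mapsI)
    show "p \<in> extensional (carrier M)" by (simp add: p_def)
    show "p x \<in> carrier M" if "x \<in> carrier M" for x using EM pE[OF that] .
    fix x y assume xy: "x \<in> carrier M" "y \<in> carrier M"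
    obtain v w where v: "v \<in> F" "x = p x \<oplus>\<^bsub>M\<^esub> v" and w: "w \<in> F" "y = p y \<oplus>\<^bsub>M\<^esub> w"
      using pD xy by metis
    have "x \<oplus>\<^bsub>M\<^esub> y = (p x \<oplus>\<^bsub>M\<^esub> v) \<oplus>\<^bsub>M\<^esub> (p y \<oplus>\<^bsub>M\<^esub> w)" using v(2) w(2) by simp
    also have "\<dots> = (p x \<oplus>\<^bsub>M\<^esub> p y) \<oplus>\<^bsub>M\<^esub> (v \<oplus>\<^bsub>M\<^esub> w)"
      using EM[OF pE[OF xy(1)]] EM[OF pE[OF xy(2)]] FM[OF v(1)] FM[OF w(1)] by (simp only: M.a_ac M.add.m_closed)
    finally show "p (x \<oplus>\<^bsub>M\<^esub> y) = p x \<oplus>\<^bsub>M\<^esub> p y"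
      by (rule pI[OF E'(5)[OF pE[OF xy(1)] pE[OF xy(2)]] F'(5)[OF v(1) w(1)]])
  next
    fix a x assume a: "a \<in> carrier R" and x: "x \<in> carrier M"
    obtain v where v: "v \<in> F" "x = p x \<oplus>\<^bsub>M\<^esub> v" using pD x by metis
    have "a \<odot>\<^bsub>M\<^esub> x = a \<odot>\<^bsub>M\<^esub> (p x \<oplus>\<^bsub>M\<^esub> v)" using v(2) by simp
    also have "\<dots> = a \<odot>\<^bsub>M\<^esub> p x \<oplus>\<^bsub>M\<^esub> a \<odot>\<^bsub>M\<^esub> v"
      using smult_r_distr[OF a EM[OF pE[OF x]] FM[OF v(1)]] .
    finally show "p (a \<odot>\<^bsub>M\<^esub> x) = a \<odot>\<^bsub>M\<^esub> p x"
      by (rule pI[OF E'(4)[OF a pE[OF x]] F'(4)[OF a v(1)]])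
  qed
  moreover have "p x = x \<longleftrightarrow> x \<in> E" if "x \<in> carrier M" for x
    using pE[OF that] pI[of x "\<zero>\<^bsub>M\<^esub>" x] z that by auto
  moreover have "p x = \<zero>\<^bsub>M\<^esub> \<longleftrightarrow> x \<in> F" if "x \<in> carrier M" for x
    using pD[OF that] pI[of "\<zero>\<^bsub>M\<^esub>" x x] z that FM by auto
  ultimately show ?thesis by blast
qed

section \<open>Elimination for systems of linear relations\<close>

text \<open>A determinant-free form of the fact that the determinant of a square matrix of relations
  among generators kills the module.  Multiplying row \<open>i\<close> by the pivot \<open>p x x\<close> and subtracting
  \<open>p i x\<close> times row \<open>x\<close> removes the generator \<open>x\<close> from the other relations.  The families \<open>T\<close>
  (diagonal entries) and \<open>L\<close> (entries off the diagonal) record the shape that this step preserves,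
  and the index \<open>d\<close> is a degree that doubles at each step.  With monic polynomials and
  polynomials of lower degree this yields integral equations, with \<open>1 + I\<close> and an ideal \<open>I\<close> it
  yields Nakayama's lemma.\<close>
lemma (in module) elimination:
  fixes T L :: "nat \<Rightarrow> 'a set"
  assumes fin: "finite A" and sub: "A \<subseteq> carrier M"
    and TR: "\<And>d. T d \<subseteq> carrier R" and LR: "\<And>d. L d \<subseteq> carrier R"
    and one: "\<one> \<in> T 0"
    and mult: "\<And>d d' t t'. \<lbrakk>t \<in> T d; t' \<in> T d'\<rbrakk> \<Longrightarrow> t \<otimes> t' \<in> T (d + d')"
    and diag: "\<And>d t t' l l'. \<lbrakk>t \<in> T d; t' \<in> T d; l \<in> L d; l' \<in> L d\<rbrakk>
      \<Longrightarrow> t \<otimes> t' \<ominus> l \<otimes> l' \<in> T (d + d)"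
    and off: "\<And>d t l l' l''. \<lbrakk>t \<in> T d; l \<in> L d; l' \<in> L d; l'' \<in> L d\<rbrakk>
      \<Longrightarrow> t \<otimes> l \<ominus> l' \<otimes> l'' \<in> L (d + d)"
    and p_diag: "\<And>i. i \<in> A \<Longrightarrow> p i i \<in> T d"
    and p_off: "\<And>i j. \<lbrakk>i \<in> A; j \<in> A; i \<noteq> j\<rbrakk> \<Longrightarrow> p i j \<in> L d"
    and rel: "\<And>i. i \<in> A \<Longrightarrow> (\<Oplus>\<^bsub>M\<^esub>j\<in>A. p i j \<odot>\<^bsub>M\<^esub> j) = \<zero>\<^bsub>M\<^esub>"
  shows "\<exists>d'. \<exists>t \<in> T d'. \<forall>i \<in> A. t \<odot>\<^bsub>M\<^esub> i = \<zero>\<^bsub>M\<^esub>"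
  using fin sub p_diag p_off rel
proof (induction A arbitrary: p d rule: finite_induct)
  case empty
  then show ?case using one by blast
next
  case (insert x A)
  let ?u = "p x x"
  have x: "x \<in> carrier M" and A: "A \<subseteq> carrier M" using insert.prems(1) by auto
  have pR: "p i j \<in> carrier R" if "i \<in> insert x A" "j \<in> insert x A" for i j
    using insert.prems(2)[OF that(1)] insert.prems(3)[OF that] TR LR by (cases "i = j") blast+
  note u = pR[of x x, simplified]
  have cl: "(\<lambda>j. p i j \<odot>\<^bsub>M\<^esub> j) \<in> A \<rightarrow> carrier M" if "i \<in> insert x A" for i
    using pR[OF that] A by (auto intro!: smult_closed)
  have split: "p i x \<odot>\<^bsub>M\<^esub> x \<oplus>\<^bsub>M\<^esub> (\<Oplus>\<^bsub>M\<^esub>j\<in>A. p i j \<odot>\<^bsub>M\<^esub> j) = \<zero>\<^bsub>M\<^esub>" if "i \<in> insert x A" for i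
    using insert.prems(4)[OF that] insert.hyps cl[OF that] pR[OF that] x by simp
  have sum: "(\<Oplus>\<^bsub>M\<^esub>j\<in>A. p i j \<odot>\<^bsub>M\<^esub> j) = \<ominus>\<^bsub>M\<^esub> (p i x \<odot>\<^bsub>M\<^esub> x)" if "i \<in> insert x A" for i
  proof -
    have "p i x \<odot>\<^bsub>M\<^esub> x \<in> carrier M" "(\<Oplus>\<^bsub>M\<^esub>j\<in>A. p i j \<odot>\<^bsub>M\<^esub> j) \<in> carrier M"
      using cl[OF that] pR[OF that] x by auto
    then show ?thesis using split[OF that] by (metis M.a_comm M.minus_equality)
  qed
  \<comment> \<open>the matrix of the relations that remain after eliminating \<open>x\<close>\<close>
  define q where "q i j = ?u \<otimes> p i j \<ominus> p i x \<otimes> p x j" for i j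
  have "\<exists>d'. \<exists>t \<in> T d'. \<forall>i \<in> A. t \<odot>\<^bsub>M\<^esub> i = \<zero>\<^bsub>M\<^esub>"
  proof (rule insert.IH[where p = q and d = "d + d"])
    show "A \<subseteq> carrier M" by fact
    show "q i i \<in> T (d + d)" if "i \<in> A" for i
      unfolding q_def using that insert.hyps
      by (intro diag insert.prems) auto
    show "q i j \<in> L (d + d)" if "i \<in> A" "j \<in> A" "i \<noteq> j" for i j
      unfolding q_def using that insert.hyps by (intro off insert.prems) auto
    show "(\<Oplus>\<^bsub>M\<^esub>j\<in>A. q i j \<odot>\<^bsub>M\<^esub> j) = \<zero>\<^bsub>M\<^esub>" if i: "i \<in> A" for i
    proof -
      have pix: "p i x \<in> carrier R" using i pR by auto
      have "(\<Oplus>\<^bsub>M\<^esub>j\<in>A. q i j \<odot>\<^bsub>M\<^esub> j)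
          = (\<Oplus>\<^bsub>M\<^esub>j\<in>A. ?u \<odot>\<^bsub>M\<^esub> (p i j \<odot>\<^bsub>M\<^esub> j) \<oplus>\<^bsub>M\<^esub> (\<ominus> p i x) \<odot>\<^bsub>M\<^esub> (p x j \<odot>\<^bsub>M\<^esub> j))"
      proof (rule M.finsum_cong')
        fix j assume j: "j \<in> A"
        have c: "p i j \<in> carrier R" "p x j \<in> carrier R" "j \<in> carrier M" using i j pR A by auto
        then show "q i j \<odot>\<^bsub>M\<^esub> j
            = ?u \<odot>\<^bsub>M\<^esub> (p i j \<odot>\<^bsub>M\<^esub> j) \<oplus>\<^bsub>M\<^esub> (\<ominus> p i x) \<odot>\<^bsub>M\<^esub> (p x j \<odot>\<^bsub>M\<^esub> j)"
          unfolding q_def using u pix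
          by (simp add: a_minus_def smult_l_distr smult_assoc1[symmetric] R.l_minus)
      qed (use i pR A u pix in \<open>auto intro!: smult_closed\<close>)
      also have "\<dots> = (\<Oplus>\<^bsub>M\<^esub>j\<in>A. ?u \<odot>\<^bsub>M\<^esub> (p i j \<odot>\<^bsub>M\<^esub> j))
          \<oplus>\<^bsub>M\<^esub> (\<Oplus>\<^bsub>M\<^esub>j\<in>A. (\<ominus> p i x) \<odot>\<^bsub>M\<^esub> (p x j \<odot>\<^bsub>M\<^esub> j))"
        using i pR A u pix by (intro M.finsum_addf) (auto intro!: smult_closed)
      also have "\<dots> = ?u \<odot>\<^bsub>M\<^esub> (\<Oplus>\<^bsub>M\<^esub>j\<in>A. p i j \<odot>\<^bsub>M\<^esub> j) \<oplus>\<^bsub>M\<^esub> (\<ominus> p i x) \<odot>\<^bsub>M\<^esub> (\<Oplus>\<^bsub>M\<^esub>j\<in>A. p x j \<odot>\<^bsub>M\<^esub> j)"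
        using insert.hyps(1) u pix cl[of i] cl[of x] i by (simp add: finsum_smult_ldistr)
      also have "\<dots> = ?u \<odot>\<^bsub>M\<^esub> (\<ominus>\<^bsub>M\<^esub> (p i x \<odot>\<^bsub>M\<^esub> x)) \<oplus>\<^bsub>M\<^esub> (\<ominus> p i x) \<odot>\<^bsub>M\<^esub> (\<ominus>\<^bsub>M\<^esub> (?u \<odot>\<^bsub>M\<^esub> x))"
        using i by (simp add: sum)
      also have "\<dots> = \<zero>\<^bsub>M\<^esub>"
        using u pix x by (simp add: smult_r_minus smult_l_minus smult_assoc1[symmetric] R.m_comm R.r_minus M.l_neg)
      finally show ?thesis .
    qed
  qed
  then obtain d' t where t: "t \<in> T d'" and kill: "\<forall>i\<in>A. t \<odot>\<^bsub>M\<^esub> i = \<zero>\<^bsub>M\<^esub>" by blast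
  have tR: "t \<in> carrier R" using t TR by blast
  have "?u \<odot>\<^bsub>M\<^esub> x = \<ominus>\<^bsub>M\<^esub> (\<Oplus>\<^bsub>M\<^esub>j\<in>A. p x j \<odot>\<^bsub>M\<^esub> j)" using sum[of x] u x by simp
  also have "t \<odot>\<^bsub>M\<^esub> \<dots> = \<ominus>\<^bsub>M\<^esub> (\<Oplus>\<^bsub>M\<^esub>j\<in>A. t \<odot>\<^bsub>M\<^esub> (p x j \<odot>\<^bsub>M\<^esub> j))"
    using tR cl[of x] insert.hyps(1) by (simp add: smult_r_minus finsum_smult_ldistr)
  also have "(\<Oplus>\<^bsub>M\<^esub>j\<in>A. t \<odot>\<^bsub>M\<^esub> (p x j \<odot>\<^bsub>M\<^esub> j)) = \<zero>\<^bsub>M\<^esub>"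
  proof (intro M.add.finprod_one_eqI)
    fix j assume j: "j \<in> A"
    have c: "p x j \<in> carrier R" "j \<in> carrier M" using j pR A by auto
    have "t \<odot>\<^bsub>M\<^esub> (p x j \<odot>\<^bsub>M\<^esub> j) = p x j \<odot>\<^bsub>M\<^esub> (t \<odot>\<^bsub>M\<^esub> j)"
      using c tR by (simp add: smult_assoc1[symmetric] R.m_comm)
    then show "t \<odot>\<^bsub>M\<^esub> (p x j \<odot>\<^bsub>M\<^esub> j) = \<zero>\<^bsub>M\<^esub>" using kill j c by simp
  qed
  finally have kx: "t \<odot>\<^bsub>M\<^esub> (?u \<odot>\<^bsub>M\<^esub> x) = \<zero>\<^bsub>M\<^esub>" by simp
  have "(t \<otimes> ?u) \<odot>\<^bsub>M\<^esub> i = \<zero>\<^bsub>M\<^esub>" if "i \<in> insert x A" for i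
  proof (cases "i = x")
    case True then show ?thesis using kx tR u x by (simp add: smult_assoc1)
  next
    case False
    then have "i \<in> A" "i \<in> carrier M" using that A by auto
    then show ?thesis using kill tR u by (simp add: R.m_comm[of t] smult_assoc1)
  qed
  moreover have "t \<otimes> ?u \<in> T (d' + d)" using t insert.prems(2) mult by blast
  ultimately show ?case by blast
qed

section \<open>The bicommutant of an endomorphism\<close>

text \<open>Unlike the subring generated by \<open>e\<close> and the scalars, the bicommutant contains the inverses of those of its
  elements that are bijective.  It is commutative: its elements commute with \<open>e\<close> (take \<open>t = e\<close>),
  and hence with one another.\<close>
definition bicommutant ::
  "('a, 'r) ring_scheme \<Rightarrow> ('a, 'b, 'm) module_scheme \<Rightarrow> ('b \<Rightarrow> 'b) \<Rightarrow> ('b \<Rightarrow> 'b) ring" where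
  "bicommutant Q M e =
    \<lparr>carrier = {s \<in> linear_maps Q M M. \<forall>t \<in> linear_maps Q M M.
        (\<forall>x \<in> carrier M. t (e x) = e (t x)) \<longrightarrow> (\<forall>x \<in> carrier M. s (t x) = t (s x))},
     monoid.mult = compose (carrier M), one = (\<lambda>x\<in>carrier M. x),
     zero = (\<lambda>x\<in>carrier M. \<zero>\<^bsub>M\<^esub>), add = (\<lambda>s t. \<lambda>x\<in>carrier M. s x \<oplus>\<^bsub>M\<^esub> t x)\<rparr>"

locale module_endomorphism = module R M for R (structure) and M (structure) +
  fixes e assumes endo: "e \<in> linear_maps R M M"
begin

abbreviation S where "S \<equiv> bicommutant R M e"

definition scalar where "scalar a = (\<lambda>x\<in>carrier M. a \<odot>\<^bsub>M\<^esub> x)"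

text \<open>\<open>M\<close> as a module over the bicommutant, so that facts about modules over a commutative ring
  apply to operators.\<close>
definition tautological_module where
  "tautological_module = \<lparr>carrier = carrier M, monoid.mult = monoid.mult M, one = one M,
     zero = \<zero>\<^bsub>M\<^esub>, add = (\<oplus>\<^bsub>M\<^esub>), smult = (\<lambda>s x. s x)\<rparr>"

lemma linear_mapsD:
  assumes "h \<in> linear_maps R M M"
  shows "x \<in> carrier M \<Longrightarrow> h x \<in> carrier M"
    and "\<lbrakk>x \<in> carrier M; y \<in> carrier M\<rbrakk> \<Longrightarrow> h (x \<oplus>\<^bsub>M\<^esub> y) = h x \<oplus>\<^bsub>M\<^esub> h y"
    and "\<lbrakk>a \<in> carrier R; x \<in> carrier M\<rbrakk> \<Longrightarrow> h (a \<odot>\<^bsub>M\<^esub> x) = a \<odot>\<^bsub>M\<^esub> h x"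
    and "h \<in> extensional (carrier M)"
  using assms by (auto simp: linear_maps_def PiE_def)

lemma linear_mapI: "h \<in> linear_maps R M M \<Longrightarrow> linear_map R M M h"
  by unfold_locales

lemma in_S_iff:
  "s \<in> carrier S \<longleftrightarrow> s \<in> linear_maps R M M \<and> (\<forall>t \<in> linear_maps R M M.
        (\<forall>x \<in> carrier M. t (e x) = e (t x)) \<longrightarrow> (\<forall>x \<in> carrier M. s (t x) = t (s x)))"
  by (simp add: bicommutant_def)

lemma S_linear: "s \<in> carrier S \<Longrightarrow> s \<in> linear_maps R M M"
  by (simp add: in_S_iff)

lemma S_apply:
  shows "x \<in> carrier M \<Longrightarrow> (s \<otimes>\<^bsub>S\<^esub> t) x = s (t x)"
    and "x \<in> carrier M \<Longrightarrow> (s \<oplus>\<^bsub>S\<^esub> t) x = s x \<oplus>\<^bsub>M\<^esub> t x"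
    and "x \<in> carrier M \<Longrightarrow> \<one>\<^bsub>S\<^esub> x = x"
    and "x \<in> carrier M \<Longrightarrow> \<zero>\<^bsub>S\<^esub> x = \<zero>\<^bsub>M\<^esub>"
  by (simp_all add: bicommutant_def compose_def)

lemma S_closed_apply [simp]: "\<lbrakk>s \<in> carrier S; x \<in> carrier M\<rbrakk> \<Longrightarrow> s x \<in> carrier M"
  using S_linear linear_mapsD(1) by blast

lemma S_commute:
  assumes "s \<in> carrier S" "t \<in> linear_maps R M M" "\<And>x. x \<in> carrier M \<Longrightarrow> t (e x) = e (t x)"
    "x \<in> carrier M"
  shows "s (t x) = t (s x)"
  using assms by (simp add: in_S_iff)

lemma S_eqI:
  assumes "s \<in> carrier S" "t \<in> carrier S" "\<And>x. x \<in> carrier M \<Longrightarrow> s x = t x"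
  shows "s = t"
  using assms S_linear linear_mapsD(4) by (meson extensionalityI)

lemma in_SI:
  assumes "s \<in> extensional (carrier M)" "\<And>x. x \<in> carrier M \<Longrightarrow> s x \<in> carrier M"
    and "\<And>x y. \<lbrakk>x \<in> carrier M; y \<in> carrier M\<rbrakk> \<Longrightarrow> s (x \<oplus>\<^bsub>M\<^esub> y) = s x \<oplus>\<^bsub>M\<^esub> s y"
    and "\<And>a x. \<lbrakk>a \<in> carrier R; x \<in> carrier M\<rbrakk> \<Longrightarrow> s (a \<odot>\<^bsub>M\<^esub> x) = a \<odot>\<^bsub>M\<^esub> s x"
    and "\<And>t x. \<lbrakk>t \<in> linear_maps R M M; \<And>x. x \<in> carrier M \<Longrightarrow> t (e x) = e (t x); x \<in> carrier M\<rbrakk>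
      \<Longrightarrow> s (t x) = t (s x)"
  shows "s \<in> carrier S"
proof -
  have "s \<in> linear_maps R M M"
    using assms(1-4) by (simp add: linear_maps_def PiE_def)
  then show ?thesis using assms(5) unfolding in_S_iff by blast
qed

lemma S_e_commute: "\<lbrakk>t \<in> carrier S; x \<in> carrier M\<rbrakk> \<Longrightarrow> t (e x) = e (t x)"
  by (rule S_commute[OF _ endo]) auto

lemma S_mult_comm_apply: "\<lbrakk>s \<in> carrier S; t \<in> carrier S; x \<in> carrier M\<rbrakk> \<Longrightarrow> s (t x) = t (s x)"
  by (rule S_commute[OF _ S_linear]) (auto simp: S_e_commute)

lemma e_in_S: "e \<in> carrier S"
  using endo by (auto simp: in_S_iff)

lemma S_mult_closed: assumes "s \<in> carrier S" "t \<in> carrier S" shows "s \<otimes>\<^bsub>S\<^esub> t \<in> carrier S"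
proof (rule in_SI)
  show "s \<otimes>\<^bsub>S\<^esub> t \<in> extensional (carrier M)" by (simp add: bicommutant_def)
qed (use assms in \<open>auto simp: S_apply S_linear linear_mapsD S_commute\<close>)

lemma S_add_closed: assumes "s \<in> carrier S" "t \<in> carrier S" shows "s \<oplus>\<^bsub>S\<^esub> t \<in> carrier S"
proof (rule in_SI)
  show "s \<oplus>\<^bsub>S\<^esub> t \<in> extensional (carrier M)" by (simp add: bicommutant_def)
  fix x y assume xy: "x \<in> carrier M" "y \<in> carrier M"
  show "(s \<oplus>\<^bsub>S\<^esub> t) (x \<oplus>\<^bsub>M\<^esub> y) = (s \<oplus>\<^bsub>S\<^esub> t) x \<oplus>\<^bsub>M\<^esub> (s \<oplus>\<^bsub>S\<^esub> t) y"
    using assms xy by (simp add: S_apply S_linear linear_mapsD M.a_ac)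
next
  fix u x assume u: "u \<in> linear_maps R M M" "\<And>x. x \<in> carrier M \<Longrightarrow> u (e x) = e (u x)"
    and x: "x \<in> carrier M"
  show "(s \<oplus>\<^bsub>S\<^esub> t) (u x) = u ((s \<oplus>\<^bsub>S\<^esub> t) x)"
    using S_commute[OF assms(1) u x] S_commute[OF assms(2) u x] assms x linear_mapsD[OF u(1)]
    by (simp add: S_apply)
qed (use assms in \<open>auto simp: S_apply S_linear linear_mapsD smult_r_distr\<close>)

lemma scalar_in_S: assumes "a \<in> carrier R" shows "scalar a \<in> carrier S"
proof (rule in_SI)
  fix b x assume "b \<in> carrier R" "x \<in> carrier M"
  then show "scalar a (b \<odot>\<^bsub>M\<^esub> x) = b \<odot>\<^bsub>M\<^esub> scalar a x"
    using assms by (simp add: scalar_def smult_assoc1[symmetric] R.m_comm)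
qed (use assms in \<open>auto simp: scalar_def linear_mapsD smult_r_distr\<close>)

lemma scalar_apply: "x \<in> carrier M \<Longrightarrow> scalar a x = a \<odot>\<^bsub>M\<^esub> x"
  by (simp add: scalar_def)

lemma S_one_closed: "\<one>\<^bsub>S\<^esub> \<in> carrier S"
proof -
  have "\<one>\<^bsub>S\<^esub> = scalar \<one>" by (auto simp: scalar_def bicommutant_def)
  then show ?thesis using scalar_in_S by simp
qed

lemma S_zero_closed: "\<zero>\<^bsub>S\<^esub> \<in> carrier S"
proof -
  have "\<zero>\<^bsub>S\<^esub> = scalar \<zero>" by (auto simp: scalar_def bicommutant_def)
  then show ?thesis using scalar_in_S by simp
qed

lemma cring_S: "cring S"
proof (intro cringI abelian_groupI comm_monoidI)
  fix s assume s: "s \<in> carrier S"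
  have "scalar (\<ominus> \<one>) \<otimes>\<^bsub>S\<^esub> s \<oplus>\<^bsub>S\<^esub> s = \<zero>\<^bsub>S\<^esub>"
    by (rule S_eqI)
       (use s in \<open>auto simp: S_apply scalar_apply scalar_in_S S_mult_closed S_add_closed S_zero_closed
          smult_l_minus M.l_neg\<close>)
  then show "\<exists>t\<in>carrier S. t \<oplus>\<^bsub>S\<^esub> s = \<zero>\<^bsub>S\<^esub>"
    using s scalar_in_S S_mult_closed by (metis R.a_inv_closed R.one_closed)
next
  fix s t assume "s \<in> carrier S" "t \<in> carrier S"
  then show "s \<otimes>\<^bsub>S\<^esub> t = t \<otimes>\<^bsub>S\<^esub> s"
    by (intro S_eqI) (auto simp: S_apply S_mult_closed S_mult_comm_apply)
qed (auto intro!: S_eqI simp: S_apply S_mult_closed S_add_closed S_zero_closed S_one_closed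
    S_linear linear_mapsD M.a_ac)

sublocale S: cring S by (rule cring_S)

lemma S_neg_apply: assumes "s \<in> carrier S" "x \<in> carrier M" shows "(\<ominus>\<^bsub>S\<^esub> s) x = \<ominus>\<^bsub>M\<^esub> s x"
proof -
  have "(\<ominus>\<^bsub>S\<^esub> s) x \<oplus>\<^bsub>M\<^esub> s x = (\<ominus>\<^bsub>S\<^esub> s \<oplus>\<^bsub>S\<^esub> s) x"
    using assms by (simp only: S_apply)
  also have "\<dots> = \<zero>\<^bsub>M\<^esub>" using assms by (simp add: S.l_neg S_apply)
  finally show ?thesis using assms by (simp add: M.minus_equality)
qed

lemma S_minus_apply:
  "\<lbrakk>s \<in> carrier S; t \<in> carrier S; x \<in> carrier M\<rbrakk> \<Longrightarrow> (s \<ominus>\<^bsub>S\<^esub> t) x = s x \<ominus>\<^bsub>M\<^esub> t x"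
  by (simp add: a_minus_def S_apply S_neg_apply)

lemma scalar_hom: "scalar \<in> ring_hom R S"
proof (rule ring_hom_memI)
  fix a b assume ab: "a \<in> carrier R" "b \<in> carrier R"
  show "scalar (a \<otimes> b) = scalar a \<otimes>\<^bsub>S\<^esub> scalar b"
    by (rule S_eqI) (use ab in \<open>auto simp: S_apply scalar_apply scalar_in_S smult_assoc1\<close>)
  show "scalar (a \<oplus> b) = scalar a \<oplus>\<^bsub>S\<^esub> scalar b"
    by (rule S_eqI) (use ab in \<open>auto simp: S_apply scalar_apply scalar_in_S smult_l_distr\<close>)
next
  show "scalar \<one> = \<one>\<^bsub>S\<^esub>"
    by (rule S_eqI) (auto simp: S_apply scalar_apply scalar_in_S)
qed (rule scalar_in_S)

lemma scalar_mult: "\<lbrakk>a \<in> carrier R; b \<in> carrier R\<rbrakk> \<Longrightarrow> scalar (a \<otimes> b) = scalar a \<otimes>\<^bsub>S\<^esub> scalar b"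
  and scalar_add: "\<lbrakk>a \<in> carrier R; b \<in> carrier R\<rbrakk> \<Longrightarrow> scalar (a \<oplus> b) = scalar a \<oplus>\<^bsub>S\<^esub> scalar b"
  and scalar_one: "scalar \<one> = \<one>\<^bsub>S\<^esub>"
  using scalar_hom by (simp_all add: ring_hom_mult ring_hom_add ring_hom_one)

lemma scalar_zero: "scalar \<zero> = \<zero>\<^bsub>S\<^esub>"
  by (rule S_eqI) (auto simp: S_apply scalar_apply scalar_in_S)

lemma scalar_neg: "a \<in> carrier R \<Longrightarrow> scalar (\<ominus> a) = \<ominus>\<^bsub>S\<^esub> scalar a"
  by (rule S_eqI) (auto simp: S_neg_apply scalar_apply scalar_in_S smult_l_minus)

lemma tautological_module: "module S tautological_module"
proof (rule moduleI)
  show "abelian_group tautological_module"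
    by (rule abelian_groupI)
       (auto simp: tautological_module_def M.a_ac intro!: bexI[of _ "\<ominus>\<^bsub>M\<^esub> _"] M.l_neg)
qed (use cring_S in \<open>auto simp: tautological_module_def S_apply S_linear linear_mapsD\<close>)

lemma finsum_tautological:
  assumes "f \<in> A \<rightarrow> carrier M"
  shows "(\<Oplus>\<^bsub>tautological_module\<^esub>i\<in>A. f i) = (\<Oplus>\<^bsub>M\<^esub>i\<in>A. f i)"
  by (simp add: finsum_def finprod_def tautological_module_def)

lemma tautological_simps [simp]:
  "carrier tautological_module = carrier M" "zero tautological_module = \<zero>\<^bsub>M\<^esub>"
  "smult tautological_module s x = s x" "add tautological_module = add M"
  by (simp_all add: tautological_module_def)

end

section \<open>Integrality and Nakayama's lemma\<close>

context UP_cring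
begin

text \<open>Vanishing of coefficients is used instead of a bound on the degree because the zero
  polynomial has degree \<open>0\<close> here: \<open>below 0\<close> has to consist of \<open>0\<close> alone for \<open>below\<close> to be
  multiplicative.\<close>
definition below where "below d = {p \<in> carrier P. \<forall>n\<ge>d. coeff P p n = \<zero>}"

definition monic_of_degree where
  "monic_of_degree d = {monom P \<one> d \<oplus>\<^bsub>P\<^esub> l | l. l \<in> below d}"

lemma below_carrier: "p \<in> below d \<Longrightarrow> p \<in> carrier P"
  by (simp add: below_def)

lemma monic_carrier: "p \<in> monic_of_degree d \<Longrightarrow> p \<in> carrier P"
  by (auto simp: monic_of_degree_def below_def)

lemma below_zero: "p \<in> below 0 \<Longrightarrow> p = \<zero>\<^bsub>P\<^esub>"
  by (auto simp: below_def intro!: up_eqI)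

lemma below_deg: assumes "p \<in> below d" "d > 0" shows "deg R p < d"
proof -
  have "deg R p \<le> d - 1" using assms by (intro deg_aboveI) (auto simp: below_def)
  then show ?thesis using assms by simp
qed

lemma below_add: "\<lbrakk>p \<in> below d; q \<in> below d\<rbrakk> \<Longrightarrow> p \<oplus>\<^bsub>P\<^esub> q \<in> below d"
  by (auto simp: below_def)

lemma below_mult: assumes "p \<in> below d" "q \<in> below d'" shows "p \<otimes>\<^bsub>P\<^esub> q \<in> below (d + d')"
proof (cases "d = 0 \<or> d' = 0")
  case True
  then have "p \<otimes>\<^bsub>P\<^esub> q = \<zero>\<^bsub>P\<^esub>" using assms below_zero by (metis P.l_null P.r_null below_carrier)
  then show ?thesis by (simp add: below_def)
next
  case False
  have pq: "p \<in> carrier P" "q \<in> carrier P" using assms below_carrier by auto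
  have "deg R (p \<otimes>\<^bsub>P\<^esub> q) < d + d'"
    using deg_mult_ring[OF pq] below_deg[OF assms(1)] below_deg[OF assms(2)] False by simp
  then show ?thesis using pq by (simp add: below_def deg_aboveD del: coeff_mult)
qed

lemma monom_mult_below: assumes "l \<in> below d'" shows "monom P \<one> d \<otimes>\<^bsub>P\<^esub> l \<in> below (d + d')"
proof -
  have l: "l \<in> carrier P" using assms below_carrier by auto
  have "coeff P (monom P \<one> d \<otimes>\<^bsub>P\<^esub> l) n = \<zero>" if "n \<ge> d + d'" for n
    using coeff_monom_mult[of \<one> l d "n - d"] l assms that by (simp add: below_def)
  then show ?thesis using l by (auto simp: below_def)
qed

lemma monic_of_degreeI: "l \<in> below d \<Longrightarrow> monom P \<one> d \<oplus>\<^bsub>P\<^esub> l \<in> monic_of_degree d"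
  by (auto simp: monic_of_degree_def)

lemma monic_mult:
  assumes "p \<in> monic_of_degree d" "q \<in> monic_of_degree d'"
  shows "p \<otimes>\<^bsub>P\<^esub> q \<in> monic_of_degree (d + d')"
proof -
  obtain l l' where l: "l \<in> below d" "p = monom P \<one> d \<oplus>\<^bsub>P\<^esub> l"
    and l': "l' \<in> below d'" "q = monom P \<one> d' \<oplus>\<^bsub>P\<^esub> l'"
    using assms by (auto simp: monic_of_degree_def)
  have c: "l \<in> carrier P" "l' \<in> carrier P" using l l' below_carrier by auto
  have "p \<otimes>\<^bsub>P\<^esub> q = monom P \<one> (d + d') \<oplus>\<^bsub>P\<^esub>
     (monom P \<one> d \<otimes>\<^bsub>P\<^esub> l' \<oplus>\<^bsub>P\<^esub> monom P \<one> d' \<otimes>\<^bsub>P\<^esub> l \<oplus>\<^bsub>P\<^esub> l \<otimes>\<^bsub>P\<^esub> l')"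
    unfolding l l' using c monom_mult[OF R.one_closed R.one_closed, of d d']
    by (simp add: P.l_distr P.r_distr P.a_ac P.m_comm del: monom_mult)
  moreover have "monom P \<one> d' \<otimes>\<^bsub>P\<^esub> l \<in> below (d + d')"
    using monom_mult_below[OF l(1), of d'] by (simp add: add.commute)
  ultimately show ?thesis
    using l l' by (auto intro!: monic_of_degreeI below_add below_mult monom_mult_below)
qed

lemma monic_add_below:
  assumes "p \<in> monic_of_degree d" "l \<in> below d" shows "p \<oplus>\<^bsub>P\<^esub> l \<in> monic_of_degree d"
proof -
  obtain l' where l': "l' \<in> below d" "p = monom P \<one> d \<oplus>\<^bsub>P\<^esub> l'"
    using assms by (auto simp: monic_of_degree_def)
  have "p \<oplus>\<^bsub>P\<^esub> l = monom P \<one> d \<oplus>\<^bsub>P\<^esub> (l' \<oplus>\<^bsub>P\<^esub> l)"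
    using l' assms below_carrier by (simp add: P.a_ac)
  then show ?thesis using l' assms by (auto intro: monic_of_degreeI below_add)
qed

lemma below_uminus: "p \<in> below d \<Longrightarrow> \<ominus>\<^bsub>P\<^esub> p \<in> below d"
  by (auto simp: below_def)

lemma monic_mult_below:
  assumes "p \<in> monic_of_degree d" "l \<in> below d'" shows "p \<otimes>\<^bsub>P\<^esub> l \<in> below (d + d')"
proof -
  obtain l' where l': "l' \<in> below d" "p = monom P \<one> d \<oplus>\<^bsub>P\<^esub> l'"
    using assms by (auto simp: monic_of_degree_def)
  then show ?thesis using assms below_carrier
    by (simp add: P.l_distr below_add below_mult monom_mult_below)
qed

lemma monic_of_degree_monic:
  assumes "\<one> \<noteq> \<zero>" "p \<in> monic_of_degree d" shows "monic R p"
proof -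
  obtain l where l: "l \<in> below d" "p = monom P \<one> d \<oplus>\<^bsub>P\<^esub> l"
    using assms by (auto simp: monic_of_degree_def)
  have lc: "l \<in> carrier P" using l below_carrier by auto
  have c: "coeff P p d = \<one>" "\<And>n. n > d \<Longrightarrow> coeff P p n = \<zero>"
    using l lc by (auto simp: below_def)
  have "deg R p = d"
    using c assms monic_carrier by (intro le_antisym deg_aboveI deg_belowI) auto
  then show ?thesis using c by (simp add: monic_def P_def)
qed

end

text \<open>The submodule \<open>I M\<close>.  The inductive form makes stability under semilinear maps a
  short induction, independent of any choice of generators.\<close>
inductive_set ideal_times ::
  "'a set \<Rightarrow> ('a, 'b, 'm) module_scheme \<Rightarrow> 'b set" for I M
where
  smult: "\<lbrakk>a \<in> I; x \<in> carrier M\<rbrakk> \<Longrightarrow> a \<odot>\<^bsub>M\<^esub> x \<in> ideal_times I M"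
| add: "\<lbrakk>x \<in> ideal_times I M; y \<in> ideal_times I M\<rbrakk> \<Longrightarrow> x \<oplus>\<^bsub>M\<^esub> y \<in> ideal_times I M"

definition (in module) generating where
  "generating A \<longleftrightarrow> finite A \<and> A \<subseteq> carrier M \<and>
     (\<forall>x \<in> carrier M. \<exists>c \<in> A \<rightarrow> carrier R. x = (\<Oplus>\<^bsub>M\<^esub>a\<in>A. c a \<odot>\<^bsub>M\<^esub> a))"

lemma (in module) ideal_times_generating:
  assumes I: "ideal I R" and A: "generating A" and x: "x \<in> ideal_times I M"
  shows "\<exists>c \<in> A \<rightarrow> I. x = (\<Oplus>\<^bsub>M\<^esub>a\<in>A. c a \<odot>\<^bsub>M\<^esub> a)"
  using x
proof induction
  case (smult a x)
  have a: "a \<in> carrier R" using smult(1) I by (meson additive_subgroup.a_subset ideal_def subsetD)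
  obtain c where c: "c \<in> A \<rightarrow> carrier R" "x = (\<Oplus>\<^bsub>M\<^esub>i\<in>A. c i \<odot>\<^bsub>M\<^esub> i)"
    using A smult(2) by (auto simp: generating_def)
  have f: "finite A" "A \<subseteq> carrier M" using A by (auto simp: generating_def)
  have "a \<odot>\<^bsub>M\<^esub> x = (\<Oplus>\<^bsub>M\<^esub>i\<in>A. a \<odot>\<^bsub>M\<^esub> (c i \<odot>\<^bsub>M\<^esub> i))"
    unfolding c(2) using c f a by (intro finsum_smult_ldistr) auto
  also have "\<dots> = (\<Oplus>\<^bsub>M\<^esub>i\<in>A. (a \<otimes> c i) \<odot>\<^bsub>M\<^esub> i)"
  proof (rule M.finsum_cong')
    show "(\<lambda>i. (a \<otimes> c i) \<odot>\<^bsub>M\<^esub> i) \<in> A \<rightarrow> carrier M" using c f a by (auto intro!: smult_closed)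
    fix i assume "i \<in> A"
    then have "c i \<in> carrier R" "i \<in> carrier M" using c f by auto
    then show "a \<odot>\<^bsub>M\<^esub> (c i \<odot>\<^bsub>M\<^esub> i) = (a \<otimes> c i) \<odot>\<^bsub>M\<^esub> i" using a by (simp add: smult_assoc1)
  qed simp
  finally have "a \<odot>\<^bsub>M\<^esub> x = (\<Oplus>\<^bsub>M\<^esub>i\<in>A. (a \<otimes> c i) \<odot>\<^bsub>M\<^esub> i)" .
  moreover have "a \<otimes> c i \<in> I" if "i \<in> A" for i
    using ideal.I_r_closed[OF I smult(1)] c(1) that by blast
  ultimately show ?case by (intro bexI[of _ "\<lambda>i. a \<otimes> c i"]) auto
next
  case (add x y)
  then obtain c c' where c: "c \<in> A \<rightarrow> I" "x = (\<Oplus>\<^bsub>M\<^esub>i\<in>A. c i \<odot>\<^bsub>M\<^esub> i)"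
    and c': "c' \<in> A \<rightarrow> I" "y = (\<Oplus>\<^bsub>M\<^esub>i\<in>A. c' i \<odot>\<^bsub>M\<^esub> i)" by blast
  interpret I: ideal I R by fact
  have f: "finite A" "A \<subseteq> carrier M" using A by (auto simp: generating_def)
  have cR: "c i \<in> carrier R" "c' i \<in> carrier R" "i \<in> carrier M" if "i \<in> A" for i
    using c c' f that I.a_subset by blast+
  have "x \<oplus>\<^bsub>M\<^esub> y = (\<Oplus>\<^bsub>M\<^esub>i\<in>A. c i \<odot>\<^bsub>M\<^esub> i \<oplus>\<^bsub>M\<^esub> c' i \<odot>\<^bsub>M\<^esub> i)"
    unfolding c(2) c'(2) using cR by (intro M.finsum_addf[symmetric]) auto
  also have "\<dots> = (\<Oplus>\<^bsub>M\<^esub>i\<in>A. (c i \<oplus> c' i) \<odot>\<^bsub>M\<^esub> i)"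
    using cR by (intro M.finsum_cong') (auto simp: smult_l_distr)
  finally show ?case using c c'
    by (intro bexI[of _ "\<lambda>i. c i \<oplus> c' i"]) (auto simp: I.a_closed)
qed

context module_endomorphism
begin

lemma S_zeroI:
  assumes A: "generating A" and s: "s \<in> carrier S" and "\<And>a. a \<in> A \<Longrightarrow> s a = \<zero>\<^bsub>M\<^esub>"
  shows "s = \<zero>\<^bsub>S\<^esub>"
proof (rule S_eqI[OF s S_zero_closed])
  fix x assume x: "x \<in> carrier M"
  obtain c where c: "c \<in> A \<rightarrow> carrier R" "x = (\<Oplus>\<^bsub>M\<^esub>i\<in>A. c i \<odot>\<^bsub>M\<^esub> i)"
    using A x by (auto simp: generating_def)
  have f: "finite A" "A \<subseteq> carrier M" using A by (auto simp: generating_def)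
  have "s x = (\<Oplus>\<^bsub>M\<^esub>i\<in>A. s (c i \<odot>\<^bsub>M\<^esub> i))"
    unfolding c(2) using c f by (intro linear_map.finsum[OF linear_mapI[OF S_linear[OF s]]]) auto
  also have "\<dots> = \<zero>\<^bsub>M\<^esub>"
  proof (rule M.add.finprod_one_eqI)
    fix i assume "i \<in> A"
    moreover have "c i \<in> carrier R" "i \<in> carrier M" using \<open>i \<in> A\<close> c f by auto
    ultimately show "s (c i \<odot>\<^bsub>M\<^esub> i) = \<zero>\<^bsub>M\<^esub>"
      using assms(3) linear_mapsD(3)[OF S_linear[OF s]] by simp
  qed
  finally show "s x = \<zero>\<^bsub>S\<^esub> x" using x by (simp add: S_apply)
qed

text \<open>If \<open>t\<close> maps each generator \<open>i\<close> to the combination with coefficients \<open>c i j\<close>, then the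
  generators satisfy the relations with matrix \<open>t \<delta>\<^bsub>i j\<^esub> - c i j\<close>.  Elimination produces an
  operator of shape \<open>T\<close> that kills all generators, that is, the operator \<open>0\<close>.\<close>
lemma determinant_trick:
  fixes T L :: "nat \<Rightarrow> ('c \<Rightarrow> 'c) set"
  assumes A: "generating A" and t: "t \<in> carrier S"
    and c: "\<And>i. i \<in> A \<Longrightarrow> c i \<in> A \<rightarrow> carrier R"
    and tc: "\<And>i. i \<in> A \<Longrightarrow> t i = (\<Oplus>\<^bsub>M\<^esub>j\<in>A. c i j \<odot>\<^bsub>M\<^esub> j)"
    and TR: "\<And>d. T d \<subseteq> carrier S" and LR: "\<And>d. L d \<subseteq> carrier S"
    and one: "\<one>\<^bsub>S\<^esub> \<in> T 0"
    and mult: "\<And>d d' t t'. \<lbrakk>t \<in> T d; t' \<in> T d'\<rbrakk> \<Longrightarrow> t \<otimes>\<^bsub>S\<^esub> t' \<in> T (d + d')"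
    and diag: "\<And>d t t' l l'. \<lbrakk>t \<in> T d; t' \<in> T d; l \<in> L d; l' \<in> L d\<rbrakk>
      \<Longrightarrow> t \<otimes>\<^bsub>S\<^esub> t' \<ominus>\<^bsub>S\<^esub> l \<otimes>\<^bsub>S\<^esub> l' \<in> T (d + d)"
    and off: "\<And>d t l l' l''. \<lbrakk>t \<in> T d; l \<in> L d; l' \<in> L d; l'' \<in> L d\<rbrakk>
      \<Longrightarrow> t \<otimes>\<^bsub>S\<^esub> l \<ominus>\<^bsub>S\<^esub> l' \<otimes>\<^bsub>S\<^esub> l'' \<in> L (d + d)"
    and c_diag: "\<And>i. i \<in> A \<Longrightarrow> t \<oplus>\<^bsub>S\<^esub> scalar (\<ominus> c i i) \<in> T d"
    and c_off: "\<And>i j. \<lbrakk>i \<in> A; j \<in> A; i \<noteq> j\<rbrakk> \<Longrightarrow> scalar (\<ominus> c i j) \<in> L d"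
  shows "\<exists>d'. \<zero>\<^bsub>S\<^esub> \<in> T d'"
proof -
  have f: "finite A" "A \<subseteq> carrier M" using A by (auto simp: generating_def)
  define p where "p i j = (if i = j then t \<oplus>\<^bsub>S\<^esub> scalar (\<ominus> c i j) else scalar (\<ominus> c i j))" for i j
  have "\<exists>d'. \<exists>u\<in>T d'. \<forall>i\<in>A. u i = \<zero>\<^bsub>M\<^esub>"
  proof (rule module.elimination[OF tautological_module f(1), of T L p d, unfolded tautological_simps])
    fix i assume i: "i \<in> A"
    have ij: "c i j \<in> carrier R" "j \<in> carrier M" if "j \<in> A" for j using c[OF i] f that by auto
    have iM: "i \<in> carrier M" using i f by auto
    have tj: "t j \<in> carrier M" if "j \<in> carrier M" for j using t that by simp
    have "(\<Oplus>\<^bsub>tautological_module\<^esub>j\<in>A. p i j j) = (\<Oplus>\<^bsub>M\<^esub>j\<in>A. p i j j)"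
      using ij t by (subst finsum_tautological) (auto simp: p_def S_apply scalar_apply)
    also have "\<dots> = (\<Oplus>\<^bsub>M\<^esub>j\<in>A. (if i = j then t j else \<zero>\<^bsub>M\<^esub>) \<oplus>\<^bsub>M\<^esub> (\<ominus> \<one>) \<odot>\<^bsub>M\<^esub> (c i j \<odot>\<^bsub>M\<^esub> j))"
    proof (rule M.finsum_cong')
      fix j assume j: "j \<in> A"
      show "p i j j = (if i = j then t j else \<zero>\<^bsub>M\<^esub>) \<oplus>\<^bsub>M\<^esub> (\<ominus> \<one>) \<odot>\<^bsub>M\<^esub> (c i j \<odot>\<^bsub>M\<^esub> j)"
        using ij[OF j] tj by (simp add: p_def S_apply scalar_apply smult_assoc1[symmetric] R.l_minus)
    qed (use ij tj in auto)
    also have "\<dots> = (\<Oplus>\<^bsub>M\<^esub>j\<in>A. if i = j then t j else \<zero>\<^bsub>M\<^esub>) \<oplus>\<^bsub>M\<^esub> (\<Oplus>\<^bsub>M\<^esub>j\<in>A. (\<ominus> \<one>) \<odot>\<^bsub>M\<^esub> (c i j \<odot>\<^bsub>M\<^esub> j))"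
      using ij tj by (intro M.finsum_addf) auto
    also have "(\<Oplus>\<^bsub>M\<^esub>j\<in>A. if i = j then t j else \<zero>\<^bsub>M\<^esub>) = t i"
      using i f tj by (intro M.finsum_singleton) auto
    also have "(\<Oplus>\<^bsub>M\<^esub>j\<in>A. (\<ominus> \<one>) \<odot>\<^bsub>M\<^esub> (c i j \<odot>\<^bsub>M\<^esub> j)) = (\<ominus> \<one>) \<odot>\<^bsub>M\<^esub> t i"
      unfolding tc[OF i] using ij f by (intro finsum_smult_ldistr[symmetric]) auto
    also have "t i \<oplus>\<^bsub>M\<^esub> (\<ominus> \<one>) \<odot>\<^bsub>M\<^esub> t i = \<zero>\<^bsub>M\<^esub>"
      using tj[OF iM] by (simp add: smult_l_minus M.r_neg)
    finally show "(\<Oplus>\<^bsub>tautological_module\<^esub>j\<in>A. p i j j) = \<zero>\<^bsub>M\<^esub>" .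
  qed (use f assms in \<open>auto simp: p_def\<close>)
  then obtain d' u where u: "u \<in> T d'" "\<forall>i\<in>A. u i = \<zero>\<^bsub>M\<^esub>" by auto
  then have "u = \<zero>\<^bsub>S\<^esub>" using S_zeroI[OF A, of u] TR by blast
  then show ?thesis using u by blast
qed

lemma eval_univ: "UP_univ_prop R S scalar e"
  using R.cring_axioms cring_S scalar_hom e_in_S
  by (intro UP_univ_prop.intro UP_pre_univ_propI UP_univ_prop_axioms.intro)

sublocale E: UP_univ_prop R S scalar "UP R" e "eval R S scalar e"
  by (rule eval_univ) simp_all

text \<open>The Cayley-Hamilton argument: the matrix \<open>e \<delta>\<^bsub>i j\<^esub> - c i j\<close> has values of monic polynomials
  of degree \<open>1\<close> on the diagonal and constants elsewhere, a shape that elimination preserves with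
  growing degree.\<close>
lemma integral_over_base:
  assumes A: "generating A" and nz: "\<one> \<noteq> \<zero>"
  shows "\<exists>p \<in> carrier (UP R). monic R p \<and> eval R S scalar e p = \<zero>\<^bsub>S\<^esub>"
proof -
  let ?ev = "eval R S scalar e"
  define T where "T d = ?ev ` E.monic_of_degree d" for d
  define L where "L d = ?ev ` E.below d" for d
  have AM: "A \<subseteq> carrier M" using A by (simp add: generating_def)
  have "\<exists>c. \<forall>i\<in>A. c i \<in> A \<rightarrow> carrier R \<and> e i = (\<Oplus>\<^bsub>M\<^esub>j\<in>A. c i j \<odot>\<^bsub>M\<^esub> j)"
    using A e_in_S AM unfolding generating_def by (intro bchoice) (meson S_closed_apply subsetD)
  then obtain c where c: "\<And>i. i \<in> A \<Longrightarrow> c i \<in> A \<rightarrow> carrier R"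
    "\<And>i. i \<in> A \<Longrightarrow> e i = (\<Oplus>\<^bsub>M\<^esub>j\<in>A. c i j \<odot>\<^bsub>M\<^esub> j)" by blast
  have const: "monom (UP R) a 0 \<in> E.below 1" if "a \<in> carrier R" for a
    using that by (auto simp: E.below_def)
  note carr = E.below_carrier E.monic_carrier
  have "\<exists>d'. \<zero>\<^bsub>S\<^esub> \<in> T d'"
  proof (rule determinant_trick[OF A e_in_S c, where L = L and d = 1])
    show "\<one>\<^bsub>S\<^esub> \<in> T 0"
    proof -
      have "\<one>\<^bsub>UP R\<^esub> \<in> E.monic_of_degree 0"
        unfolding E.monic_of_degree_def using E.monom_one
        by (auto simp: E.below_def intro!: exI[of _ "\<zero>\<^bsub>UP R\<^esub>"])
      then show ?thesis unfolding T_def by (metis E.hom_one imageI)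
    qed
  next
    fix d d' t t' assume "t \<in> T d" "t' \<in> T d'"
    then obtain p p' where p: "p \<in> E.monic_of_degree d" "p' \<in> E.monic_of_degree d'"
      "t = ?ev p" "t' = ?ev p'" by (auto simp: T_def)
    then have "t \<otimes>\<^bsub>S\<^esub> t' = ?ev (p \<otimes>\<^bsub>UP R\<^esub> p')" using carr by simp
    then show "t \<otimes>\<^bsub>S\<^esub> t' \<in> T (d + d')" unfolding T_def using p E.monic_mult by blast
  next
    fix d t t' l l' assume "t \<in> T d" "t' \<in> T d" "l \<in> L d" "l' \<in> L d"
    then obtain p p' q q' where p: "p \<in> E.monic_of_degree d" "p' \<in> E.monic_of_degree d"
      "q \<in> E.below d" "q' \<in> E.below d" "t = ?ev p" "t' = ?ev p'" "l = ?ev q" "l' = ?ev q'"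
      by (auto simp: T_def L_def)
    then have "t \<otimes>\<^bsub>S\<^esub> t' \<ominus>\<^bsub>S\<^esub> l \<otimes>\<^bsub>S\<^esub> l'
        = ?ev (p \<otimes>\<^bsub>UP R\<^esub> p' \<oplus>\<^bsub>UP R\<^esub> \<ominus>\<^bsub>UP R\<^esub> (q \<otimes>\<^bsub>UP R\<^esub> q'))"
      using carr by (simp add: a_minus_def)
    moreover have "p \<otimes>\<^bsub>UP R\<^esub> p' \<oplus>\<^bsub>UP R\<^esub> \<ominus>\<^bsub>UP R\<^esub> (q \<otimes>\<^bsub>UP R\<^esub> q') \<in> E.monic_of_degree (d + d)"
      using p by (intro E.monic_add_below E.monic_mult E.below_uminus E.below_mult)
    ultimately show "t \<otimes>\<^bsub>S\<^esub> t' \<ominus>\<^bsub>S\<^esub> l \<otimes>\<^bsub>S\<^esub> l' \<in> T (d + d)" unfolding T_def by blast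
  next
    fix d t l l' l'' assume "t \<in> T d" "l \<in> L d" "l' \<in> L d" "l'' \<in> L d"
    then obtain p q q' q'' where p: "p \<in> E.monic_of_degree d" "q'' \<in> E.below d"
      "q \<in> E.below d" "q' \<in> E.below d" "t = ?ev p" "l = ?ev q" "l' = ?ev q'" "l'' = ?ev q''"
      by (auto simp: T_def L_def)
    then have "t \<otimes>\<^bsub>S\<^esub> l \<ominus>\<^bsub>S\<^esub> l' \<otimes>\<^bsub>S\<^esub> l''
        = ?ev (p \<otimes>\<^bsub>UP R\<^esub> q \<oplus>\<^bsub>UP R\<^esub> \<ominus>\<^bsub>UP R\<^esub> (q' \<otimes>\<^bsub>UP R\<^esub> q''))"
      using carr by (simp add: a_minus_def)
    moreover have "p \<otimes>\<^bsub>UP R\<^esub> q \<oplus>\<^bsub>UP R\<^esub> \<ominus>\<^bsub>UP R\<^esub> (q' \<otimes>\<^bsub>UP R\<^esub> q'') \<in> E.below (d + d)"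
      using p by (intro E.below_add E.monic_mult_below E.below_uminus E.below_mult)
    ultimately show "t \<otimes>\<^bsub>S\<^esub> l \<ominus>\<^bsub>S\<^esub> l' \<otimes>\<^bsub>S\<^esub> l'' \<in> L (d + d)" unfolding L_def by blast
  next
    fix i assume i: "i \<in> A"
    then have ci: "\<ominus> c i i \<in> carrier R" using c by blast
    have "e \<oplus>\<^bsub>S\<^esub> scalar (\<ominus> c i i) = ?ev (monom (UP R) \<one> 1 \<oplus>\<^bsub>UP R\<^esub> monom (UP R) (\<ominus> c i i) 0)"
      using ci e_in_S E.eval_monom1[OF e_in_S] E.eval_const[OF e_in_S ci]
      by (simp del: E.monom_a_inv)
    then show "e \<oplus>\<^bsub>S\<^esub> scalar (\<ominus> c i i) \<in> T 1"
      unfolding T_def using E.monic_of_degreeI const ci by blast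
  next
    fix i j assume "i \<in> A" "j \<in> A"
    then have ci: "\<ominus> c i j \<in> carrier R" using c by blast
    show "scalar (\<ominus> c i j) \<in> L 1"
      unfolding L_def using const[OF ci] E.eval_const[OF e_in_S ci] by (metis imageI)
  qed (use carr in \<open>auto simp: T_def L_def\<close>)
  then obtain d p where "p \<in> E.monic_of_degree d" "?ev p = \<zero>\<^bsub>S\<^esub>" by (auto simp: T_def)
  then show ?thesis using E.monic_of_degree_monic[OF nz] E.monic_carrier by blast
qed

text \<open>With \<open>u = 1 - s\<close>, the operators \<open>T = 1 + I + u S\<close> and \<open>L = I + u S\<close> have the closure
  properties that elimination asks for, and the matrix \<open>s \<delta>\<^bsub>i j\<^esub> - c i j\<close> has this shape
  because \<open>s = 1 - u\<close> and \<open>c i j\<close> lies in \<open>I\<close>.  So \<open>0\<close> lies in \<open>T\<close>, that is, \<open>-u y\<close> is a unit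
  of the form \<open>1 + a\<close> with \<open>a\<close> in \<open>I\<close>.\<close>
lemma Nakayama_unit:
  assumes A: "generating A" and I: "ideal I R" and unit: "\<And>a. a \<in> I \<Longrightarrow> \<one> \<oplus> a \<in> Units R"
    and s: "s \<in> carrier S" and sM: "\<And>x. x \<in> carrier M \<Longrightarrow> s x \<in> ideal_times I M"
  shows "\<one>\<^bsub>S\<^esub> \<ominus>\<^bsub>S\<^esub> s \<in> Units S"
proof -
  interpret I: ideal I R by fact
  note scalar = scalar_mult scalar_add scalar_one scalar_zero scalar_neg scalar_in_S
  define u where "u = \<one>\<^bsub>S\<^esub> \<ominus>\<^bsub>S\<^esub> s"
  have u: "u \<in> carrier S" using s by (simp add: u_def)
  define L where "L = {scalar a \<oplus>\<^bsub>S\<^esub> u \<otimes>\<^bsub>S\<^esub> y | a y. a \<in> I \<and> y \<in> carrier S}"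
  define T where "T = {\<one>\<^bsub>S\<^esub> \<oplus>\<^bsub>S\<^esub> l | l. l \<in> L}"
  have TI: "\<one>\<^bsub>S\<^esub> \<oplus>\<^bsub>S\<^esub> l \<in> T" if "l \<in> L" for l
    using that by (auto simp: T_def)
  have LI: "scalar a \<oplus>\<^bsub>S\<^esub> u \<otimes>\<^bsub>S\<^esub> y \<in> L" if "a \<in> I" "y \<in> carrier S" for a y
    using that by (auto simp: L_def)
  have LS: "l \<in> carrier S" if "l \<in> L" for l
    using that u I.a_subset by (auto simp: L_def scalar subset_iff)
  have Lmult: "l \<otimes>\<^bsub>S\<^esub> l' \<in> L" if "l \<in> L" "l' \<in> L" for l l'
  proof -
    obtain a y a' y' where a: "a \<in> I" "y \<in> carrier S" "a' \<in> I" "y' \<in> carrier S"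
      "l = scalar a \<oplus>\<^bsub>S\<^esub> u \<otimes>\<^bsub>S\<^esub> y" "l' = scalar a' \<oplus>\<^bsub>S\<^esub> u \<otimes>\<^bsub>S\<^esub> y'" using \<open>l \<in> L\<close> \<open>l' \<in> L\<close>
      by (auto simp: L_def)
    have aR: "a \<in> carrier R" "a' \<in> carrier R" using a I.a_subset by auto
    have hs: "scalar a \<in> carrier S" "scalar a' \<in> carrier S" using aR scalar_in_S by auto
    have "l \<otimes>\<^bsub>S\<^esub> l' = scalar a \<otimes>\<^bsub>S\<^esub> scalar a' \<oplus>\<^bsub>S\<^esub>
        u \<otimes>\<^bsub>S\<^esub> (scalar a \<otimes>\<^bsub>S\<^esub> y' \<oplus>\<^bsub>S\<^esub> y \<otimes>\<^bsub>S\<^esub> scalar a' \<oplus>\<^bsub>S\<^esub> y \<otimes>\<^bsub>S\<^esub> (u \<otimes>\<^bsub>S\<^esub> y'))"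
      unfolding a using hs a(2,4) u
      by (simp add: S.l_distr S.r_distr S.a_ac S.m_ac)
    moreover have "a \<otimes> a' \<in> I" using I.I_r_closed[OF a(1)] aR by simp
    ultimately show ?thesis
      using LI[of "a \<otimes> a'" "scalar a \<otimes>\<^bsub>S\<^esub> y' \<oplus>\<^bsub>S\<^esub> y \<otimes>\<^bsub>S\<^esub> scalar a' \<oplus>\<^bsub>S\<^esub> y \<otimes>\<^bsub>S\<^esub> (u \<otimes>\<^bsub>S\<^esub> y')"]
        aR hs u a(2,4) by (simp add: scalar_mult)
  qed
  have Ladd: "l \<oplus>\<^bsub>S\<^esub> l' \<in> L" if "l \<in> L" "l' \<in> L" for l l'
  proof -
    obtain a y a' y' where a: "a \<in> I" "y \<in> carrier S" "a' \<in> I" "y' \<in> carrier S"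
      "l = scalar a \<oplus>\<^bsub>S\<^esub> u \<otimes>\<^bsub>S\<^esub> y" "l' = scalar a' \<oplus>\<^bsub>S\<^esub> u \<otimes>\<^bsub>S\<^esub> y'" using \<open>l \<in> L\<close> \<open>l' \<in> L\<close>
      by (auto simp: L_def)
    have aR: "a \<in> carrier R" "a' \<in> carrier R" using a I.a_subset by auto
    have "l \<oplus>\<^bsub>S\<^esub> l' = scalar (a \<oplus> a') \<oplus>\<^bsub>S\<^esub> u \<otimes>\<^bsub>S\<^esub> (y \<oplus>\<^bsub>S\<^esub> y')"
      unfolding a using aR a(2,4) u by (simp add: scalar S.r_distr S.a_ac)
    moreover have "a \<oplus> a' \<in> I" using a by simp
    ultimately show ?thesis using LI[of "a \<oplus> a'" "y \<oplus>\<^bsub>S\<^esub> y'"] a by simp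
  qed
  have Lneg: "\<ominus>\<^bsub>S\<^esub> l \<in> L" if "l \<in> L" for l
  proof -
    obtain a y where a: "a \<in> I" "y \<in> carrier S" "l = scalar a \<oplus>\<^bsub>S\<^esub> u \<otimes>\<^bsub>S\<^esub> y" using \<open>l \<in> L\<close>
      by (auto simp: L_def)
    have aR: "a \<in> carrier R" using a I.a_subset by auto
    have "\<ominus>\<^bsub>S\<^esub> l = scalar (\<ominus> a) \<oplus>\<^bsub>S\<^esub> u \<otimes>\<^bsub>S\<^esub> (\<ominus>\<^bsub>S\<^esub> y)"
      unfolding a using aR a(2) u by (simp add: scalar S.minus_add S.r_minus)
    then show ?thesis using LI[of "\<ominus> a" "\<ominus>\<^bsub>S\<^esub> y"] a by simp
  qed
  have L0: "scalar a \<in> L" if "a \<in> I" for a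
    using LI[OF that S.zero_closed] that I.a_subset u by (auto simp: scalar subset_iff)
  have L0': "\<zero>\<^bsub>S\<^esub> \<in> L" using L0[OF I.zero_closed] by (simp add: scalar)
  have AM: "A \<subseteq> carrier M" using A by (simp add: generating_def)
  have "\<exists>c. \<forall>i\<in>A. c i \<in> A \<rightarrow> I \<and> s i = (\<Oplus>\<^bsub>M\<^esub>j\<in>A. c i j \<odot>\<^bsub>M\<^esub> j)"
    using ideal_times_generating[OF I A sM] AM by (intro bchoice) blast
  then obtain c where c: "\<And>i. i \<in> A \<Longrightarrow> c i \<in> A \<rightarrow> I"
    "\<And>i. i \<in> A \<Longrightarrow> s i = (\<Oplus>\<^bsub>M\<^esub>j\<in>A. c i j \<odot>\<^bsub>M\<^esub> j)" by blast
  have cR: "c i \<in> A \<rightarrow> carrier R" if "i \<in> A" for i using c(1)[OF that] I.a_subset by blast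
  have "\<exists>d'::nat. \<zero>\<^bsub>S\<^esub> \<in> T"
  proof (rule determinant_trick[OF A s cR c(2), where T = "\<lambda>_. T" and L = "\<lambda>_. L"])
    show "\<one>\<^bsub>S\<^esub> \<in> T" using L0' by (auto simp: T_def intro!: exI[of _ "\<zero>\<^bsub>S\<^esub>"])
  next
    fix t t' assume "t \<in> T" "t' \<in> T"
    then obtain l l' where l: "l \<in> L" "l' \<in> L" "t = \<one>\<^bsub>S\<^esub> \<oplus>\<^bsub>S\<^esub> l" "t' = \<one>\<^bsub>S\<^esub> \<oplus>\<^bsub>S\<^esub> l'"
      by (auto simp: T_def)
    then have "t \<otimes>\<^bsub>S\<^esub> t' = \<one>\<^bsub>S\<^esub> \<oplus>\<^bsub>S\<^esub> (l \<oplus>\<^bsub>S\<^esub> l' \<oplus>\<^bsub>S\<^esub> l \<otimes>\<^bsub>S\<^esub> l')"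
      using LS by (simp add: S.l_distr S.r_distr S.a_ac)
    note eq = this
    have L1: "l \<oplus>\<^bsub>S\<^esub> l' \<oplus>\<^bsub>S\<^esub> l \<otimes>\<^bsub>S\<^esub> l' \<in> L" by (intro Ladd Lmult l(1,2))
    show "t \<otimes>\<^bsub>S\<^esub> t' \<in> T" unfolding eq by (rule TI[OF L1])
    fix l1 l2 assume l12: "l1 \<in> L" "l2 \<in> L"
    have "t \<otimes>\<^bsub>S\<^esub> t' \<ominus>\<^bsub>S\<^esub> l1 \<otimes>\<^bsub>S\<^esub> l2
        = \<one>\<^bsub>S\<^esub> \<oplus>\<^bsub>S\<^esub> ((l \<oplus>\<^bsub>S\<^esub> l' \<oplus>\<^bsub>S\<^esub> l \<otimes>\<^bsub>S\<^esub> l') \<oplus>\<^bsub>S\<^esub> \<ominus>\<^bsub>S\<^esub> (l1 \<otimes>\<^bsub>S\<^esub> l2))"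
      unfolding eq a_minus_def using LS[OF L1] LS[OF l12(1)] LS[OF l12(2)]
      by (intro S.a_assoc) auto
    then show "t \<otimes>\<^bsub>S\<^esub> t' \<ominus>\<^bsub>S\<^esub> l1 \<otimes>\<^bsub>S\<^esub> l2 \<in> T"
      using TI[OF Ladd[OF L1 Lneg[OF Lmult[OF l12]]]] by simp
  next
    fix t l l1 l2 assume "t \<in> T" and l: "l \<in> L" "l1 \<in> L" "l2 \<in> L"
    then obtain l' where l': "l' \<in> L" "t = \<one>\<^bsub>S\<^esub> \<oplus>\<^bsub>S\<^esub> l'" by (auto simp: T_def)
    have "t \<otimes>\<^bsub>S\<^esub> l \<ominus>\<^bsub>S\<^esub> l1 \<otimes>\<^bsub>S\<^esub> l2 = (l \<oplus>\<^bsub>S\<^esub> l' \<otimes>\<^bsub>S\<^esub> l) \<oplus>\<^bsub>S\<^esub> \<ominus>\<^bsub>S\<^esub> (l1 \<otimes>\<^bsub>S\<^esub> l2)"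
      using l l' LS by (simp add: a_minus_def S.l_distr)
    then show "t \<otimes>\<^bsub>S\<^esub> l \<ominus>\<^bsub>S\<^esub> l1 \<otimes>\<^bsub>S\<^esub> l2 \<in> L" using l l' Ladd Lmult Lneg by simp
  next
    fix i assume i: "i \<in> A"
    have ci: "c i i \<in> I" "c i i \<in> carrier R" using c(1)[OF i] cR[OF i] i by auto
    have "s = \<one>\<^bsub>S\<^esub> \<oplus>\<^bsub>S\<^esub> \<ominus>\<^bsub>S\<^esub> u"
      unfolding u_def using s by (simp add: a_minus_def S.minus_add S.r_neg2)
    then have "s \<oplus>\<^bsub>S\<^esub> scalar (\<ominus> c i i) = \<one>\<^bsub>S\<^esub> \<oplus>\<^bsub>S\<^esub> (scalar (\<ominus> c i i) \<oplus>\<^bsub>S\<^esub> u \<otimes>\<^bsub>S\<^esub> \<ominus>\<^bsub>S\<^esub> \<one>\<^bsub>S\<^esub>)"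
      using u ci by (simp add: scalar S.a_ac S.r_minus)
    then show "s \<oplus>\<^bsub>S\<^esub> scalar (\<ominus> c i i) \<in> T"
      using LI[of "\<ominus> c i i" "\<ominus>\<^bsub>S\<^esub> \<one>\<^bsub>S\<^esub>"] ci(1) TI by simp
  next
    fix i j assume "i \<in> A" "j \<in> A"
    then have "\<ominus> c i j \<in> I" using c(1) by blast
    then show "scalar (\<ominus> c i j) \<in> L" by (rule L0)
  next
    show "T \<subseteq> carrier S" using LS by (auto simp: T_def)
    show "L \<subseteq> carrier S" using LS by auto
  qed
  then obtain a y where a: "a \<in> I" "y \<in> carrier S"
    and z: "\<zero>\<^bsub>S\<^esub> = \<one>\<^bsub>S\<^esub> \<oplus>\<^bsub>S\<^esub> (scalar a \<oplus>\<^bsub>S\<^esub> u \<otimes>\<^bsub>S\<^esub> y)" by (auto simp: T_def L_def)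
  have aR: "a \<in> carrier R" using a I.a_subset by auto
  obtain b where b: "b \<in> carrier R" "b \<otimes> (\<one> \<oplus> a) = \<one>" using unit[OF a(1)] by (auto simp: Units_def)
  have "scalar (\<one> \<oplus> a) \<oplus>\<^bsub>S\<^esub> u \<otimes>\<^bsub>S\<^esub> y = \<zero>\<^bsub>S\<^esub>"
    using z[symmetric] aR a u by (simp add: scalar S.a_assoc)
  then have "scalar b \<otimes>\<^bsub>S\<^esub> (scalar (\<one> \<oplus> a) \<oplus>\<^bsub>S\<^esub> u \<otimes>\<^bsub>S\<^esub> y) = \<zero>\<^bsub>S\<^esub>"
    using b scalar_in_S by simp
  moreover have "scalar b \<otimes>\<^bsub>S\<^esub> scalar (\<one> \<oplus> a) = \<one>\<^bsub>S\<^esub>"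
    using b aR by (metis R.add.m_closed R.one_closed scalar_mult scalar_one)
  ultimately have "\<one>\<^bsub>S\<^esub> \<oplus>\<^bsub>S\<^esub> u \<otimes>\<^bsub>S\<^esub> (scalar b \<otimes>\<^bsub>S\<^esub> y) = \<zero>\<^bsub>S\<^esub>"
    using b a u aR by (simp add: scalar_in_S S.r_distr S.m_ac)
  moreover define v where "v = scalar b \<otimes>\<^bsub>S\<^esub> y"
  ultimately have 1: "\<one>\<^bsub>S\<^esub> \<oplus>\<^bsub>S\<^esub> u \<otimes>\<^bsub>S\<^esub> v = \<zero>\<^bsub>S\<^esub>" by simp
  have v: "v \<in> carrier S" using a b scalar_in_S by (simp add: v_def)
  have "u \<otimes>\<^bsub>S\<^esub> (\<ominus>\<^bsub>S\<^esub> v) = \<one>\<^bsub>S\<^esub>"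
    using S.minus_equality[OF 1] u v by (simp add: S.r_minus)
  then have "(\<ominus>\<^bsub>S\<^esub> v) \<otimes>\<^bsub>S\<^esub> u = \<one>\<^bsub>S\<^esub>" "u \<otimes>\<^bsub>S\<^esub> (\<ominus>\<^bsub>S\<^esub> v) = \<one>\<^bsub>S\<^esub>"
    using u v S.m_comm[of u "\<ominus>\<^bsub>S\<^esub> v"] by simp_all
  then show ?thesis unfolding u_def[symmetric] Units_def using u v by blast
qed

end

section \<open>Splitting off the root zero over a henselian ring\<close>

lemma (in ideal) coset_eq_zero_iff:
  assumes "x \<in> carrier R" shows "I +> x = \<zero>\<^bsub>R Quot I\<^esub> \<longleftrightarrow> x \<in> I"
proof -
  have zero: "\<zero>\<^bsub>R Quot I\<^esub> = I" unfolding FactRing_def by simp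
  have "x \<in> I +> x" using assms by (rule a_rcos_self)
  moreover have "I +> x = I" if "x \<in> I" using that by (rule a_rcos_const)
  ultimately show ?thesis unfolding zero by blast
qed

lemma (in cring) exists_maximalideal:
  assumes I: "ideal I R" and "\<one> \<notin> I"
  shows "\<exists>J. maximalideal J R \<and> I \<subseteq> J"
proof -
  let ?A = "{J. ideal J R \<and> I \<subseteq> J \<and> \<one> \<notin> J}"
  have "\<exists>J\<in>?A. \<forall>X\<in>?A. J \<subseteq> X \<longrightarrow> X = J"
  proof (rule subset_Zorn_nonempty)
    show "?A \<noteq> {}" using assms by auto
    fix C assume C: "C \<noteq> {}" "subset.chain ?A C"
    then have "subset.chain {J. ideal J R} C" by (auto simp: subset.chain_def)
    then have "ideal (\<Union>C) R" using chain_Union_is_ideal[of C] C(1) by simp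
    then show "\<Union>C \<in> ?A" using C by (auto simp: subset.chain_def)
  qed
  then obtain J where J: "ideal J R" "I \<subseteq> J" "\<one> \<notin> J" and max: "\<forall>X\<in>?A. J \<subseteq> X \<longrightarrow> X = J" by auto
  have "maximalideal J R"
  proof (rule maximalidealI[OF J(1)])
    show "carrier R \<noteq> J" using J by auto
    fix K assume K: "ideal K R" "J \<subseteq> K" "K \<subseteq> carrier R"
    show "K = J \<or> K = carrier R"
    proof (cases "\<one> \<in> K")
      case True then show ?thesis using K ideal.one_imp_carrier by blast
    next
      case False then show ?thesis using max K J by blast
    qed
  qed
  then show ?thesis using J by auto
qed

text \<open>A nonunit generates a proper ideal, which lies in some maximal ideal, and there is only one.\<close>
lemma local_ring_Units:
  fixes R (structure)
  assumes "local_ring R \<mm>" shows "Units R = carrier R - \<mm>"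
proof -
  interpret cring R using assms by (simp add: local_ring_def)
  interpret m: maximalideal \<mm> R using assms by (simp add: local_ring_def)
  show ?thesis
  proof (intro equalityI subsetI)
    fix a assume a: "a \<in> Units R"
    have "a \<notin> \<mm>"
    proof
      assume "a \<in> \<mm>"
      then have "inv a \<otimes> a \<in> \<mm>" using a by (intro m.I_l_closed) auto
      then show False using a m.I_notcarr m.one_imp_carrier by auto
    qed
    then show "a \<in> carrier R - \<mm>" using a by auto
  next
    fix a assume a: "a \<in> carrier R - \<mm>"
    show "a \<in> Units R"
    proof (rule ccontr)
      assume "a \<notin> Units R"
      then have "\<one> \<notin> PIdl a"
        using a ideal_eq_carrier_iff[of a] ideal.one_imp_carrier[OF cgenideal_ideal[of a]] by auto
      then obtain J where "maximalideal J R" "PIdl a \<subseteq> J"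
        using exists_maximalideal[OF cgenideal_ideal[of a]] a by auto
      then have "a \<in> \<mm>" using assms cgenideal_self[of a] a unfolding local_ring_def by blast
      then show False using a by simp
    qed
  qed
qed

lemma local_ring_one_add_Units:
  fixes R (structure)
  assumes "local_ring R \<mm>" "a \<in> \<mm>" shows "\<one> \<oplus> a \<in> Units R"
proof -
  interpret cring R using assms by (simp add: local_ring_def)
  interpret m: maximalideal \<mm> R using assms by (simp add: local_ring_def)
  have aR: "a \<in> carrier R" using assms(2) m.a_subset by auto
  have "\<one> \<oplus> a \<notin> \<mm>"
  proof
    assume "\<one> \<oplus> a \<in> \<mm>"
    then have "(\<one> \<oplus> a) \<oplus> \<ominus> a \<in> \<mm>" by (rule m.a_closed) (rule m.a_inv_closed[OF assms(2)])
    moreover have "(\<one> \<oplus> a) \<oplus> \<ominus> a = \<one>" using aR by (simp add: a_assoc r_neg)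
    ultimately show False using m.I_notcarr m.one_imp_carrier by simp
  qed
  then show ?thesis using local_ring_Units[OF assms(1)] aR by simp
qed

context UP_cring
begin

lemma factor_out_indeterminate:
  assumes p: "p \<in> carrier P" and low: "\<And>n. n < a \<Longrightarrow> coeff P p n = \<zero>"
  shows "\<exists>q \<in> carrier P. p = monom P \<one> a \<otimes>\<^bsub>P\<^esub> q \<and> (\<forall>n. coeff P q n = coeff P p (n + a))"
proof -
  let ?q = "\<lambda>n. coeff P p (n + a)"
  have "?q \<in> up R"
    using p by (intro mem_upI) (auto intro!: exI[of _ "deg R p"] bound.intro deg_aboveD)
  then have q: "?q \<in> carrier P" and cq: "\<And>n. coeff P ?q n = coeff P p (n + a)"
    by (simp_all add: P_def UP_def)
  have "p = monom P \<one> a \<otimes>\<^bsub>P\<^esub> ?q"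
  proof (rule up_eqI)
    fix n
    show "coeff P p n = coeff P (monom P \<one> a \<otimes>\<^bsub>P\<^esub> ?q) n"
    proof (cases "n < a")
      case True
      have "coeff P (monom P \<one> a \<otimes>\<^bsub>P\<^esub> ?q) n = (\<Oplus>i\<in>{..n}. \<zero>)"
        unfolding coeff_mult[OF monom_closed[OF R.one_closed] q]
        using True q by (intro R.finsum_cong') auto
      then show ?thesis using low[OF True] by simp
    next
      case False
      then show ?thesis using coeff_monom_mult[OF R.one_closed q, of a "n - a"] p cq[of "n - a"]
        by (simp del: coeff_mult)
    qed
  qed (use p q in auto)
  then show ?thesis using q cq by blast
qed

text \<open>Modulo \<open>h\<close> the constant coefficient, a unit, is a multiple of the indeterminate.  So
  if \<open>X\<^bsup>j + 1\<^esup>\<close> lies in the ideal, then \<open>X\<^sup>j\<close> does too, and descending from \<open>j = a\<close> one reaches \<open>1\<close>.\<close>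
lemma unit_constant_coeff_coprime_to_monom:
  assumes h: "h \<in> carrier P" and c: "coeff P h 0 \<in> Units R"
  shows "Idl\<^bsub>P\<^esub> {monom P \<one> a, h} = carrier P"
proof -
  let ?J = "Idl\<^bsub>P\<^esub> {monom P \<one> a, h}"
  have sub: "{monom P \<one> a, h} \<subseteq> carrier P" using h by simp
  interpret J: ideal ?J P using sub by (rule P.genideal_ideal)
  have in_J: "monom P \<one> a \<in> ?J" "h \<in> ?J" using P.genideal_self[OF sub] by auto
  let ?c = "coeff P h 0"
  have cR: "?c \<in> carrier R" "inv ?c \<in> carrier R" using c by auto
  obtain q where q: "q \<in> carrier P" "h \<ominus>\<^bsub>P\<^esub> monom P ?c 0 = monom P \<one> 1 \<otimes>\<^bsub>P\<^esub> q"
    using factor_out_indeterminate[of "h \<ominus>\<^bsub>P\<^esub> monom P ?c 0" 1] h cR by (auto simp: R.minus_eq R.r_neg)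
  have "monom P \<one> j \<in> ?J" if "j \<le> a" for j
    using that
  proof (induction j rule: inc_induct)
    case base then show ?case using in_J by simp
  next
    case (step j)
    have "monom P (inv ?c) j \<otimes>\<^bsub>P\<^esub> h \<ominus>\<^bsub>P\<^esub> monom P (inv ?c) (Suc j) \<otimes>\<^bsub>P\<^esub> q \<in> ?J"
    proof -
      have "monom P (inv ?c) (Suc j) = monom P (inv ?c) 0 \<otimes>\<^bsub>P\<^esub> monom P \<one> (Suc j)"
        using cR monom_mult[of "inv ?c" \<one> 0 "Suc j"] by simp
      then have "monom P (inv ?c) (Suc j) \<in> ?J" using step cR by (simp add: J.I_l_closed)
      then have "monom P (inv ?c) (Suc j) \<otimes>\<^bsub>P\<^esub> q \<in> ?J" using q(1) by (rule J.I_r_closed)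
      moreover have "monom P (inv ?c) j \<otimes>\<^bsub>P\<^esub> h \<in> ?J" using in_J(2) cR by (intro J.I_l_closed) auto
      ultimately show ?thesis unfolding P.minus_eq by (intro J.a_closed J.a_inv_closed)
    qed
    moreover have "monom P (inv ?c) j \<otimes>\<^bsub>P\<^esub> h \<ominus>\<^bsub>P\<^esub> monom P (inv ?c) (Suc j) \<otimes>\<^bsub>P\<^esub> q
        = monom P \<one> j"
    proof -
      have "monom P (inv ?c) (Suc j) = monom P (inv ?c) j \<otimes>\<^bsub>P\<^esub> monom P \<one> 1"
        using cR monom_mult[of "inv ?c" \<one> j 1] by simp
      then have "monom P (inv ?c) (Suc j) \<otimes>\<^bsub>P\<^esub> q
          = monom P (inv ?c) j \<otimes>\<^bsub>P\<^esub> (h \<ominus>\<^bsub>P\<^esub> monom P ?c 0)"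
        using cR q h by (simp add: P.m_assoc)
      also have "\<dots> = monom P (inv ?c) j \<otimes>\<^bsub>P\<^esub> h \<ominus>\<^bsub>P\<^esub> monom P \<one> j"
        using cR h c monom_mult[of "inv ?c" ?c j 0] by (simp add: P.minus_eq P.r_distr P.r_minus del: monom_a_inv)
      finally show ?thesis using cR h
        by (simp add: P.minus_eq P.minus_add P.r_neg2)
    qed
    ultimately show ?case by simp
  qed
  from this[of 0] show ?thesis using J.one_imp_carrier by simp
qed

end

text \<open>Over the residue field \<open>p\<close> is the power \<open>X\<^sup>a\<close>, where \<open>a\<close> is the multiplicity of the root \<open>0\<close>,
  times a monic polynomial with nonzero constant coefficient.  These factors are coprime, so the
  factorization lifts.\<close>
lemma hensel_split_off_zero:
  assumes hens: "henselian R \<mm>" and p: "p \<in> carrier (UP R)" "monic R p"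
  obtains a g h where "g \<in> carrier (UP R)" "h \<in> carrier (UP R)" "p = g \<otimes>\<^bsub>UP R\<^esub> h"
    and "\<And>i. i \<noteq> a \<Longrightarrow> coeff (UP R) g i \<in> \<mm>" and "coeff (UP R) g a \<ominus>\<^bsub>R\<^esub> \<one>\<^bsub>R\<^esub> \<in> \<mm>"
    and "coeff (UP R) h 0 \<in> Units R"
proof -
  have loc: "local_ring R \<mm>" using hens by (simp add: henselian_def)
  interpret R: cring R using loc by (simp add: local_ring_def)
  interpret m: maximalideal \<mm> R using loc by (simp add: local_ring_def)
  define k where "k = R Quot \<mm>"
  interpret k: field k by (unfold k_def, rule m.quotient_is_field) (rule R.is_cring)
  interpret U: UP_cring R "UP R" by unfold_locales simp
  interpret K: UP_cring k "UP k" by unfold_locales simp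
  interpret q: ring_hom_cring R k "\<lambda>x. \<mm> +>\<^bsub>R\<^esub> x" by (unfold k_def, rule m.rcos_ring_hom_cring) (rule R.is_cring)
  have zero_iff: "\<mm> +>\<^bsub>R\<^esub> x = \<zero>\<^bsub>k\<^esub> \<longleftrightarrow> x \<in> \<mm>" if "x \<in> carrier R" for x
    using m.coset_eq_zero_iff[OF that] by (simp add: k_def)
  let ?p = "reduce_poly R \<mm> p"
  have red: "r n = \<mm> +>\<^bsub>R\<^esub> coeff (UP R) s n" if "reduce_poly R \<mm> s = r" for s r n
    using that by (auto simp: reduce_poly_def)
  define d where "d = deg R p"
  have "?p \<in> up k"
  proof (rule mem_upI)
    show "?p n \<in> carrier k" for n using p q.hom_closed by (simp add: reduce_poly_def)
    show "\<exists>n. bound \<zero>\<^bsub>k\<^esub> n ?p"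
      using p U.deg_aboveD[of p] q.hom_zero
      by (intro exI[of _ d] bound.intro) (auto simp: reduce_poly_def d_def)
  qed
  then have pk: "?p \<in> carrier (UP k)" and cp: "\<And>n. coeff (UP k) ?p n = \<mm> +>\<^bsub>R\<^esub> coeff (UP R) p n"
    by (simp_all add: UP_def reduce_poly_def)
  have pd: "coeff (UP k) ?p d = \<one>\<^bsub>k\<^esub>"
    using p q.hom_one unfolding cp by (simp add: monic_def d_def)
  have pd': "coeff (UP k) ?p n = \<zero>\<^bsub>k\<^esub>" if "n > d" for n
    using U.deg_aboveD[of p n] p that q.hom_zero unfolding cp by (simp add: d_def)
  define a where "a = (LEAST n. coeff (UP k) ?p n \<noteq> \<zero>\<^bsub>k\<^esub>)"
  have ad: "a \<le> d" unfolding a_def by (rule Least_le) (simp only: pd k.one_not_zero not_False_eq_True)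
  have pa: "coeff (UP k) ?p a \<noteq> \<zero>\<^bsub>k\<^esub>" 
    unfolding a_def using LeastI[of "\<lambda>n. coeff (UP k) ?p n \<noteq> \<zero>\<^bsub>k\<^esub>" d] pd k.one_not_zero by presburger
  have "\<And>n. n < a \<Longrightarrow> coeff (UP k) ?p n = \<zero>\<^bsub>k\<^esub>" unfolding a_def using not_less_Least by blast
  from K.factor_out_indeterminate[OF pk this] obtain hk
    where hk: "hk \<in> carrier (UP k)" "?p = monom (UP k) \<one>\<^bsub>k\<^esub> a \<otimes>\<^bsub>UP k\<^esub> hk"
      and chk: "\<And>n. coeff (UP k) hk n = coeff (UP k) ?p (n + a)" by blast
  let ?g = "monom (UP k) \<one>\<^bsub>k\<^esub> a"
  have gk: "?g \<in> carrier (UP k)" by simp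
  have "monic k ?g" using K.deg_monom[of "\<one>\<^bsub>k\<^esub>" a] by (simp add: monic_def)
  moreover have "monic k hk"
  proof -
    have top: "coeff (UP k) hk (d - a) = \<one>\<^bsub>k\<^esub>" using chk pd ad by simp
    have "deg k hk = d - a"
    proof (intro le_antisym K.deg_aboveI K.deg_belowI)
      show "coeff (UP k) hk n = \<zero>\<^bsub>k\<^esub>" if "d - a < n" for n
        unfolding chk using pd'[of "n + a"] that by simp
    qed (use hk top in auto)
    then show ?thesis using top by (simp add: monic_def)
  qed
  moreover have "genideal (UP k) {?g, hk} = carrier (UP k)"
    using hk pa chk[of 0] k.field_Units K.coeff_closed[OF pk]
    by (intro K.unit_constant_coeff_coprime_to_monom) auto
  ultimately obtain g h where gh: "g \<in> carrier (UP R)" "h \<in> carrier (UP R)" "p = g \<otimes>\<^bsub>UP R\<^esub> h"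
    and rg: "reduce_poly R \<mm> g = ?g" and rh: "reduce_poly R \<mm> h = hk"
    using hens p gk hk unfolding henselian_def Let_def k_def[symmetric] by blast
  have cg: "\<mm> +>\<^bsub>R\<^esub> coeff (UP R) g n = (if n = a then \<one>\<^bsub>k\<^esub> else \<zero>\<^bsub>k\<^esub>)" for n
  proof -
    have "coeff (UP k) ?g n = ?g n" using gk by (simp add: UP_def)
    then show ?thesis using red[OF rg, of n] K.coeff_monom[of "\<one>\<^bsub>k\<^esub>" a n] by (simp split: if_splits)
  qed
  show ?thesis
  proof (rule that[OF gh])
    show "coeff (UP R) g i \<in> \<mm>" if "i \<noteq> a" for i
      using cg[of i] that zero_iff[OF U.coeff_closed[OF gh(1)]] by simp
    have "\<mm> +>\<^bsub>R\<^esub> (coeff (UP R) g a \<ominus>\<^bsub>R\<^esub> \<one>\<^bsub>R\<^esub>) = \<zero>\<^bsub>k\<^esub>"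
      using cg[of a] gh(1) q.hom_one k.r_neg[OF k.one_closed]
      by (simp add: R.minus_eq q.hom_add q.hom_a_inv)
    then show "coeff (UP R) g a \<ominus>\<^bsub>R\<^esub> \<one>\<^bsub>R\<^esub> \<in> \<mm>"
      using zero_iff[of "coeff (UP R) g a \<ominus>\<^bsub>R\<^esub> \<one>\<^bsub>R\<^esub>"] gh(1)
      by (metis R.minus_closed R.one_closed U.coeff_closed)
    have "\<mm> +>\<^bsub>R\<^esub> coeff (UP R) h 0 \<noteq> \<zero>\<^bsub>k\<^esub>"
    proof -
      have "coeff (UP k) hk 0 = hk 0" using hk by (simp add: UP_def)
      then show ?thesis using red[OF rh, of 0] chk[of 0] pa by simp
    qed
    then show "coeff (UP R) h 0 \<in> Units R"
      using zero_iff local_ring_Units[OF loc] gh(2) by simp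
  qed
qed

section \<open>Lifting idempotents in commutative rings\<close>

context cring
begin

lemma one_minus_dvd_one_minus_pow:
  assumes z: "z \<in> carrier R"
  shows "\<exists>s \<in> carrier R. \<one> \<ominus> z [^] (n::nat) = (\<one> \<ominus> z) \<otimes> s"
proof (induction n)
  case 0
  have "\<one> \<ominus> z [^] (0::nat) = (\<one> \<ominus> z) \<otimes> \<zero>" using z by (simp add: a_minus_def r_neg)
  then show ?case by blast
next
  case (Suc n)
  then obtain s where s: "s \<in> carrier R" "\<one> \<ominus> z [^] n = (\<one> \<ominus> z) \<otimes> s" by blast
  have p: "z [^] n \<in> carrier R" using z by simp
  have "(\<one> \<ominus> z) \<otimes> z [^] n = z [^] n \<ominus> z [^] Suc n"
    using z p by (simp add: a_minus_def l_distr l_minus m_comm[of z])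
  then have "\<one> \<ominus> z [^] Suc n = (\<one> \<ominus> z [^] n) \<oplus> (\<one> \<ominus> z) \<otimes> z [^] n"
    using z p by (simp add: a_minus_def a_assoc r_neg1)
  also have "\<dots> = (\<one> \<ominus> z) \<otimes> (s \<oplus> z [^] n)"
    using s z p by (simp add: r_distr)
  finally show ?case using s p by blast
qed

lemma idempotent_pow_absorb:
  assumes "E \<in> carrier R" "E \<otimes> E = E" shows "E [^] (n::nat) \<otimes> E = E"
  using assms by (induction n) (auto simp: m_assoc)

text \<open>Let \<open>A = E\<^sup>n - Y\<close> and \<open>B = 1 - E W\<close>.  As \<open>E\<close> is idempotent, \<open>B = (1 - E) + B E\<close>, and
  \<open>A B = 0\<close> gives \<open>A (1 - E) = 0\<close>.  Moreover \<open>A E = (1 - Y) E\<close> with \<open>1 - Y\<close> a unit, so \<open>A B = 0\<close>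
  also gives \<open>B E = 0\<close>.  Multiplying \<open>A U + B V = 1\<close> by \<open>E\<close> leaves \<open>A U = E\<close>.\<close>
lemma complementary_factor_eq_idempotent:
  assumes c: "E \<in> carrier R" "Y \<in> carrier R" "W \<in> carrier R" "U \<in> carrier R" "V \<in> carrier R"
    and idem: "E \<otimes> E = E" and unit: "\<one> \<ominus> Y \<in> Units R"
    and AB: "(E [^] (n::nat) \<ominus> Y) \<otimes> (\<one> \<ominus> E \<otimes> W) = \<zero>"
    and UV: "(E [^] n \<ominus> Y) \<otimes> U \<oplus> (\<one> \<ominus> E \<otimes> W) \<otimes> V = \<one>"
  shows "(E [^] n \<ominus> Y) \<otimes> U = E"
proof -
  define A where "A = E [^] n \<ominus> Y"
  define B where "B = \<one> \<ominus> E \<otimes> W"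
  have AB': "A \<in> carrier R" "B \<in> carrier R" "A \<otimes> B = \<zero>" "A \<otimes> U \<oplus> B \<otimes> V = \<one>"
    using c AB UV by (simp_all add: A_def B_def)
  have "B \<otimes> E = E \<ominus> E \<otimes> W \<otimes> E"
    using c by (simp add: B_def a_minus_def l_distr l_minus)
  also have "E \<otimes> W \<otimes> E = E \<otimes> W" using c idem by (metis m_assoc m_comm)
  finally have BE: "B \<otimes> E = E \<ominus> E \<otimes> W" .
  have "A \<otimes> (B \<otimes> E) = \<zero>" using AB' c by (simp add: m_assoc[symmetric])
  have B1: "B = \<one> \<ominus> E \<oplus> B \<otimes> E"
    unfolding BE using c by (simp add: B_def a_minus_def a_assoc r_neg1)
  have "A \<otimes> B = A \<otimes> (\<one> \<ominus> E) \<oplus> A \<otimes> (B \<otimes> E)"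
    by (subst B1) (use AB' c in \<open>simp add: r_distr\<close>)
  then have "A \<otimes> (\<one> \<ominus> E) = \<zero>"
    using AB' c \<open>A \<otimes> (B \<otimes> E) = \<zero>\<close> by simp
  then have "A \<ominus> A \<otimes> E = \<zero>" using AB' c by (simp add: a_minus_def r_distr r_minus)
  then have A: "A = A \<otimes> E" using AB' c by simp
  have AE: "A \<otimes> E = (\<one> \<ominus> Y) \<otimes> E"
    unfolding A_def using c idempotent_pow_absorb[OF c(1) idem, of n]
    by (simp add: a_minus_def l_distr l_minus)
  have "(\<one> \<ominus> Y) \<otimes> (B \<otimes> E) = B \<otimes> (A \<otimes> E)"
    unfolding AE using AB' c by (simp add: m_ac)
  also have "\<dots> = \<zero>" using AB' c by (metis A m_comm)
  finally have "inv (\<one> \<ominus> Y) \<otimes> ((\<one> \<ominus> Y) \<otimes> (B \<otimes> E)) = \<zero>" using unit by simp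
  moreover have "inv (\<one> \<ominus> Y) \<otimes> ((\<one> \<ominus> Y) \<otimes> (B \<otimes> E)) = B \<otimes> E"
    using unit c AB' by (simp add: m_assoc[symmetric] Units_l_inv)
  ultimately have "B \<otimes> E = \<zero>" by simp
  have "E = (A \<otimes> U \<oplus> B \<otimes> V) \<otimes> E" using AB' c by simp
  also have "\<dots> = (A \<otimes> E) \<otimes> U \<oplus> (B \<otimes> E) \<otimes> V"
    using AB'(1,2) c by (simp add: l_distr r_distr m_ac)
  also have "\<dots> = A \<otimes> U" using \<open>B \<otimes> E = \<zero>\<close> AB' c A[symmetric] by simp
  finally show ?thesis by (simp add: A_def)
qed

text \<open>The factors \<open>a = e\<^sup>n - y\<close> and \<open>b = 1 - e w\<close> of zero are comaximal, because \<open>1 - y w\<^sup>n\<close>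
  equals \<open>a w\<^sup>n + (1 - (e w)\<^sup>n)\<close>, where \<open>b\<close> divides the bracket.  The idempotent \<open>\<epsilon>\<close> that belongs to
  the decomposition of the ring along \<open>a\<close> and \<open>b\<close> reduces to \<open>e\<close> modulo \<open>I\<close> because \<open>e\<close> becomes
  idempotent there.\<close>
lemma idempotent_lift:
  assumes I: "ideal I R"
    and c: "e \<in> carrier R" "y \<in> carrier R" "w \<in> carrier R"
    and idem: "e \<otimes> e \<ominus> e \<in> I"
    and ab: "(e [^] (n::nat) \<ominus> y) \<otimes> (\<one> \<ominus> e \<otimes> w) = \<zero>"
    and unit: "\<one> \<ominus> y \<in> Units R" "\<one> \<ominus> y \<otimes> w [^] n \<in> Units R"
  shows "\<exists>\<epsilon> \<in> carrier R. \<epsilon> \<otimes> \<epsilon> = \<epsilon> \<and> \<epsilon> \<ominus> e \<in> I"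
proof -
  interpret I: ideal I R by fact
  define a where "a = e [^] n \<ominus> y"
  define b where "b = \<one> \<ominus> e \<otimes> w"
  have abc: "a \<in> carrier R" "b \<in> carrier R" "a \<otimes> b = \<zero>" using c ab by (simp_all add: a_def b_def)
  obtain s where s: "s \<in> carrier R" "\<one> \<ominus> (e \<otimes> w) [^] n = b \<otimes> s"
    using one_minus_dvd_one_minus_pow[of "e \<otimes> w" n] c unfolding b_def by auto
  define t where "t = \<one> \<ominus> y \<otimes> w [^] n"
  have tu: "inv t \<in> carrier R" "t \<otimes> inv t = \<one>" "t \<in> carrier R" using unit by (auto simp: t_def)
  have "(e \<otimes> w) [^] n = a \<otimes> w [^] n \<oplus> y \<otimes> w [^] n"
    using c by (simp add: a_def nat_pow_distrib a_minus_def l_distr l_minus a_assoc l_neg)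
  then have "b \<otimes> s = \<one> \<ominus> (a \<otimes> w [^] n \<oplus> y \<otimes> w [^] n)" using s by simp
  then have "t = a \<otimes> w [^] n \<oplus> b \<otimes> s"
    using c abc s unfolding t_def by (simp add: a_minus_def minus_add a_ac r_neg2)
  then have "(a \<otimes> w [^] n \<oplus> b \<otimes> s) \<otimes> inv t = \<one>" using tu by simp
  moreover define u where "u = w [^] n \<otimes> inv t"
  moreover define v where "v = s \<otimes> inv t"
  ultimately have uv: "a \<otimes> u \<oplus> b \<otimes> v = \<one>"
    using abc c s tu by (simp add: l_distr m_assoc)
  have uvc: "u \<in> carrier R" "v \<in> carrier R" using c s tu by (auto simp: u_def v_def)
  define \<epsilon> where "\<epsilon> = a \<otimes> u"
  have ec: "\<epsilon> \<in> carrier R" using abc uvc by (simp add: \<epsilon>_def)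
  have "\<epsilon> = \<epsilon> \<otimes> (a \<otimes> u \<oplus> b \<otimes> v)" using uv ec by simp
  also have "\<dots> = \<epsilon> \<otimes> \<epsilon> \<oplus> (a \<otimes> b) \<otimes> (u \<otimes> v)"
    using abc(1,2) uvc unfolding \<epsilon>_def by (simp add: r_distr m_ac)
  also have "\<dots> = \<epsilon> \<otimes> \<epsilon>" using abc uvc ec by simp
  finally have idem': "\<epsilon> \<otimes> \<epsilon> = \<epsilon>" by simp
  define k where "k = R Quot I"
  define q where "q = (\<lambda>x. I +> x)"
  interpret q: ring_hom_cring R k q
    unfolding k_def q_def by (rule I.rcos_ring_hom_cring) (rule is_cring)
  have q0: "q x = \<zero>\<^bsub>k\<^esub> \<longleftrightarrow> x \<in> I" if "x \<in> carrier R" for x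
    using I.coset_eq_zero_iff[OF that] by (simp add: k_def q_def)
  have qm: "q (x \<ominus> z) = q x \<ominus>\<^bsub>k\<^esub> q z" if "x \<in> carrier R" "z \<in> carrier R" for x z
    using that by (simp add: a_minus_def)
  have "(q e [^]\<^bsub>k\<^esub> n \<ominus>\<^bsub>k\<^esub> q y) \<otimes>\<^bsub>k\<^esub> q u = q e"
  proof (rule q.S.complementary_factor_eq_idempotent[where W = "q w" and V = "q v"])
    have "q e \<otimes>\<^bsub>k\<^esub> q e \<ominus>\<^bsub>k\<^esub> q e = q (e \<otimes> e \<ominus> e)" using c by (simp add: qm)
    also have "\<dots> = \<zero>\<^bsub>k\<^esub>" using q0[of "e \<otimes> e \<ominus> e"] idem c by simp
    finally show "q e \<otimes>\<^bsub>k\<^esub> q e = q e" using c by simp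
    have "q (\<one> \<ominus> y) \<in> Units k"
    proof -
      have "q (inv (\<one> \<ominus> y)) \<otimes>\<^bsub>k\<^esub> q (\<one> \<ominus> y) = \<one>\<^bsub>k\<^esub>"
        using unit(1) q.hom_mult[of "inv (\<one> \<ominus> y)" "\<one> \<ominus> y"]
        by (metis Units_closed Units_inv_closed Units_l_inv q.hom_one)
      then show ?thesis using unit(1) q.S.m_comm[of "q (inv (\<one> \<ominus> y))" "q (\<one> \<ominus> y)"]
        unfolding Units_def[of k] by (auto intro!: bexI[of _ "q (inv (\<one> \<ominus> y))"])
    qed
    then show "\<one>\<^bsub>k\<^esub> \<ominus>\<^bsub>k\<^esub> q y \<in> Units k" using c by (simp add: qm)
    show "(q e [^]\<^bsub>k\<^esub> n \<ominus>\<^bsub>k\<^esub> q y) \<otimes>\<^bsub>k\<^esub> (\<one>\<^bsub>k\<^esub> \<ominus>\<^bsub>k\<^esub> q e \<otimes>\<^bsub>k\<^esub> q w) = \<zero>\<^bsub>k\<^esub>"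
      using arg_cong[OF ab, of q] c by (simp add: qm)
    show "(q e [^]\<^bsub>k\<^esub> n \<ominus>\<^bsub>k\<^esub> q y) \<otimes>\<^bsub>k\<^esub> q u \<oplus>\<^bsub>k\<^esub>
        (\<one>\<^bsub>k\<^esub> \<ominus>\<^bsub>k\<^esub> q e \<otimes>\<^bsub>k\<^esub> q w) \<otimes>\<^bsub>k\<^esub> q v = \<one>\<^bsub>k\<^esub>"
      using arg_cong[OF uv, of q] c uvc unfolding a_def b_def by (simp add: qm)
  qed (use c uvc in auto)
  then have "q \<epsilon> = q e" using c uvc unfolding \<epsilon>_def a_def by (simp add: qm)
  then have "q (\<epsilon> \<ominus> e) = \<zero>\<^bsub>k\<^esub>" using ec c by (simp add: qm q.S.r_neg a_minus_def)
  then have "\<epsilon> \<ominus> e \<in> I" using q0[of "\<epsilon> \<ominus> e"] minus_closed[OF ec c(1)] by blast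
  then show ?thesis using ec idem' by blast
qed

text \<open>This compares a norm with a power, once modulo the ideal of operators that are zero
  modulo the maximal ideal and once modulo the ideal generated by \<open>e\<close>.\<close>
lemma finprod_cong_modulo_ideal:
  assumes J: "ideal J R" and "finite T" and c: "c \<in> carrier R"
    and x: "\<And>g. g \<in> T \<Longrightarrow> x g \<in> carrier R" "\<And>g. g \<in> T \<Longrightarrow> x g \<ominus> c \<in> J"
  shows "finprod R x T \<ominus> c [^] card T \<in> J"
  using assms(2) x
proof (induction T rule: finite_induct)
  case empty
  interpret J: ideal J R by fact
  show ?case by (simp add: a_minus_def r_neg)
next
  case (insert g T)
  interpret J: ideal J R by fact
  have xg: "x g \<in> carrier R" "x g \<ominus> c \<in> J" and xT: "x \<in> T \<rightarrow> carrier R" using insert.prems by auto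
  have IH: "finprod R x T \<ominus> c [^] card T \<in> J" using insert by simp
  have F: "finprod R x T \<in> carrier R" using xT by simp
  have p: "c [^] card T \<in> carrier R" using c by simp
  have "x g \<otimes> finprod R x T \<ominus> c [^] Suc (card T)
      = x g \<otimes> (finprod R x T \<ominus> c [^] card T) \<oplus> (x g \<ominus> c) \<otimes> c [^] card T"
    using xg F c p by (simp add: a_minus_def l_distr r_distr l_minus r_minus a_assoc m_comm r_neg1 r_neg2)
  also have "\<dots> \<in> J" using IH xg p by (intro J.a_closed J.I_l_closed J.I_r_closed)
  finally show ?case using insert.hyps xg xT by simp
qed

end

section \<open>Lifting invariant idempotents\<close>

text \<open>Stated for an abstract ring in order to be applied to a ring of operators on which the group
  acts by conjugation.\<close>
locale finite_group_acting = cring R + G: group G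
  for R (structure) and G :: "('g, 'x) monoid_scheme" and \<psi> +
  assumes finite_G: "finite (carrier G)"
    and hom: "g \<in> carrier G \<Longrightarrow> \<psi> g \<in> ring_hom R R"
    and act_mult: "\<lbrakk>g \<in> carrier G; h \<in> carrier G; x \<in> carrier R\<rbrakk> \<Longrightarrow> \<psi> (g \<otimes>\<^bsub>G\<^esub> h) x = \<psi> g (\<psi> h x)"
begin

abbreviation K where "K \<equiv> invariant_ring G R \<psi>"

definition norm where "norm x = finprod R (\<lambda>g. \<psi> g x) (carrier G)"

lemma K_iff: "x \<in> carrier K \<longleftrightarrow> x \<in> carrier R \<and> (\<forall>g \<in> carrier G. \<psi> g x = x)"
  by (simp add: invariant_ring_def)

lemma act_closed: "\<lbrakk>g \<in> carrier G; x \<in> carrier R\<rbrakk> \<Longrightarrow> \<psi> g x \<in> carrier R"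
  using hom by (rule ring_hom_closed)

lemma act_ring_hom_cring: "g \<in> carrier G \<Longrightarrow> ring_hom_cring R R (\<psi> g)"
  using hom is_cring by (intro ring_hom_cringI)

lemma norm_closed: "x \<in> carrier R \<Longrightarrow> norm x \<in> carrier R"
  by (auto simp: norm_def act_closed)

lemma norm_mult: "\<lbrakk>x \<in> carrier R; y \<in> carrier R\<rbrakk> \<Longrightarrow> norm (x \<otimes> y) = norm x \<otimes> norm y"
proof -
  assume xy: "x \<in> carrier R" "y \<in> carrier R"
  have "norm (x \<otimes> y) = finprod R (\<lambda>g. \<psi> g x \<otimes> \<psi> g y) (carrier G)"
    unfolding norm_def using xy hom
    by (intro finprod_cong') (auto simp: ring_hom_mult act_closed)
  then show ?thesis unfolding norm_def using xy by (simp add: act_closed Pi_def)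
qed

lemma norm_invariant: assumes x: "x \<in> carrier R" shows "norm x \<in> carrier K"
proof -
  have "\<psi> h (norm x) = norm x" if h: "h \<in> carrier G" for h
  proof -
    interpret h: ring_hom_cring R R "\<psi> h" using h by (rule act_ring_hom_cring)
    have "\<psi> h (norm x) = finprod R (\<lambda>g. \<psi> h (\<psi> g x)) (carrier G)"
      unfolding norm_def using h.hom_finprod[of "\<lambda>g. \<psi> g x" "carrier G"] x
      by (simp add: act_closed Pi_def comp_def)
    also have "\<dots> = finprod R (\<lambda>g. \<psi> (h \<otimes>\<^bsub>G\<^esub> g) x) (carrier G)"
      using x h by (intro finprod_cong') (auto simp: act_mult act_closed)
    also have "\<dots> = finprod R (\<lambda>g. \<psi> g x) ((\<lambda>g. h \<otimes>\<^bsub>G\<^esub> g) ` carrier G)"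
      using x h G.inj_on_cmult[OF h] by (intro finprod_reindex[symmetric]) (auto simp: act_closed)
    also have "(\<lambda>g. h \<otimes>\<^bsub>G\<^esub> g) ` carrier G = carrier G"
      using h G.surj_const_mult by blast
    finally show ?thesis unfolding norm_def .
  qed
  then show ?thesis using norm_closed[OF x] by (simp add: K_iff)
qed

lemma norm_of_invariant:
  assumes "x \<in> carrier K" shows "norm x = x [^] card (carrier G)"
proof -
  have "norm x = finprod R (\<lambda>g. x) (carrier G)"
    unfolding norm_def using assms by (intro finprod_cong') (auto simp: K_iff)
  then show ?thesis using assms by (simp add: finprod_const K_iff)
qed

lemma subcring_K: "subcring (carrier K) R"
proof (rule subcringI')
  show "subring (carrier K) R"
  proof (rule subringI)
    show "\<one> \<in> carrier K" using hom by (auto simp: K_iff ring_hom_one)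
    fix x y assume "x \<in> carrier K" "y \<in> carrier K"
    then show "x \<otimes> y \<in> carrier K" "x \<oplus> y \<in> carrier K" "\<ominus> x \<in> carrier K"
      using hom act_ring_hom_cring ring_hom_cring.hom_a_inv
      by (force simp: K_iff ring_hom_mult ring_hom_add)+
  qed (auto simp: K_iff)
qed

lemma K_closed:
  shows "\<lbrakk>x \<in> carrier K; y \<in> carrier K\<rbrakk> \<Longrightarrow> x \<otimes> y \<in> carrier K"
    and "\<lbrakk>x \<in> carrier K; y \<in> carrier K\<rbrakk> \<Longrightarrow> x \<oplus> y \<in> carrier K"
    and "x \<in> carrier K \<Longrightarrow> \<ominus> x \<in> carrier K"
    and "\<lbrakk>x \<in> carrier K; y \<in> carrier K\<rbrakk> \<Longrightarrow> x \<ominus> y \<in> carrier K"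
    and "\<one> \<in> carrier K" and "\<zero> \<in> carrier K"
  using subcringE[OF subcring_K] by (auto simp: a_minus_def)

lemma K_pow_closed: "x \<in> carrier K \<Longrightarrow> x [^] (n::nat) \<in> carrier K"
  by (induction n) (auto simp: K_closed)

lemma K_ops: "x \<otimes>\<^bsub>K\<^esub> y = x \<otimes> y" "x \<oplus>\<^bsub>K\<^esub> y = x \<oplus> y" "\<one>\<^bsub>K\<^esub> = \<one>" "\<zero>\<^bsub>K\<^esub> = \<zero>"
  by (simp_all add: invariant_ring_def)

lemma K_pow: "x [^]\<^bsub>K\<^esub> (n::nat) = x [^] n"
  by (simp add: nat_pow_def K_ops)

lemma cring_K: "cring K"
  using subcring_iff[OF subcringE(1)[OF subcring_K]] subcring_K
  by (simp add: invariant_ring_def)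

lemma K_minus: assumes "x \<in> carrier K" "y \<in> carrier K"
  shows "\<ominus>\<^bsub>K\<^esub> x = \<ominus> x" "y \<ominus>\<^bsub>K\<^esub> x = y \<ominus> x"
proof -
  interpret K: cring K by (rule cring_K)
  have "\<ominus> x \<oplus>\<^bsub>K\<^esub> x = \<zero>\<^bsub>K\<^esub>" using assms by (simp add: K_ops K_iff l_neg)
  then show "\<ominus>\<^bsub>K\<^esub> x = \<ominus> x" using assms K_closed by (intro K.minus_equality) auto
  then show "y \<ominus>\<^bsub>K\<^esub> x = y \<ominus> x" by (simp add: a_minus_def K_ops)
qed

lemma K_Units: assumes "u \<in> carrier K" "u \<in> Units R" shows "u \<in> Units K"
proof -
  have i: "inv u \<in> carrier R" "inv u \<otimes> u = \<one>" "u \<otimes> inv u = \<one>" using assms by auto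
  have "\<psi> g (inv u) = inv u" if g: "g \<in> carrier G" for g
  proof -
    have "\<psi> g (inv u) \<otimes> u = \<psi> g (inv u \<otimes> u)"
      using ring_hom_mult[OF hom[OF g] i(1), of u] g assms(1) by (simp add: K_iff)
    also have "\<dots> = \<one>" using i hom[OF g] by (simp add: ring_hom_one)
    finally have "\<psi> g (inv u) \<otimes> u = \<one>" .
    then show ?thesis using i act_closed[OF g i(1)] assms
      by (metis comm_inv_char K_iff m_comm)
  qed
  then have "inv u \<in> carrier K" using i by (simp add: K_iff)
  then show ?thesis using assms i unfolding Units_def by (auto simp: K_ops)
qed

text \<open>The norms of \<open>a\<close> and of \<open>b = 1 - e w\<close> are invariant and have product \<open>0\<close>.  The norm of \<open>a\<close> is
  congruent to a power of \<open>e\<close> modulo \<open>J\<close>.  The norm of \<open>b\<close> is \<open>1 - z\<close> with \<open>z\<close> an invariant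
  multiple of \<open>e\<close>, but the cofactor of \<open>e\<close> in \<open>z\<close> need not be invariant.  This is repaired by a
  power: with \<open>m\<close> the order of \<open>G\<close>, \<open>z\<^sup>m\<close> is the norm of \<open>z\<close>, hence \<open>e\<^sup>m\<close> times the norm of the
  cofactor, and \<open>1 - z\<close> divides \<open>1 - z\<^sup>m\<close>.  An invariant cofactor is indispensable because \<open>I\<close> is
  an ideal of the ring of invariants only.\<close>
lemma equivariant_idempotent_lift:
  assumes J: "ideal J R" and J_stable: "\<And>g x. \<lbrakk>g \<in> carrier G; x \<in> J\<rbrakk> \<Longrightarrow> \<psi> g x \<in> J"
    and J_unit: "\<And>x. x \<in> J \<Longrightarrow> \<one> \<ominus> x \<in> Units R"
    and I: "ideal I K" and e: "e \<in> carrier K" and idem: "e \<otimes> e \<ominus> e \<in> I"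
    and a: "a \<in> carrier R" "a \<ominus> e [^] (n::nat) \<in> J"
    and w: "w \<in> carrier R" and aw: "a \<otimes> (\<one> \<ominus> e \<otimes> w) = \<zero>"
  shows "\<exists>\<epsilon> \<in> carrier K. \<epsilon> \<otimes> \<epsilon> = \<epsilon> \<and> \<epsilon> \<ominus> e \<in> I"
proof -
  interpret J: ideal J R by fact
  interpret K: cring K by (rule cring_K)
  define m where "m = card (carrier G)"
  have m: "m > 0" unfolding m_def using finite_G G.one_closed card_gt_0_iff by blast
  have eR: "e \<in> carrier R" using e by (simp add: K_iff)
  define b where "b = \<one> \<ominus> e \<otimes> w"
  have bR: "b \<in> carrier R" using eR w by (simp add: b_def)
  have act_e: "\<psi> g e = e" if "g \<in> carrier G" for g using e that by (simp add: K_iff)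
  have act_pow: "\<psi> g (e [^] n) = e [^] n" if "g \<in> carrier G" for g
    using K_pow_closed[OF e, of n] that by (simp add: K_iff)
  have act_minus: "\<psi> g (x \<ominus> z) = \<psi> g x \<ominus> \<psi> g z" if "g \<in> carrier G" "x \<in> carrier R" "z \<in> carrier R" for g x z
    using that ring_hom_add[OF hom[OF that(1)]] ring_hom_cring.hom_a_inv[OF act_ring_hom_cring[OF that(1)]]
    by (simp add: a_minus_def)
  have NaNb: "norm a \<otimes> norm b = \<zero>"
  proof -
    have "norm a \<otimes> norm b = norm \<zero>" using norm_mult[OF a(1) bR] aw by (simp add: b_def)
    also have "\<dots> = \<zero>" using norm_of_invariant[OF K_closed(6)] m by (simp add: m_def nat_pow_zero)
    finally show ?thesis .
  qed
  define y where "y = (e [^] n) [^] m \<ominus> norm a"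
  have yK: "y \<in> carrier K"
    unfolding y_def using e a by (intro K_closed K_pow_closed norm_invariant)
  have "norm a \<ominus> (e [^] n) [^] m \<in> J"
    unfolding norm_def m_def
  proof (rule finprod_cong_modulo_ideal[OF J finite_G])
    fix g assume g: "g \<in> carrier G"
    have "\<psi> g a \<ominus> e [^] n = \<psi> g (a \<ominus> e [^] n)" using g a eR by (simp add: act_minus act_pow)
    then show "\<psi> g a \<ominus> e [^] n \<in> J" using J_stable[OF g a(2)] by simp
  qed (use a eR act_closed in auto)
  then have "\<ominus> (norm a \<ominus> (e [^] n) [^] m) \<in> J" by (rule J.a_inv_closed)
  then have yJ: "y \<in> J"
    unfolding y_def using a eR norm_closed by (simp add: a_minus_def minus_add a_comm)
  have "norm b \<ominus> \<one> [^] m \<in> PIdl e"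
    unfolding norm_def m_def
  proof (rule finprod_cong_modulo_ideal[OF cgenideal_ideal[OF eR] finite_G])
    fix g assume g: "g \<in> carrier G"
    have "\<psi> g b = \<one> \<ominus> e \<otimes> \<psi> g w"
      unfolding b_def using g eR w hom[OF g] by (simp add: act_minus act_e ring_hom_one ring_hom_mult)
    then have "\<psi> g b \<ominus> \<one> = (\<ominus> \<psi> g w) \<otimes> e"
      using g eR act_closed[OF g w] by (simp add: a_minus_def a_ac r_neg2 r_minus m_comm)
    then show "\<psi> g b \<ominus> \<one> \<in> PIdl e" using act_closed[OF g w] by (auto simp: cgenideal_def)
  qed (use bR act_closed in auto)
  then obtain w1 where w1: "w1 \<in> carrier R" "norm b \<ominus> \<one> = w1 \<otimes> e" by (auto simp: cgenideal_def)
  define z where "z = \<one> \<ominus> norm b"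
  have z: "z = e \<otimes> \<ominus> w1"
  proof -
    have "z = \<ominus> (norm b \<ominus> \<one>)" using norm_closed[OF bR] by (simp add: z_def a_minus_def minus_add a_comm)
    then show ?thesis using w1 eR by (simp add: r_minus m_comm)
  qed
  have zK: "z \<in> carrier K" unfolding z_def using bR by (intro K_closed norm_invariant)
  have zR: "z \<in> carrier R" using zK by (simp add: K_iff)
  have "z [^] m = norm z" using norm_of_invariant[OF zK] by (simp add: m_def)
  also have "\<dots> = norm e \<otimes> norm (\<ominus> w1)" unfolding z using eR w1 by (simp add: norm_mult)
  also have "norm e = e [^] m" using norm_of_invariant[OF e] by (simp add: m_def)
  also have "e [^] m = e \<otimes> e [^] (m - 1)" using m eR by (cases m) (auto simp: m_comm)
  finally have zm: "z [^] m = e \<otimes> (e [^] (m - 1) \<otimes> norm (\<ominus> w1))"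
    using eR w1 norm_closed by (simp add: m_assoc)
  define w' where "w' = e [^] (m - 1) \<otimes> norm (\<ominus> w1)"
  have w'K: "w' \<in> carrier K"
    unfolding w'_def using e w1 by (intro K_closed K_pow_closed norm_invariant) auto
  obtain s where s: "s \<in> carrier R" "\<one> \<ominus> z [^] m = (\<one> \<ominus> z) \<otimes> s"
    using one_minus_dvd_one_minus_pow[OF zR] by blast
  have nb: "\<one> \<ominus> z = norm b" unfolding z_def using norm_closed[OF bR] by (simp add: a_minus_def minus_add r_neg2)
  have na: "(e [^] n) [^] m \<ominus> y = norm a"
    unfolding y_def using norm_closed[OF a(1)] eR by (simp add: a_minus_def minus_add r_neg2)
  have prod: "((e [^] n) [^] m \<ominus> y) \<otimes> (\<one> \<ominus> e \<otimes> w') = \<zero>"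
  proof -
    have "\<one> \<ominus> e \<otimes> w' = norm b \<otimes> s" using s zm nb by (simp add: w'_def)
    then show ?thesis unfolding na using NaNb norm_closed a bR s by (simp add: m_assoc[symmetric])
  qed
  have yR: "y \<in> carrier R" and w'R: "w' \<in> carrier R" using yK w'K by (simp_all add: K_iff)
  have "y \<otimes> w' [^] (n * m) \<in> J" using yJ w'R by (intro J.I_r_closed) auto
  then have units: "\<one> \<ominus> y \<in> Units R" "\<one> \<ominus> y \<otimes> w' [^] (n * m) \<in> Units R"
    using J_unit yJ by auto
  have "\<exists>\<epsilon> \<in> carrier K. \<epsilon> \<otimes>\<^bsub>K\<^esub> \<epsilon> = \<epsilon> \<and> \<epsilon> \<ominus>\<^bsub>K\<^esub> e \<in> I"
  proof (rule K.idempotent_lift[OF I e yK w'K, of "n * m"])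
    show "e \<otimes>\<^bsub>K\<^esub> e \<ominus>\<^bsub>K\<^esub> e \<in> I" using idem e by (simp add: K_ops K_minus K_closed)
    show "(e [^]\<^bsub>K\<^esub> (n * m) \<ominus>\<^bsub>K\<^esub> y) \<otimes>\<^bsub>K\<^esub> (\<one>\<^bsub>K\<^esub> \<ominus>\<^bsub>K\<^esub> e \<otimes>\<^bsub>K\<^esub> w') = \<zero>\<^bsub>K\<^esub>"
      using prod e yK w'K eR
      by (simp add: K_ops K_minus K_closed K_pow K_pow_closed nat_pow_pow)
    show "\<one>\<^bsub>K\<^esub> \<ominus>\<^bsub>K\<^esub> y \<in> Units K"
      using units(1) yK K_closed by (simp add: K_ops K_minus K_Units)
    show "\<one>\<^bsub>K\<^esub> \<ominus>\<^bsub>K\<^esub> y \<otimes>\<^bsub>K\<^esub> w' [^]\<^bsub>K\<^esub> (n * m) \<in> Units K"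
      using units(2) yK w'K K_closed K_pow_closed by (simp add: K_ops K_minus K_Units K_pow)
  qed
  then show ?thesis using e by (auto simp: K_ops K_minus)
qed

end

section \<open>Endomorphisms of twisted modules\<close>

context module_endomorphism
begin

text \<open>Applied to the two lifted factors: to the first one with the ideal of operators that map \<open>M\<close>
  into \<open>\<mm>M\<close> and the exponent of the power of \<open>X\<close> to which it reduces, to the second one with the ideal
  generated by \<open>e\<close> and the exponent \<open>0\<close>.\<close>
lemma eval_minus_term:
  assumes K: "ideal K S" and q: "q \<in> carrier (UP R)"
    and terms: "\<And>i. i \<noteq> j \<Longrightarrow> scalar (coeff (UP R) q i) \<otimes>\<^bsub>S\<^esub> e [^]\<^bsub>S\<^esub> i \<in> K"
  shows "eval R S scalar e q \<ominus>\<^bsub>S\<^esub> scalar (coeff (UP R) q j) \<otimes>\<^bsub>S\<^esub> e [^]\<^bsub>S\<^esub> j \<in> K"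
proof -
  interpret K: ideal K S by fact
  let ?c = "coeff (UP R) q j"
  have c: "?c \<in> carrier R" using q by simp
  define q' where "q' = q \<ominus>\<^bsub>UP R\<^esub> monom (UP R) ?c j"
  have q': "q' \<in> carrier (UP R)" using q by (simp add: q'_def)
  have cq': "coeff (UP R) q' i = (if i = j then \<zero> else coeff (UP R) q i)" for i
    using q c by (simp add: q'_def R.minus_eq R.r_neg)
  have in_K: "scalar (coeff (UP R) q' i) \<otimes>\<^bsub>S\<^esub> e [^]\<^bsub>S\<^esub> i \<in> K" for i
    using terms[of i] cq'[of i] e_in_S by (cases "i = j") (simp_all add: scalar_zero)
  have "(\<Oplus>\<^bsub>S\<^esub>i\<in>B. scalar (coeff (UP R) q' i) \<otimes>\<^bsub>S\<^esub> e [^]\<^bsub>S\<^esub> i) \<in> K" if "finite B" for B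
    using that
  proof (induction B rule: finite_induct)
    case (insert x B)
    then show ?case using in_K q' e_in_S by (simp add: scalar_in_S)
  qed simp
  then have "eval R S scalar e q' \<in> K" using q' by (simp add: E.eval_on_carrier)
  moreover have "eval R S scalar e q' = eval R S scalar e q \<ominus>\<^bsub>S\<^esub> scalar ?c \<otimes>\<^bsub>S\<^esub> e [^]\<^bsub>S\<^esub> j"
    unfolding q'_def a_minus_def using q c by (simp add: E.Eval_monom del: E.monom_a_inv)
  ultimately show ?thesis by simp
qed

lemma ideal_times_subset: assumes "I \<subseteq> carrier R" "x \<in> ideal_times I M" shows "x \<in> carrier M"
  using assms(2) by induction (use assms(1) in auto)

lemma ideal_maps_into_ideal_times:
  assumes I: "ideal I R"
  shows "ideal {s \<in> carrier S. \<forall>x \<in> carrier M. s x \<in> ideal_times I M} S" (is "ideal ?J S")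
proof -
  interpret I: ideal I R by fact
  have mult: "s \<otimes>\<^bsub>S\<^esub> t \<in> ?J" if "s \<in> ?J" "t \<in> carrier S" for s t
    using that by (auto simp: S_apply)
  have zero: "\<zero>\<^bsub>M\<^esub> \<in> ideal_times I M"
    using ideal_times.smult[OF I.zero_closed M.zero_closed] by simp
  show ?thesis
  proof (rule idealI)
    show "ring S" by (rule S.ring_axioms)
    show "subgroup ?J (add_monoid S)"
    proof (rule S.add.subgroupI)
      show "?J \<noteq> {}" using zero S_zero_closed by (auto simp: S_apply intro!: exI[of _ "\<zero>\<^bsub>S\<^esub>"])
      show "\<ominus>\<^bsub>S\<^esub> s \<in> ?J" if "s \<in> ?J" for s
        using mult[OF that, of "\<ominus>\<^bsub>S\<^esub> \<one>\<^bsub>S\<^esub>"] that by (simp add: S.r_minus)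
    qed (auto simp: S_apply intro: ideal_times.add)
    fix s t assume "s \<in> ?J" "t \<in> carrier S"
    then show "s \<otimes>\<^bsub>S\<^esub> t \<in> ?J" by (rule mult)
    with \<open>s \<in> ?J\<close> \<open>t \<in> carrier S\<close> show "t \<otimes>\<^bsub>S\<^esub> s \<in> ?J" using S.m_comm[of s t] by simp
  qed
qed

end

lemma (in ring_action) act_inv:
  assumes "g \<in> carrier G" "a \<in> carrier Q"
  shows "\<phi> (inv\<^bsub>G\<^esub> g) (\<phi> g a) = a" "\<phi> g (\<phi> (inv\<^bsub>G\<^esub> g) a) = a"
proof -
  interpret G: group G using group_hom by (rule group_hom.axioms(1))
  show "\<phi> (inv\<^bsub>G\<^esub> g) (\<phi> g a) = a" using orbit_sym_aux[OF assms refl] .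
  show "\<phi> g (\<phi> (inv\<^bsub>G\<^esub> g) a) = a"
    using orbit_sym_aux[OF G.inv_closed[OF assms(1)] assms(2) refl] assms by simp
qed

locale equivariant_endomorphism = twisted_module G Q \<phi> M \<rho>
  for G :: "('g, 'x) monoid_scheme" and Q :: "('q, 'y) ring_scheme" and \<phi>
    and M :: "('q, 'm, 'z) module_scheme" and \<rho> +
  fixes e
  assumes e_linear: "e \<in> linear_maps Q M M"
    and e_equivariant: "\<lbrakk>g \<in> carrier G; x \<in> carrier M\<rbrakk> \<Longrightarrow> e (\<rho> g x) = \<rho> g (e x)"
begin

sublocale EE: module_endomorphism Q M e
  using e_linear by unfold_locales

abbreviation S where "S \<equiv> bicommutant Q M e"

text \<open>\<open>\<rho> g\<close> is only semilinear, but in a conjugate the twists of \<open>\<rho> g\<close> and of its inverse cancel,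
  so that conjugation preserves linear maps.\<close>
definition conjugate where "conjugate g s = (\<lambda>x\<in>carrier M. \<rho> g (s (\<rho> (inv\<^bsub>G\<^esub> g) x)))"

lemma group_G: "group G"
  using Act.group_hom by (rule group_hom.axioms(1))

lemma inv_closed: "g \<in> carrier G \<Longrightarrow> inv\<^bsub>G\<^esub> g \<in> carrier G"
  using group_G by (rule group.inv_closed)

lemma rho_closed [simp]: "\<lbrakk>g \<in> carrier G; x \<in> carrier M\<rbrakk> \<Longrightarrow> \<rho> g x \<in> carrier M"
  using Act.element_image by blast

lemma phi_closed [simp]: "\<lbrakk>g \<in> carrier G; a \<in> carrier Q\<rbrakk> \<Longrightarrow> \<phi> g a \<in> carrier Q"
  using act_ring_hom by (metis ring_hom_closed)

lemma rho_inv [simp]: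
  assumes "g \<in> carrier G" "x \<in> carrier M"
  shows "\<rho> (inv\<^bsub>G\<^esub> g) (\<rho> g x) = x" "\<rho> g (\<rho> (inv\<^bsub>G\<^esub> g) x) = x"
  using Act.orbit_sym_aux[OF assms refl] Act.orbit_sym_aux[OF inv_closed[OF assms(1)] assms(2) refl]
    group.inv_inv[OF group_G assms(1)] by simp_all

lemma conjugate_apply: "x \<in> carrier M \<Longrightarrow> conjugate g s x = \<rho> g (s (\<rho> (inv\<^bsub>G\<^esub> g) x))"
  by (simp add: conjugate_def)

lemma conjugate_linear:
  assumes g: "g \<in> carrier G" and t: "t \<in> linear_maps Q M M"
  shows "conjugate g t \<in> linear_maps Q M M"
proof -
  note g' = inv_closed[OF g] and D = EE.linear_mapsD[OF t]
  have "conjugate g t \<in> carrier M \<rightarrow>\<^sub>E carrier M"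
    using g g' D(1) by (simp add: conjugate_def)
  moreover have "conjugate g t (x \<oplus>\<^bsub>M\<^esub> y) = conjugate g t x \<oplus>\<^bsub>M\<^esub> conjugate g t y"
    if "x \<in> carrier M" "y \<in> carrier M" for x y
    using that g g' by (simp add: conjugate_apply act_add D(1,2))
  moreover have "conjugate g t (a \<odot>\<^bsub>M\<^esub> x) = a \<odot>\<^bsub>M\<^esub> conjugate g t x"
    if "a \<in> carrier Q" "x \<in> carrier M" for a x
    using that g g' by (simp add: conjugate_apply act_smult D(1,3) act_inv)
  ultimately show ?thesis unfolding linear_maps_def by blast
qed

text \<open>If \<open>t\<close> commutes with \<open>e\<close>, then so does its conjugate by the inverse of \<open>g\<close>, because \<open>e\<close> is
  equivariant; \<open>s\<close> commutes with that conjugate, so the conjugate of \<open>s\<close> commutes with \<open>t\<close>.\<close>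
lemma conjugate_in_S:
  assumes g: "g \<in> carrier G" and s: "s \<in> carrier S"
  shows "conjugate g s \<in> carrier S"
  unfolding EE.in_S_iff
proof (intro conjI ballI impI)
  show "conjugate g s \<in> linear_maps Q M M" using g s EE.S_linear by (intro conjugate_linear)
  fix t x assume t: "t \<in> linear_maps Q M M" and te: "\<forall>x\<in>carrier M. t (e x) = e (t x)"
    and x: "x \<in> carrier M"
  have g': "inv\<^bsub>G\<^esub> g \<in> carrier G" using g by (rule inv_closed)
  have ii: "inv\<^bsub>G\<^esub> (inv\<^bsub>G\<^esub> g) = g" using group.inv_inv[OF group_G g] .
  have tM: "t z \<in> carrier M" if "z \<in> carrier M" for z using EE.linear_mapsD(1)[OF t that] .
  have eM: "e z \<in> carrier M" if "z \<in> carrier M" for z using EE.linear_mapsD(1)[OF e_linear that] .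
  let ?t = "conjugate (inv\<^bsub>G\<^esub> g) t"
  have "?t (e z) = e (?t z)" if z: "z \<in> carrier M" for z
  proof -
    have "?t (e z) = \<rho> (inv\<^bsub>G\<^esub> g) (t (\<rho> g (e z)))" using eM[OF z] by (simp add: conjugate_apply ii)
    also have "\<rho> g (e z) = e (\<rho> g z)" using e_equivariant[OF g z] by simp
    also have "t \<dots> = e (t (\<rho> g z))" using te rho_closed[OF g z] by (rule bspec)
    also have "\<rho> (inv\<^bsub>G\<^esub> g) \<dots> = e (\<rho> (inv\<^bsub>G\<^esub> g) (t (\<rho> g z)))"
      by (rule e_equivariant[OF g' tM[OF rho_closed[OF g z]], symmetric])
    finally show ?thesis using z by (simp add: conjugate_apply ii)
  qed
  then have comm: "s (?t z) = ?t (s z)" if "z \<in> carrier M" for z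
    by (rule EE.S_commute[OF s conjugate_linear[OF g' t] _ that])
  have "conjugate g s (t x) = \<rho> g (s (?t (\<rho> (inv\<^bsub>G\<^esub> g) x)))"
    using x g g' tM by (simp add: conjugate_apply ii)
  also have "\<dots> = \<rho> g (?t (s (\<rho> (inv\<^bsub>G\<^esub> g) x)))" using comm x g' by simp
  also have "\<dots> = t (conjugate g s x)" using x g g' s tM by (simp add: conjugate_apply ii)
  finally show "conjugate g s (t x) = t (conjugate g s x)" .
qed

lemma finite_group_acting_conjugate:
  assumes "finite (carrier G)" shows "finite_group_acting S G conjugate"
proof -
  interpret G: group G by (rule group_G)
  show ?thesis
  proof (intro finite_group_acting.intro finite_group_acting_axioms.intro EE.cring_S group_G assms)
    fix g assume g: "g \<in> carrier G"
    note g' = inv_closed[OF g]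
    show "conjugate g \<in> ring_hom S S"
    proof (rule ring_hom_memI)
      fix s t assume st: "s \<in> carrier S" "t \<in> carrier S"
      show "conjugate g (s \<otimes>\<^bsub>S\<^esub> t) = conjugate g s \<otimes>\<^bsub>S\<^esub> conjugate g t"
        by (rule EE.S_eqI)
           (use st g g' in \<open>auto simp: conjugate_apply EE.S_apply intro: conjugate_in_S\<close>)
      show "conjugate g (s \<oplus>\<^bsub>S\<^esub> t) = conjugate g s \<oplus>\<^bsub>S\<^esub> conjugate g t"
        by (rule EE.S_eqI)
           (use st g g' in \<open>auto simp: conjugate_apply EE.S_apply act_add intro: conjugate_in_S\<close>)
    next
      show "conjugate g \<one>\<^bsub>S\<^esub> = \<one>\<^bsub>S\<^esub>"
        by (rule EE.S_eqI) (use g g' in \<open>auto simp: conjugate_apply EE.S_apply intro: conjugate_in_S\<close>)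
    qed (use g in \<open>auto intro: conjugate_in_S\<close>)
    fix h s assume h: "h \<in> carrier G" and s: "s \<in> carrier S"
    show "conjugate (g \<otimes>\<^bsub>G\<^esub> h) s = conjugate g (conjugate h s)"
      by (rule EE.S_eqI)
         (use g h s g' inv_closed[OF h] in \<open>auto simp: conjugate_apply Act.composition_rule G.inv_mult_group
           intro: conjugate_in_S\<close>)
  qed
qed

lemma conjugate_invariant_iff:
  "s \<in> carrier (invariant_ring G S conjugate) \<longleftrightarrow> s \<in> carrier S \<and>
     (\<forall>g \<in> carrier G. \<forall>x \<in> carrier M. s (\<rho> g x) = \<rho> g (s x))" (is "?L \<longleftrightarrow> ?R")
proof
  assume L: ?L
  then have s: "s \<in> carrier S" and inv: "\<And>g. g \<in> carrier G \<Longrightarrow> conjugate g s = s"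
    by (auto simp: invariant_ring_def)
  have "s (\<rho> g x) = \<rho> g (s x)" if g: "g \<in> carrier G" and x: "x \<in> carrier M" for g x
  proof -
    have "s (\<rho> g x) = conjugate g s (\<rho> g x)" using inv[OF g] by simp
    also have "\<dots> = \<rho> g (s x)" using g x by (simp add: conjugate_apply)
    finally show ?thesis .
  qed
  then show ?R using s by blast
next
  assume R: ?R
  have "conjugate g s = s" if g: "g \<in> carrier G" for g
    by (rule EE.S_eqI) (use R g inv_closed[OF g] in \<open>auto simp: conjugate_apply intro: conjugate_in_S\<close>)
  then show ?L using R by (simp add: invariant_ring_def)
qed

text \<open>The values at \<open>e\<close> of the two factors of an integral equation of \<open>e\<close> are brought into the shape
  that the invariant lifting of idempotents starts from.  Here \<open>J\<close> is the ideal of operators with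
  image in \<open>\<mm>M\<close>; it is stable under conjugation because automorphisms preserve the set
  of nonunits.\<close>
theorem henselian_idempotent_lift:
  assumes fin: "finite (carrier G)" and hens: "henselian Q \<mm>" and A: "Mod.generating A"
    and I: "ideal I (invariant_ring G S conjugate)"
    and idem: "e \<otimes>\<^bsub>S\<^esub> e \<ominus>\<^bsub>S\<^esub> e \<in> I"
  shows "\<exists>\<epsilon> \<in> carrier (invariant_ring G S conjugate). \<epsilon> \<otimes>\<^bsub>S\<^esub> \<epsilon> = \<epsilon> \<and> \<epsilon> \<ominus>\<^bsub>S\<^esub> e \<in> I"
proof -
  have loc: "local_ring Q \<mm>" using hens by (simp add: henselian_def)
  interpret Q: cring Q using loc by (simp add: local_ring_def)
  interpret m: maximalideal \<mm> Q using loc by (simp add: local_ring_def)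
  interpret A: finite_group_acting S G conjugate by (rule finite_group_acting_conjugate[OF fin])
  have U: "Units Q = carrier Q - \<mm>" by (rule local_ring_Units[OF loc])
  have nz: "\<one>\<^bsub>Q\<^esub> \<noteq> \<zero>\<^bsub>Q\<^esub>"
    using m.I_notcarr m.one_imp_carrier m.zero_closed by metis
  let ?ev = "eval Q S EE.scalar e"
  define J where "J = {s \<in> carrier S. \<forall>x \<in> carrier M. s x \<in> ideal_times \<mm> M}"
  have J_iff: "s \<in> J \<longleftrightarrow> s \<in> carrier S \<and> (\<forall>x \<in> carrier M. s x \<in> ideal_times \<mm> M)" for s
    unfolding J_def by (rule mem_Collect_eq)
  have J: "ideal J S" unfolding J_def by (rule EE.ideal_maps_into_ideal_times) (rule m.is_ideal)
  interpret J: ideal J S by (rule J)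
  have phi_m: "\<phi> g a \<in> \<mm>" if g: "g \<in> carrier G" and a: "a \<in> \<mm>" for g a
  proof (rule ccontr)
    assume "\<phi> g a \<notin> \<mm>"
    have aQ: "a \<in> carrier Q" using a m.a_subset by auto
    then have "\<phi> g a \<in> Units Q" using \<open>\<phi> g a \<notin> \<mm>\<close> U g by simp
    then obtain b where b: "b \<in> carrier Q" "b \<otimes>\<^bsub>Q\<^esub> \<phi> g a = \<one>\<^bsub>Q\<^esub>" unfolding Units_def by blast
    have g': "inv\<^bsub>G\<^esub> g \<in> carrier G" using g by (rule inv_closed)
    have "\<phi> (inv\<^bsub>G\<^esub> g) (\<phi> g a) = a" using act_inv(1)[OF g aQ] .
    then have "\<phi> (inv\<^bsub>G\<^esub> g) b \<otimes>\<^bsub>Q\<^esub> a = \<one>\<^bsub>Q\<^esub>"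
      using b aQ g act_ring_hom[OF g'] ring_hom_mult[OF act_ring_hom[OF g'] b(1), of "\<phi> g a"]
      by (simp add: ring_hom_one)
    moreover have "\<phi> (inv\<^bsub>G\<^esub> g) b \<otimes>\<^bsub>Q\<^esub> a \<in> \<mm>" using m.I_l_closed[OF a] g' b by simp
    ultimately show False using m.I_notcarr m.one_imp_carrier by simp
  qed
  have msub: "\<mm> \<subseteq> carrier Q" by (rule m.a_subset)
  have rho_m: "\<rho> g x \<in> ideal_times \<mm> M" if g: "g \<in> carrier G" and x: "x \<in> ideal_times \<mm> M" for g x
    using x
  proof induction
    case (smult a x)
    then have "\<rho> g (a \<odot>\<^bsub>M\<^esub> x) = \<phi> g a \<odot>\<^bsub>M\<^esub> \<rho> g x" "\<phi> g a \<in> \<mm>" "\<rho> g x \<in> carrier M"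
      using act_smult[OF g _ smult(2), of a] smult msub phi_m[OF g smult(1)] rho_closed[OF g smult(2)]
      by blast+
    then show ?case by (simp only: ideal_times.smult)
  next
    case (add x y)
    then have "\<rho> g (x \<oplus>\<^bsub>M\<^esub> y) = \<rho> g x \<oplus>\<^bsub>M\<^esub> \<rho> g y"
      using EE.ideal_times_subset[OF msub] by (intro act_add g)
    then show ?case using add.IH by (simp only: ideal_times.add)
  qed
  have J_stable: "conjugate g s \<in> J" if g: "g \<in> carrier G" and s: "s \<in> J" for g s
  proof -
    have "conjugate g s x \<in> ideal_times \<mm> M" if "x \<in> carrier M" for x
    proof -
      have "s (\<rho> (inv\<^bsub>G\<^esub> g) x) \<in> ideal_times \<mm> M"
        using s rho_closed[OF inv_closed[OF g] that] unfolding J_iff by blast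
      then show ?thesis unfolding conjugate_apply[OF that] by (rule rho_m[OF g])
    qed
    then show ?thesis using conjugate_in_S[OF g] s unfolding J_iff by blast
  qed
  have J_unit: "\<one>\<^bsub>S\<^esub> \<ominus>\<^bsub>S\<^esub> s \<in> Units S" if "s \<in> J" for s
  proof (rule EE.Nakayama_unit[OF A m.is_ideal local_ring_one_add_Units[OF loc]])
    show "s \<in> carrier S" "\<And>x. x \<in> carrier M \<Longrightarrow> s x \<in> ideal_times \<mm> M"
      using that unfolding J_iff by blast+
  qed
  obtain p where p: "p \<in> carrier (UP Q)" "monic Q p" "?ev p = \<zero>\<^bsub>S\<^esub>"
    using EE.integral_over_base[OF A nz] by blast
  obtain n g h where gh: "g \<in> carrier (UP Q)" "h \<in> carrier (UP Q)" "p = g \<otimes>\<^bsub>UP Q\<^esub> h"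
    and gm: "\<And>i. i \<noteq> n \<Longrightarrow> coeff (UP Q) g i \<in> \<mm>" and gn: "coeff (UP Q) g n \<ominus>\<^bsub>Q\<^esub> \<one>\<^bsub>Q\<^esub> \<in> \<mm>"
    and h0: "coeff (UP Q) h 0 \<in> Units Q"
    using hensel_split_off_zero[OF hens p(1,2)] by metis
  note eS = EE.e_in_S
  have scalar_J: "EE.scalar a \<otimes>\<^bsub>S\<^esub> s \<in> J" if "a \<in> \<mm>" "s \<in> carrier S" for a s
  proof -
    have "EE.scalar a \<in> carrier S" using that msub by (intro EE.scalar_in_S) blast
    moreover have "EE.scalar a x \<in> ideal_times \<mm> M" if "x \<in> carrier M" for x
      unfolding EE.scalar_apply[OF that] using \<open>a \<in> \<mm>\<close> that by (rule ideal_times.smult)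
    ultimately have "EE.scalar a \<in> J" unfolding J_iff by blast
    then show ?thesis using that by (intro J.I_r_closed)
  qed
  have evg: "?ev g \<in> carrier S" "?ev h \<in> carrier S" using gh by simp_all
  have gnQ: "coeff (UP Q) g n \<in> carrier Q" using gh EE.E.coeff_closed by blast
  have 1: "?ev g \<ominus>\<^bsub>S\<^esub> EE.scalar (coeff (UP Q) g n) \<otimes>\<^bsub>S\<^esub> e [^]\<^bsub>S\<^esub> n \<in> J"
    using scalar_J gm eS by (intro EE.eval_minus_term[OF J gh(1)]) auto
  have 2: "EE.scalar (coeff (UP Q) g n \<ominus>\<^bsub>Q\<^esub> \<one>\<^bsub>Q\<^esub>) \<otimes>\<^bsub>S\<^esub> e [^]\<^bsub>S\<^esub> n \<in> J"
    using scalar_J[OF gn] eS by simp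
  have ga: "?ev g \<ominus>\<^bsub>S\<^esub> e [^]\<^bsub>S\<^esub> n \<in> J"
  proof -
    have "?ev g \<ominus>\<^bsub>S\<^esub> e [^]\<^bsub>S\<^esub> n
        = (?ev g \<ominus>\<^bsub>S\<^esub> EE.scalar (coeff (UP Q) g n) \<otimes>\<^bsub>S\<^esub> e [^]\<^bsub>S\<^esub> n) \<oplus>\<^bsub>S\<^esub>
          EE.scalar (coeff (UP Q) g n \<ominus>\<^bsub>Q\<^esub> \<one>\<^bsub>Q\<^esub>) \<otimes>\<^bsub>S\<^esub> e [^]\<^bsub>S\<^esub> n"
      using evg eS gnQ
      by (simp add: a_minus_def EE.scalar_add EE.scalar_neg EE.scalar_one EE.scalar_in_S
          EE.S.l_distr EE.S.l_minus EE.S.a_assoc EE.S.r_neg1)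
    then show ?thesis using J.a_closed[OF 1 2] by simp
  qed
  have h0Q: "coeff (UP Q) h 0 \<in> carrier Q" "inv\<^bsub>Q\<^esub> coeff (UP Q) h 0 \<in> carrier Q" using h0 by auto
  have "?ev h \<ominus>\<^bsub>S\<^esub> EE.scalar (coeff (UP Q) h 0) \<otimes>\<^bsub>S\<^esub> e [^]\<^bsub>S\<^esub> (0::nat) \<in> PIdl\<^bsub>S\<^esub> e"
  proof (rule EE.eval_minus_term[OF EE.S.cgenideal_ideal[OF eS] gh(2)])
    fix i :: nat assume "i \<noteq> 0"
    then obtain k where k: "i = Suc k" by (cases i) auto
    have c: "EE.scalar (coeff (UP Q) h i) \<in> carrier S"
      using gh(2) by (intro EE.scalar_in_S EE.E.coeff_closed)
    have "EE.scalar (coeff (UP Q) h i) \<otimes>\<^bsub>S\<^esub> e [^]\<^bsub>S\<^esub> i = (EE.scalar (coeff (UP Q) h i) \<otimes>\<^bsub>S\<^esub> e [^]\<^bsub>S\<^esub> k) \<otimes>\<^bsub>S\<^esub> e"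
      using c eS k by (simp add: EE.S.m_assoc)
    then show "EE.scalar (coeff (UP Q) h i) \<otimes>\<^bsub>S\<^esub> e [^]\<^bsub>S\<^esub> i \<in> PIdl\<^bsub>S\<^esub> e"
      using c eS unfolding cgenideal_def by auto
  qed
  then obtain v where v: "v \<in> carrier S" and hv: "?ev h \<ominus>\<^bsub>S\<^esub> EE.scalar (coeff (UP Q) h 0) = v \<otimes>\<^bsub>S\<^esub> e"
    using EE.scalar_in_S[OF h0Q(1)] by (auto simp: cgenideal_def)
  \<comment> \<open>normalizes the constant term of the second factor to \<open>1\<close>\<close>
  define \<eta> where "\<eta> = EE.scalar (inv\<^bsub>Q\<^esub> coeff (UP Q) h 0)"
  have \<eta>: "\<eta> \<in> carrier S" unfolding \<eta>_def using h0Q by (intro EE.scalar_in_S)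
  have \<eta>1: "\<eta> \<otimes>\<^bsub>S\<^esub> EE.scalar (coeff (UP Q) h 0) = \<one>\<^bsub>S\<^esub>"
    unfolding \<eta>_def using h0Q h0 by (simp add: EE.scalar_mult[symmetric] EE.scalar_one)
  have sc: "EE.scalar (coeff (UP Q) h 0) \<in> carrier S" using h0Q(1) by (rule EE.scalar_in_S)
  have "?ev h = EE.scalar (coeff (UP Q) h 0) \<oplus>\<^bsub>S\<^esub> v \<otimes>\<^bsub>S\<^esub> e"
    unfolding hv[symmetric] using evg sc EE.S.a_comm[of "?ev h" "\<ominus>\<^bsub>S\<^esub> EE.scalar (coeff (UP Q) h 0)"]
    by (simp add: a_minus_def EE.S.r_neg2)
  then have "\<eta> \<otimes>\<^bsub>S\<^esub> ?ev h = \<one>\<^bsub>S\<^esub> \<oplus>\<^bsub>S\<^esub> \<eta> \<otimes>\<^bsub>S\<^esub> (v \<otimes>\<^bsub>S\<^esub> e)"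
    using \<eta> sc v eS by (simp add: EE.S.r_distr \<eta>1)
  also have "\<dots> = \<one>\<^bsub>S\<^esub> \<ominus>\<^bsub>S\<^esub> e \<otimes>\<^bsub>S\<^esub> (\<ominus>\<^bsub>S\<^esub> (\<eta> \<otimes>\<^bsub>S\<^esub> v))"
    using \<eta> v eS by (simp add: a_minus_def EE.S.r_minus EE.S.m_ac)
  finally have b: "\<one>\<^bsub>S\<^esub> \<ominus>\<^bsub>S\<^esub> e \<otimes>\<^bsub>S\<^esub> (\<ominus>\<^bsub>S\<^esub> (\<eta> \<otimes>\<^bsub>S\<^esub> v)) = \<eta> \<otimes>\<^bsub>S\<^esub> ?ev h" by simp
  have gh0: "?ev g \<otimes>\<^bsub>S\<^esub> ?ev h = \<zero>\<^bsub>S\<^esub>" using p(3) gh by simp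
  show ?thesis
  proof (rule A.equivariant_idempotent_lift[OF J J_stable J_unit I _ idem evg(1) ga])
    show "e \<in> carrier (invariant_ring G S conjugate)"
      using eS e_equivariant by (simp add: conjugate_invariant_iff)
    show "\<ominus>\<^bsub>S\<^esub> (\<eta> \<otimes>\<^bsub>S\<^esub> v) \<in> carrier S" using \<eta> v by simp
    have "?ev g \<otimes>\<^bsub>S\<^esub> (\<eta> \<otimes>\<^bsub>S\<^esub> ?ev h) = \<eta> \<otimes>\<^bsub>S\<^esub> (?ev g \<otimes>\<^bsub>S\<^esub> ?ev h)"
      by (rule EE.S.m_lcomm[OF evg(1) \<eta> evg(2)])
    then show "?ev g \<otimes>\<^bsub>S\<^esub> (\<one>\<^bsub>S\<^esub> \<ominus>\<^bsub>S\<^esub> e \<otimes>\<^bsub>S\<^esub> (\<ominus>\<^bsub>S\<^esub> (\<eta> \<otimes>\<^bsub>S\<^esub> v))) = \<zero>\<^bsub>S\<^esub>"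
      unfolding b gh0 using \<eta> by simp
  qed
qed

end

section \<open>Homotopy of maps of matrix factorizations\<close>

locale mf_object =
  fixes G :: "('g, 'x) monoid_scheme" and Q :: "('q, 'y) ring_scheme"
    and \<phi> :: "'g \<Rightarrow> 'q \<Rightarrow> 'q" and f :: 'q and P :: "('q, 'g, 'm) eqmf"
  assumes mf: "matrix_factorization G Q \<phi> f P"
begin

abbreviation M where "M \<equiv> und P"
abbreviation d where "d \<equiv> diff P"

lemma twisted: "twisted_module G Q \<phi> M (act P)" and gr: "graded G Q P"
  and fg: "finitely_generated Q M" and proj: "projective Q M"
  and d_odd: "d \<in> odd_maps G Q P P" and dd: "x \<in> carrier M \<Longrightarrow> d (d x) = f \<odot>\<^bsub>M\<^esub> x"
  using mf by (auto simp: matrix_factorization_def)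

sublocale M: module Q M
  using twisted by (rule twisted_module.axioms(2))

lemma act_closed: "\<lbrakk>g \<in> carrier G; x \<in> carrier M\<rbrakk> \<Longrightarrow> act P g x \<in> carrier M"
  using group_action.element_image[OF twisted_module.axioms(3)[OF twisted]] by blast

lemma act_add: "\<lbrakk>g \<in> carrier G; x \<in> carrier M; y \<in> carrier M\<rbrakk>
    \<Longrightarrow> act P g (x \<oplus>\<^bsub>M\<^esub> y) = act P g x \<oplus>\<^bsub>M\<^esub> act P g y"
  by (rule twisted_module.act_add[OF twisted])

lemma act_zero: "g \<in> carrier G \<Longrightarrow> act P g \<zero>\<^bsub>M\<^esub> = \<zero>\<^bsub>M\<^esub>"
  using act_add[of g "\<zero>\<^bsub>M\<^esub>" "\<zero>\<^bsub>M\<^esub>"] act_closed[of g "\<zero>\<^bsub>M\<^esub>"] by simp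

lemma act_neg: "\<lbrakk>g \<in> carrier G; x \<in> carrier M\<rbrakk> \<Longrightarrow> act P g (\<ominus>\<^bsub>M\<^esub> x) = \<ominus>\<^bsub>M\<^esub> act P g x"
  using act_add[of g "\<ominus>\<^bsub>M\<^esub> x" x] act_zero[of g] act_closed[of g]
  by (simp add: M.M.l_neg M.M.minus_equality)

lemma ev: "submodule (ev P) Q M" and od: "submodule (od P) Q M"
  and act_ev: "\<lbrakk>g \<in> carrier G; x \<in> ev P\<rbrakk> \<Longrightarrow> act P g x \<in> ev P"
  and act_od: "\<lbrakk>g \<in> carrier G; x \<in> od P\<rbrakk> \<Longrightarrow> act P g x \<in> od P"
  and ev_od: "ev P \<inter> od P = {\<zero>\<^bsub>M\<^esub>}" "ev P <+>\<^bsub>M\<^esub> od P = carrier M"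
  using gr unfolding graded_def by blast+

lemma ev_closed: "x \<in> ev P \<Longrightarrow> x \<in> carrier M" and od_closed: "x \<in> od P \<Longrightarrow> x \<in> carrier M"
  using M.submoduleE(1)[OF ev] M.submoduleE(1)[OF od] by blast+

lemma zero_ev: "\<zero>\<^bsub>M\<^esub> \<in> ev P" and zero_od: "\<zero>\<^bsub>M\<^esub> \<in> od P"
  using ev_od(1) by auto

lemma d_linear: "d \<in> linear_maps Q M M"
  and d_act: "\<lbrakk>g \<in> carrier G; x \<in> carrier M\<rbrakk> \<Longrightarrow> d (act P g x) = act P g (d x)"
  and d_ev: "x \<in> ev P \<Longrightarrow> d x \<in> od P" and d_od: "x \<in> od P \<Longrightarrow> d x \<in> ev P"
  using d_odd by (auto simp: odd_maps_def twisted_linear_maps_def)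

sublocale d: linear_map Q M M d
  using d_linear by unfold_locales

end

lemma mem_odd_maps:
  "h \<in> odd_maps G Q P P' \<longleftrightarrow> h \<in> linear_maps Q (und P) (und P') \<and>
     (\<forall>g \<in> carrier G. \<forall>x \<in> carrier (und P). h (act P g x) = act P' g (h x)) \<and>
     (\<forall>x \<in> ev P. h x \<in> od P') \<and> (\<forall>x \<in> od P. h x \<in> ev P')"
  by (auto simp: odd_maps_def twisted_linear_maps_def)

lemma mem_even_maps:
  "h \<in> even_maps G Q P P' \<longleftrightarrow> h \<in> linear_maps Q (und P) (und P') \<and>
     (\<forall>g \<in> carrier G. \<forall>x \<in> carrier (und P). h (act P g x) = act P' g (h x)) \<and>
     (\<forall>x \<in> ev P. h x \<in> ev P') \<and> (\<forall>x \<in> od P. h x \<in> od P')"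
  by (auto simp: even_maps_def twisted_linear_maps_def)

lemma mem_Hom:
  "\<alpha> \<in> Hom (mf G Q \<phi> f) P P' \<longleftrightarrow>
     \<alpha> \<in> even_maps G Q P P' \<and> (\<forall>x \<in> carrier (und P). \<alpha> (diff P x) = diff P' (\<alpha> x))"
  by (simp add: mf_def)

locale mf_pair = P: mf_object G Q \<phi> f P + P': mf_object G Q \<phi> f P'
  for G :: "('g, 'x) monoid_scheme" and Q :: "('q, 'y) ring_scheme"
    and \<phi> :: "'g \<Rightarrow> 'q \<Rightarrow> 'q" and f :: 'q and P P' :: "('q, 'g, 'm) eqmf"
begin

lemma linear_mapI: "h \<in> linear_maps Q P.M P'.M \<Longrightarrow> linear_map Q P.M P'.M h"
  by unfold_locales

lemma odd_zero: "(\<lambda>x\<in>carrier P.M. \<zero>\<^bsub>P'.M\<^esub>) \<in> odd_maps G Q P P'"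
  unfolding mem_odd_maps
proof (intro conjI ballI linear_mapsI)
qed (simp_all add: P.act_closed P'.act_zero P.ev_closed P.od_closed P'.zero_ev P'.zero_od)

lemma odd_neg:
  assumes h: "h \<in> odd_maps G Q P P'"
  shows "(\<lambda>x\<in>carrier P.M. \<ominus>\<^bsub>P'.M\<^esub> h x) \<in> odd_maps G Q P P'"
proof -
  note h' = h[unfolded mem_odd_maps]
  interpret h: linear_map Q P.M P'.M h using h' by (intro linear_mapI) blast
  show ?thesis
    unfolding mem_odd_maps
  proof (intro conjI ballI linear_mapsI)
  qed (use h' in \<open>simp_all add: P.act_closed P'.act_neg P.ev_closed P.od_closed h.add h.smult
        P'.M.M.minus_add P'.M.smult_r_minus P'.M.submoduleE(3)[OF P'.ev] P'.M.submoduleE(3)[OF P'.od]\<close>)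
qed

lemma odd_add:
  assumes h: "h \<in> odd_maps G Q P P'" and k: "k \<in> odd_maps G Q P P'"
  shows "(\<lambda>x\<in>carrier P.M. h x \<oplus>\<^bsub>P'.M\<^esub> k x) \<in> odd_maps G Q P P'"
proof -
  note h' = h[unfolded mem_odd_maps] and k' = k[unfolded mem_odd_maps]
  interpret h: linear_map Q P.M P'.M h using h' by (intro linear_mapI) blast
  interpret k: linear_map Q P.M P'.M k using k' by (intro linear_mapI) blast
  show ?thesis
    unfolding mem_odd_maps
  proof (intro conjI ballI linear_mapsI)
  qed (use h' k' in \<open>simp_all add: P.act_closed P'.act_add P.ev_closed P.od_closed h.add h.smult k.add k.smult
        P'.M.M.a_ac P'.M.smult_r_distr P'.M.submoduleE(5)[OF P'.ev] P'.M.submoduleE(5)[OF P'.od]\<close>)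
qed

lemma equiv_homotopy: "equiv (Hom (mf G Q \<phi> f) P P') (homotopy_rel G Q \<phi> f P P')"
proof (rule equivI)
  let ?H = "Hom (mf G Q \<phi> f) P P'" and ?r = "homotopy_rel G Q \<phi> f P P'"
  show "?r \<subseteq> ?H \<times> ?H" by (auto simp: homotopy_rel_def)
  have lin: "linear_map Q P.M P'.M \<alpha>" if "\<alpha> \<in> ?H" for \<alpha>
    using that by (intro linear_mapI) (simp add: mem_Hom mem_even_maps)
  have lin': "linear_map Q P.M P'.M h" if "h \<in> odd_maps G Q P P'" for h
    using that by (intro linear_mapI) (simp add: mem_odd_maps)
  show "refl_on ?H ?r"
  proof (rule refl_onI)
    fix \<alpha> assume \<alpha>: "\<alpha> \<in> ?H"
    interpret \<alpha>: linear_map Q P.M P'.M \<alpha> by (rule lin[OF \<alpha>])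
    show "(\<alpha>, \<alpha>) \<in> ?r"
      unfolding homotopy_rel_def using \<alpha> odd_zero
      by (auto simp: P'.M.M.minus_eq P'.M.M.r_neg intro!: bexI[OF _ odd_zero])
  qed
  show "sym ?r"
  proof (rule symI)
    fix \<alpha> \<beta> assume ab: "(\<alpha>, \<beta>) \<in> ?r"
    then obtain h where H: "\<alpha> \<in> ?H" "\<beta> \<in> ?H" and h: "h \<in> odd_maps G Q P P'"
      and eq: "\<And>x. x \<in> carrier P.M \<Longrightarrow> \<alpha> x \<ominus>\<^bsub>P'.M\<^esub> \<beta> x = P'.d (h x) \<oplus>\<^bsub>P'.M\<^esub> h (P.d x)"
      unfolding homotopy_rel_def by blast
    interpret \<alpha>: linear_map Q P.M P'.M \<alpha> by (rule lin[OF H(1)])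
    interpret \<beta>: linear_map Q P.M P'.M \<beta> by (rule lin[OF H(2)])
    interpret h: linear_map Q P.M P'.M h by (rule lin'[OF h])
    let ?k = "\<lambda>x\<in>carrier P.M. \<ominus>\<^bsub>P'.M\<^esub> h x"
    have "\<beta> x \<ominus>\<^bsub>P'.M\<^esub> \<alpha> x = P'.d (?k x) \<oplus>\<^bsub>P'.M\<^esub> ?k (P.d x)" if x: "x \<in> carrier P.M" for x
    proof -
      have "\<beta> x \<ominus>\<^bsub>P'.M\<^esub> \<alpha> x = \<ominus>\<^bsub>P'.M\<^esub> (\<alpha> x \<ominus>\<^bsub>P'.M\<^esub> \<beta> x)"
        using x by (simp add: P'.M.M.minus_eq P'.M.M.minus_add P'.M.M.a_comm)
      then show ?thesis unfolding eq[OF x] using x by (simp add: P'.d.neg P'.M.M.minus_add)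
    qed
    then show "(\<beta>, \<alpha>) \<in> ?r" unfolding homotopy_rel_def using H odd_neg[OF h] by blast
  qed
  show "trans ?r"
  proof (rule transI)
    fix \<alpha> \<beta> \<gamma> assume ab: "(\<alpha>, \<beta>) \<in> ?r" and bc: "(\<beta>, \<gamma>) \<in> ?r"
    obtain h where H: "\<alpha> \<in> ?H" "\<beta> \<in> ?H" and h: "h \<in> odd_maps G Q P P'"
      and eq: "\<And>x. x \<in> carrier P.M \<Longrightarrow> \<alpha> x \<ominus>\<^bsub>P'.M\<^esub> \<beta> x = P'.d (h x) \<oplus>\<^bsub>P'.M\<^esub> h (P.d x)"
      using ab unfolding homotopy_rel_def by blast
    obtain k where K: "\<gamma> \<in> ?H" and k: "k \<in> odd_maps G Q P P'"
      and eq': "\<And>x. x \<in> carrier P.M \<Longrightarrow> \<beta> x \<ominus>\<^bsub>P'.M\<^esub> \<gamma> x = P'.d (k x) \<oplus>\<^bsub>P'.M\<^esub> k (P.d x)"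
      using bc unfolding homotopy_rel_def by blast
    interpret \<alpha>: linear_map Q P.M P'.M \<alpha> by (rule lin[OF H(1)])
    interpret \<beta>: linear_map Q P.M P'.M \<beta> by (rule lin[OF H(2)])
    interpret \<gamma>: linear_map Q P.M P'.M \<gamma> by (rule lin[OF K])
    interpret h: linear_map Q P.M P'.M h by (rule lin'[OF h])
    interpret k: linear_map Q P.M P'.M k by (rule lin'[OF k])
    let ?k = "\<lambda>x\<in>carrier P.M. h x \<oplus>\<^bsub>P'.M\<^esub> k x"
    have "\<alpha> x \<ominus>\<^bsub>P'.M\<^esub> \<gamma> x = P'.d (?k x) \<oplus>\<^bsub>P'.M\<^esub> ?k (P.d x)" if x: "x \<in> carrier P.M" for x
    proof -
      have "\<alpha> x \<ominus>\<^bsub>P'.M\<^esub> \<gamma> x = (\<alpha> x \<ominus>\<^bsub>P'.M\<^esub> \<beta> x) \<oplus>\<^bsub>P'.M\<^esub> (\<beta> x \<ominus>\<^bsub>P'.M\<^esub> \<gamma> x)"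
        using x by (simp add: P'.M.M.minus_eq P'.M.M.a_assoc P'.M.M.r_neg1)
      then show ?thesis unfolding eq[OF x] eq'[OF x] using x by (simp add: P'.d.add P'.M.M.a_ac)
    qed
    then show "(\<alpha>, \<gamma>) \<in> ?r" unfolding homotopy_rel_def using H K odd_add[OF h k] by blast
  qed
qed

end

locale mf_triple = PP': mf_pair G Q \<phi> f P P' + P'P'': mf_pair G Q \<phi> f P' P''
  for G :: "('g, 'x) monoid_scheme" and Q :: "('q, 'y) ring_scheme"
    and \<phi> :: "'g \<Rightarrow> 'q \<Rightarrow> 'q" and f :: 'q and P P' P'' :: "('q, 'g, 'm) eqmf"
begin

sublocale PP'': mf_pair G Q \<phi> f P P'' ..

lemma even_then_odd:
  assumes \<alpha>: "\<alpha> \<in> even_maps G Q P P'" and h: "h \<in> odd_maps G Q P' P''"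
  shows "compose (carrier (und P)) h \<alpha> \<in> odd_maps G Q P P''"
proof -
  note a = \<alpha>[unfolded mem_even_maps] and b = h[unfolded mem_odd_maps]
  have "\<alpha> x \<in> carrier (und P')" if "x \<in> carrier (und P)" for x
    using a that by (auto simp: linear_maps_def)
  then show ?thesis
    unfolding mem_odd_maps using a b linear_maps_compose[of \<alpha> Q "und P" "und P'" h "und P''"] PP'.P.M.module_axioms
    by (simp add: compose_def PP'.P.act_closed PP'.P.ev_closed PP'.P.od_closed)
qed

lemma odd_then_even:
  assumes h: "h \<in> odd_maps G Q P P'" and \<alpha>: "\<alpha> \<in> even_maps G Q P' P''"
  shows "compose (carrier (und P)) \<alpha> h \<in> odd_maps G Q P P''"
proof -
  note a = \<alpha>[unfolded mem_even_maps] and b = h[unfolded mem_odd_maps]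
  have "h x \<in> carrier (und P')" if "x \<in> carrier (und P)" for x
    using b that by (auto simp: linear_maps_def)
  then show ?thesis
    unfolding mem_odd_maps using a b linear_maps_compose[of h Q "und P" "und P'" \<alpha> "und P''"] PP'.P.M.module_axioms
    by (simp add: compose_def PP'.P.act_closed PP'.P.ev_closed PP'.P.od_closed)
qed

lemma Hom_compose:
  assumes \<alpha>: "\<alpha> \<in> Hom (mf G Q \<phi> f) P P'" and \<beta>: "\<beta> \<in> Hom (mf G Q \<phi> f) P' P''"
  shows "compose (carrier (und P)) \<beta> \<alpha> \<in> Hom (mf G Q \<phi> f) P P''"
proof -
  note a = \<alpha>[unfolded mem_Hom mem_even_maps] and b = \<beta>[unfolded mem_Hom mem_even_maps]
  have "\<alpha> x \<in> carrier (und P')" if "x \<in> carrier (und P)" for x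
    using a that by (auto simp: linear_maps_def)
  then show ?thesis
    unfolding mem_Hom mem_even_maps using a b linear_maps_compose[of \<alpha> Q "und P" "und P'" \<beta> "und P''"] PP'.P.M.module_axioms
    by (simp add: compose_def PP'.P.act_closed PP'.P.ev_closed PP'.P.od_closed)
qed

text \<open>If \<open>h\<close> and \<open>k\<close> are homotopies for the two factors, \<open>\<beta> h + k \<alpha>'\<close> is one for the composites.\<close>
lemma homotopy_compose:
  assumes \<alpha>: "(\<alpha>, \<alpha>') \<in> homotopy_rel G Q \<phi> f P P'" and \<beta>: "(\<beta>, \<beta>') \<in> homotopy_rel G Q \<phi> f P' P''"
  shows "(compose (carrier (und P)) \<beta> \<alpha>, compose (carrier (und P)) \<beta>' \<alpha>') \<in> homotopy_rel G Q \<phi> f P P''"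
proof -
  obtain h where a: "\<alpha> \<in> Hom (mf G Q \<phi> f) P P'" "\<alpha>' \<in> Hom (mf G Q \<phi> f) P P'" and h: "h \<in> odd_maps G Q P P'"
    and eq: "\<And>x. x \<in> carrier (und P) \<Longrightarrow> \<alpha> x \<ominus>\<^bsub>und P'\<^esub> \<alpha>' x = diff P' (h x) \<oplus>\<^bsub>und P'\<^esub> h (diff P x)"
    using \<alpha> unfolding homotopy_rel_def by blast
  obtain k where b: "\<beta> \<in> Hom (mf G Q \<phi> f) P' P''" "\<beta>' \<in> Hom (mf G Q \<phi> f) P' P''" and k: "k \<in> odd_maps G Q P' P''"
    and eq': "\<And>x. x \<in> carrier (und P') \<Longrightarrow> \<beta> x \<ominus>\<^bsub>und P''\<^esub> \<beta>' x = diff P'' (k x) \<oplus>\<^bsub>und P''\<^esub> k (diff P' x)"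
    using \<beta> unfolding homotopy_rel_def by blast
  interpret \<alpha>: linear_map Q "und P" "und P'" \<alpha> using a by (intro PP'.linear_mapI) (simp add: mem_Hom mem_even_maps)
  interpret \<alpha>': linear_map Q "und P" "und P'" \<alpha>' using a by (intro PP'.linear_mapI) (simp add: mem_Hom mem_even_maps)
  interpret \<beta>: linear_map Q "und P'" "und P''" \<beta> using b by (intro P'P''.linear_mapI) (simp add: mem_Hom mem_even_maps)
  interpret \<beta>': linear_map Q "und P'" "und P''" \<beta>' using b by (intro P'P''.linear_mapI) (simp add: mem_Hom mem_even_maps)
  interpret h: linear_map Q "und P" "und P'" h using h by (intro PP'.linear_mapI) (simp add: mem_odd_maps)
  interpret k: linear_map Q "und P'" "und P''" k using k by (intro P'P''.linear_mapI) (simp add: mem_odd_maps)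
  have ev: "\<beta> \<in> even_maps G Q P' P''" "\<alpha>' \<in> even_maps G Q P P'" using a b by (simp_all add: mem_Hom)
  let ?h = "compose (carrier (und P)) \<beta> h" and ?k = "compose (carrier (und P)) k \<alpha>'"
  define H where "H = (\<lambda>x\<in>carrier (und P). ?h x \<oplus>\<^bsub>und P''\<^esub> ?k x)"
  have H: "H \<in> odd_maps G Q P P''"
    unfolding H_def by (rule PP''.odd_add[OF odd_then_even[OF h ev(1)] even_then_odd[OF ev(2) k]])
  have "compose (carrier (und P)) \<beta> \<alpha> x \<ominus>\<^bsub>und P''\<^esub> compose (carrier (und P)) \<beta>' \<alpha>' x
      = diff P'' (H x) \<oplus>\<^bsub>und P''\<^esub> H (diff P x)" if x: "x \<in> carrier (und P)" for x
  proof -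
    have c: "\<beta> (diff P' y) = diff P'' (\<beta> y)" if "y \<in> carrier (und P')" for y using b that by (simp add: mem_Hom)
    have c': "\<alpha>' (diff P x) = diff P' (\<alpha>' x)" using a x by (simp add: mem_Hom)
    have "\<beta> (\<alpha> x) \<ominus>\<^bsub>und P''\<^esub> \<beta>' (\<alpha>' x)
        = \<beta> (\<alpha> x \<ominus>\<^bsub>und P'\<^esub> \<alpha>' x) \<oplus>\<^bsub>und P''\<^esub> (\<beta> (\<alpha>' x) \<ominus>\<^bsub>und P''\<^esub> \<beta>' (\<alpha>' x))"
      using x by (simp add: \<beta>.minus P'P''.P'.M.M.minus_eq P'P''.P'.M.M.a_assoc P'P''.P'.M.M.r_neg1)
    also have "\<dots> = (diff P'' (\<beta> (h x)) \<oplus>\<^bsub>und P''\<^esub> \<beta> (h (diff P x))) \<oplus>\<^bsub>und P''\<^esub>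
        (diff P'' (k (\<alpha>' x)) \<oplus>\<^bsub>und P''\<^esub> k (\<alpha>' (diff P x)))"
      using x by (simp add: eq eq' \<beta>.add c c')
    also have "\<dots> = diff P'' (H x) \<oplus>\<^bsub>und P''\<^esub> H (diff P x)"
      using x by (simp add: H_def compose_def P'P''.P'.d.add P'P''.P'.M.M.a_ac)
    finally show ?thesis using x by (simp add: compose_def)
  qed
  then show ?thesis unfolding homotopy_rel_def
    using H Hom_compose[OF a(1) b(1)] Hom_compose[OF a(2) b(2)] by blast
qed

lemma Comp_homotopy_classes:
  assumes \<alpha>: "\<alpha> \<in> Hom (mf G Q \<phi> f) P P'" and \<beta>: "\<beta> \<in> Hom (mf G Q \<phi> f) P' P''"
  shows "Comp (homotopy_mf G Q \<phi> f) P P' P'' (homotopy_rel G Q \<phi> f P' P'' `` {\<beta>}) (homotopy_rel G Q \<phi> f P P' `` {\<alpha>})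
    = homotopy_rel G Q \<phi> f P P'' `` {compose (carrier (und P)) \<beta> \<alpha>}" (is "_ = ?R")
proof -
  have 1: "homotopy_rel G Q \<phi> f P P'' `` {compose (carrier (und P)) \<beta>' \<alpha>'} = ?R"
    if "\<beta>' \<in> homotopy_rel G Q \<phi> f P' P'' `` {\<beta>}" "\<alpha>' \<in> homotopy_rel G Q \<phi> f P P' `` {\<alpha>}" for \<alpha>' \<beta>'
    using equiv_class_eq[OF PP''.equiv_homotopy homotopy_compose[of \<alpha> \<alpha>' \<beta> \<beta>']] that by simp
  have 2: "\<beta> \<in> homotopy_rel G Q \<phi> f P' P'' `` {\<beta>}" "\<alpha> \<in> homotopy_rel G Q \<phi> f P P' `` {\<alpha>}"
    using equiv_class_self[OF P'P''.equiv_homotopy \<beta>] equiv_class_self[OF PP'.equiv_homotopy \<alpha>] .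
  have "Comp (homotopy_mf G Q \<phi> f) P P' P'' (homotopy_rel G Q \<phi> f P' P'' `` {\<beta>}) (homotopy_rel G Q \<phi> f P P' `` {\<alpha>})
      = (\<Union>\<beta>'\<in>homotopy_rel G Q \<phi> f P' P'' `` {\<beta>}. \<Union>\<alpha>'\<in>homotopy_rel G Q \<phi> f P P' `` {\<alpha>}.
          homotopy_rel G Q \<phi> f P P'' `` {compose (carrier (und P)) \<beta>' \<alpha>'})"
    by (simp add: homotopy_mf_def quotient_category_def mf_def)
  also have "\<dots> = (\<Union>\<beta>'\<in>homotopy_rel G Q \<phi> f P' P'' `` {\<beta>}. \<Union>\<alpha>'\<in>homotopy_rel G Q \<phi> f P P' `` {\<alpha>}. ?R)"
    using 1 by (intro SUP_cong refl) blast
  also have "\<dots> = ?R" using 2 by blast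
  finally show ?thesis .
qed

end

section \<open>Idempotents of matrix factorizations\<close>

context mf_object
begin

lemma self_pair: "mf_pair G Q \<phi> f P P" ..

text \<open>The image of \<open>\<epsilon>\<close> is taken as its set of fixed points, a subset of the carrier of \<open>P\<close>.  The
  action and the differential commute with \<open>\<epsilon>\<close> and so restrict to it; \<open>\<epsilon>\<close> preserves parity, so
  the homogeneous components of a fixed point are fixed.\<close>
lemma split_idempotent:
  assumes \<epsilon>: "\<epsilon> \<in> Hom (mf G Q \<phi> f) P P" and idem: "compose (carrier M) \<epsilon> \<epsilon> = \<epsilon>"
  shows "\<exists>Y \<in> Ob (mf G Q \<phi> f). \<exists>\<pi> \<in> Hom (mf G Q \<phi> f) P Y. \<exists>\<iota> \<in> Hom (mf G Q \<phi> f) Y P.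
    compose (carrier (und Y)) \<pi> \<iota> = (\<lambda>x\<in>carrier (und Y). x) \<and> compose (carrier M) \<iota> \<pi> = \<epsilon>"
proof -
  note e = \<epsilon>[unfolded mem_Hom mem_even_maps]
  interpret e: linear_map Q M M \<epsilon> using e by unfold_locales blast
  have e_act: "\<epsilon> (act P g x) = act P g (\<epsilon> x)" if "g \<in> carrier G" "x \<in> carrier M" for g x
    using e that by blast
  have e_ev: "\<epsilon> x \<in> ev P" if "x \<in> ev P" for x using e that by blast
  have e_od: "\<epsilon> x \<in> od P" if "x \<in> od P" for x using e that by blast
  have e_d: "\<epsilon> (d x) = d (\<epsilon> x)" if "x \<in> carrier M" for x using e that by blast
  have ee: "\<epsilon> (\<epsilon> x) = \<epsilon> x" if "x \<in> carrier M" for x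
    using fun_cong[OF idem, of x] that by (simp add: compose_def)
  define N where "N = {x \<in> carrier M. \<epsilon> x = x}"
  have N: "x \<in> N \<longleftrightarrow> x \<in> carrier M \<and> \<epsilon> x = x" for x by (simp add: N_def)
  have eN: "\<epsilon> x \<in> N" if "x \<in> carrier M" for x using that ee by (simp add: N)
  have NM: "x \<in> carrier M" if "x \<in> N" for x using that by (simp add: N)
  have sub: "submodule N Q M"
    by (rule M.submoduleI) (auto simp: N e.add e.smult e.neg)
  define Y where "Y = \<lparr>und = M\<lparr>carrier := N\<rparr>, act = (\<lambda>g. \<lambda>x\<in>N. act P g x),
    ev = ev P \<inter> N, od = od P \<inter> N, diff = (\<lambda>x\<in>N. d x)\<rparr>"
  have uY: "carrier (und Y) = N" "add (und Y) = add M" "smult (und Y) = smult M" "zero (und Y) = zero M"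
    by (simp_all add: Y_def)
  have aY: "act Y = (\<lambda>g. \<lambda>x\<in>N. act P g x)" "ev Y = ev P \<inter> N" "od Y = od P \<inter> N" "diff Y = (\<lambda>x\<in>N. d x)"
    by (simp_all add: Y_def)
  have modY: "module Q (und Y)"
    unfolding Y_def using submodule.submodule_is_module[OF sub M.module_axioms] by simp
  interpret Y: module Q "und Y" by (rule modY)
  have negY: "\<ominus>\<^bsub>und Y\<^esub> x = \<ominus>\<^bsub>M\<^esub> x" if "x \<in> N" for x
  proof -
    have "\<ominus>\<^bsub>M\<^esub> x \<oplus>\<^bsub>und Y\<^esub> x = \<zero>\<^bsub>und Y\<^esub>" using NM[OF that] by (simp add: uY M.M.l_neg)
    moreover have "\<ominus>\<^bsub>M\<^esub> x \<in> carrier (und Y)" using that by (simp add: uY N e.neg)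
    ultimately show ?thesis using that by (intro Y.M.minus_equality) (simp_all add: uY)
  qed
  interpret T: twisted_module G Q \<phi> M "act P" by (rule twisted)
  have grp: "group G" using T.Act.group_hom by (rule group_hom.axioms(1))
  have actN: "act P g x \<in> N" if "g \<in> carrier G" "x \<in> N" for g x
    using that by (simp add: N act_closed e_act)
  have bij: "(\<lambda>x\<in>N. act P g x) \<in> Bij N" if g: "g \<in> carrier G" for g
  proof -
    have g': "inv\<^bsub>G\<^esub> g \<in> carrier G" using group.inv_closed[OF grp g] .
    have "bij_betw (\<lambda>x\<in>N. act P g x) N N"
    proof (rule bij_betw_byWitness[where f' = "\<lambda>x\<in>N. act P (inv\<^bsub>G\<^esub> g) x"])
      show "\<forall>a\<in>N. (\<lambda>x\<in>N. act P (inv\<^bsub>G\<^esub> g) x) ((\<lambda>x\<in>N. act P g x) a) = a"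
        using actN[OF g] T.Act.orbit_sym_aux[OF g NM refl] by simp
      show "\<forall>a\<in>N. (\<lambda>x\<in>N. act P g x) ((\<lambda>x\<in>N. act P (inv\<^bsub>G\<^esub> g) x) a) = a"
        using actN[OF g'] T.Act.orbit_sym_aux[OF g' NM refl] group.inv_inv[OF grp g] by simp
    qed (use actN g g' in auto)
    then show ?thesis by (simp add: Bij_def)
  qed
  have actY: "group_action G (carrier (und Y)) (act Y)"
    unfolding uY aY(1)
  proof (intro group_action.intro group_hom.intro grp group_BijGroup group_hom_axioms.intro homI)
    show "(\<lambda>x\<in>N. act P g x) \<in> carrier (BijGroup N)" if "g \<in> carrier G" for g
      using bij[OF that] by (simp add: BijGroup_def)
    fix g h assume g: "g \<in> carrier G" and h: "h \<in> carrier G"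
    have "(\<lambda>x\<in>N. act P (g \<otimes>\<^bsub>G\<^esub> h) x) = compose N (\<lambda>x\<in>N. act P g x) (\<lambda>x\<in>N. act P h x)"
      using g h actN NM T.Act.composition_rule by (auto simp: compose_def)
    then show "(\<lambda>x\<in>N. act P (g \<otimes>\<^bsub>G\<^esub> h) x)
        = (\<lambda>x\<in>N. act P g x) \<otimes>\<^bsub>BijGroup N\<^esub> (\<lambda>x\<in>N. act P h x)"
      using bij[OF g] bij[OF h] by (simp add: BijGroup_def)
  qed
  have twY: "twisted_module G Q \<phi> (und Y) (act Y)"
  proof (intro twisted_module.intro twisted_module_axioms.intro modY actY)
    show "ring_action G Q \<phi>" by (rule twisted_module.axioms(1)[OF twisted])
  qed (use Y.M.add.m_closed Y.smult_closed in \<open>auto simp: uY aY act_add T.act_smult NM\<close>)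
  have subY: "submodule (E \<inter> N) Q (und Y)" if E: "submodule E Q M" for E
  proof (rule Y.submoduleI)
    show "E \<inter> N \<subseteq> carrier (und Y)" by (simp add: uY)
    show "\<zero>\<^bsub>und Y\<^esub> \<in> E \<inter> N"
      using M.submoduleE(2,4)[OF E] M.submoduleE(1)[OF E] M.smult_l_null
      by (auto simp: uY N) (metis M.R.zero_closed M.smult_l_null subsetD)
  qed (use M.submoduleE[OF E] Y.M.add.m_closed Y.smult_closed Y.M.add.inv_closed in
      \<open>auto simp: uY negY N e.add e.smult e.neg\<close>)
  have grY: "graded G Q Y"
    unfolding graded_def aY
  proof (intro conjI ballI subY ev od)
    show "ev P \<inter> N \<inter> (od P \<inter> N) = {\<zero>\<^bsub>und Y\<^esub>}"
      using ev_od(1) by (auto simp: uY N)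
    show "ev P \<inter> N <+>\<^bsub>und Y\<^esub> od P \<inter> N = carrier (und Y)"
    proof (intro equalityI subsetI)
      fix x assume "x \<in> ev P \<inter> N <+>\<^bsub>und Y\<^esub> od P \<inter> N"
      then obtain u v where "u \<in> ev P \<inter> N" "v \<in> od P \<inter> N" "x = u \<oplus>\<^bsub>M\<^esub> v"
        unfolding set_add_def' uY by blast
      then show "x \<in> carrier (und Y)" by (simp add: uY N e.add)
    next
      fix x assume x: "x \<in> carrier (und Y)"
      then have xN: "x \<in> N" by (simp add: uY)
      then obtain u v where uv: "u \<in> ev P" "v \<in> od P" "x = u \<oplus>\<^bsub>M\<^esub> v"
        using NM[OF xN] unfolding ev_od(2)[symmetric] set_add_def' by blast
      have "x = \<epsilon> u \<oplus>\<^bsub>M\<^esub> \<epsilon> v" using xN uv ev_closed od_closed by (simp add: N e.add)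
      moreover have "\<epsilon> u \<in> ev P \<inter> N" "\<epsilon> v \<in> od P \<inter> N"
        using uv ev_closed od_closed eN e_ev e_od by auto
      ultimately show "x \<in> ev P \<inter> N <+>\<^bsub>und Y\<^esub> od P \<inter> N"
        unfolding set_add_def' uY by blast
    qed
  qed (use act_ev act_od actN in auto)
  have pi: "\<epsilon> \<in> linear_maps Q M (und Y)"
    by (rule linear_mapsI) (use eN e.ext in \<open>auto simp: uY e.add e.smult\<close>)
  define \<iota> where "\<iota> = (\<lambda>x\<in>N. x)"
  have iota: "\<iota> \<in> linear_maps Q (und Y) M"
    by (rule linear_mapsI)
       (use NM Y.M.add.m_closed Y.smult_closed in \<open>auto simp: uY \<iota>_def\<close>)
  have retr: "\<epsilon> (\<iota> y) = y" if "y \<in> carrier (und Y)" for y using that by (simp add: uY \<iota>_def N)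
  have fgY: "finitely_generated Q (und Y)"
    by (rule finitely_generated_image[OF M.module_axioms modY pi _ fg])
       (use retr NM in \<open>auto simp: uY \<iota>_def\<close>)
  have projY: "projective Q (und Y)"
    by (rule projective_retract[OF M.module_axioms modY pi iota retr proj])
  have dN: "d x \<in> N" if "x \<in> N" for x using that by (simp add: N e_d)
  have dY: "diff Y \<in> odd_maps G Q Y Y"
    unfolding mem_odd_maps
  proof (intro conjI ballI linear_mapsI)
  qed (use dN actN NM d_ev d_od Y.M.add.m_closed Y.smult_closed in
      \<open>auto simp: uY aY d.add d.smult d_act\<close>)
  have Y_ob: "matrix_factorization G Q \<phi> f Y"
    unfolding matrix_factorization_def using twY grY fgY projY dY dN NM dd by (simp add: uY aY)
  have piH: "\<epsilon> \<in> Hom (mf G Q \<phi> f) P Y"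
    unfolding mem_Hom mem_even_maps using pi e_act e_ev e_od e_d eN ev_closed od_closed by (simp add: uY aY)
  have iotaH: "\<iota> \<in> Hom (mf G Q \<phi> f) Y P"
    unfolding mem_Hom mem_even_maps using iota actN dN by (simp add: uY aY \<iota>_def)
  have "compose (carrier (und Y)) \<epsilon> \<iota> = (\<lambda>x\<in>carrier (und Y). x)"
    by (auto simp: compose_def uY \<iota>_def N)
  moreover have "compose (carrier M) \<iota> \<epsilon> = \<epsilon>"
    by (rule extensionalityI[OF _ e.ext]) (auto simp: compose_def \<iota>_def eN)
  moreover have "Y \<in> Ob (mf G Q \<phi> f)" using Y_ob by (simp add: mf_def)
  ultimately show ?thesis using piH iotaH by blast
qed

text \<open>The ring is the bicommutant of \<open>e\<close>, the ideal is the set \<open>I\<close> of its null-homotopic invariant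
  elements.  It is an ideal because the elements of the bicommutant commute with \<open>d\<close>, so
  that \<open>t (d h + h d) = d (t h) + (t h) d\<close>.  An invariant element is a morphism because it
  commutes with \<open>d\<close> and with the projection onto the even part, both of which commute with \<open>e\<close>.\<close>
lemma lift_homotopy_idempotent:
  assumes fin: "finite (carrier G)" and hens: "henselian Q \<mm>"
    and e: "e \<in> Hom (mf G Q \<phi> f) P P"
    and idem: "(compose (carrier M) e e, e) \<in> homotopy_rel G Q \<phi> f P P"
  shows "\<exists>\<epsilon> \<in> Hom (mf G Q \<phi> f) P P. compose (carrier M) \<epsilon> \<epsilon> = \<epsilon> \<and> (\<epsilon>, e) \<in> homotopy_rel G Q \<phi> f P P"
proof -
  note e' = e[unfolded mem_Hom mem_even_maps]
  interpret pair: mf_pair G Q \<phi> f P P by (rule self_pair)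
  interpret triple: mf_triple G Q \<phi> f P P P ..
  interpret X: equivariant_endomorphism G Q \<phi> M "act P" e
    using e' by (intro equivariant_endomorphism.intro twisted equivariant_endomorphism_axioms.intro) blast+
  let ?S = "bicommutant Q M e"
  let ?K = "invariant_ring G ?S X.conjugate"
  interpret A: finite_group_acting ?S G X.conjugate by (rule X.finite_group_acting_conjugate[OF fin])
  interpret K: cring ?K by (rule A.cring_K)
  have KS: "s \<in> carrier ?S" if "s \<in> carrier ?K" for s using that by (simp add: A.K_iff)
  have K_Hom: "s \<in> Hom (mf G Q \<phi> f) P P" if s: "s \<in> carrier ?K" for s
  proof -
    obtain p where p: "p \<in> linear_maps Q M M" and pe: "\<And>x. x \<in> carrier M \<Longrightarrow> p x = x \<longleftrightarrow> x \<in> ev P"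
      and po: "\<And>x. x \<in> carrier M \<Longrightarrow> p x = \<zero>\<^bsub>M\<^esub> \<longleftrightarrow> x \<in> od P"
      using M.exists_projection[OF ev od ev_od] by blast
    interpret p: linear_map Q M M p using p by unfold_locales
    interpret e: linear_map Q M M e using e' by unfold_locales blast
    have sS: "s \<in> carrier ?S" using s by (rule KS)
    interpret s: linear_map Q M M s using X.EE.S_linear[OF sS] by unfold_locales
    have "p (e x) = e (p x)" if x: "x \<in> carrier M" for x
    proof -
      obtain u v where uv: "u \<in> ev P" "v \<in> od P" "x = u \<oplus>\<^bsub>M\<^esub> v"
        using x unfolding ev_od(2)[symmetric] set_add_def' by blast
      have c: "u \<in> carrier M" "v \<in> carrier M" using uv ev_closed od_closed by auto
      have "e u \<in> ev P" "e v \<in> od P" using e' uv by blast+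
      then have "p (e u) = e u" "p (e v) = \<zero>\<^bsub>M\<^esub>" using pe[of "e u"] po[of "e v"] c by simp_all
      moreover have "p u = u" "p v = \<zero>\<^bsub>M\<^esub>" using pe[of u] po[of v] uv c by simp_all
      ultimately show ?thesis unfolding uv(3) using c by (simp add: p.add e.add)
    qed
    then have sp: "s (p x) = p (s x)" if "x \<in> carrier M" for x
      by (rule X.EE.S_commute[OF sS p _ that])
    have "s x \<in> ev P" if "x \<in> ev P" for x
      using sp[of x] pe[of x] pe[of "s x"] that ev_closed[OF that] by simp
    moreover have "s x \<in> od P" if "x \<in> od P" for x
      using sp[of x] po[of x] po[of "s x"] that od_closed[OF that] by simp
    moreover have "s (d x) = d (s x)" if "x \<in> carrier M" for x
    proof (rule X.EE.S_commute[OF sS d_linear _ that])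
      show "d (e x) = e (d x)" if "x \<in> carrier M" for x using e' that by simp
    qed
    moreover have "s (act P g x) = act P g (s x)" if "g \<in> carrier G" "x \<in> carrier M" for g x
      using s that unfolding X.conjugate_invariant_iff by blast
    ultimately show ?thesis unfolding mem_Hom mem_even_maps using s.linear by blast
  qed
  define null where "null s h \<longleftrightarrow> (\<forall>x \<in> carrier M. s x = d (h x) \<oplus>\<^bsub>M\<^esub> h (d x))" for s h
  have nullD: "s x = d (h x) \<oplus>\<^bsub>M\<^esub> h (d x)" if "null s h" "x \<in> carrier M" for s h x
    using that by (simp add: null_def)
  define I where "I = {s \<in> carrier ?K. \<exists>h \<in> odd_maps G Q P P. null s h}"
  have I_iff: "s \<in> I \<longleftrightarrow> s \<in> carrier ?K \<and> (\<exists>h \<in> odd_maps G Q P P. null s h)" for s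
    unfolding I_def by (rule mem_Collect_eq)
  have lin: "linear_map Q M M h" if "h \<in> odd_maps G Q P P" for h
    using that by unfold_locales (simp add: mem_odd_maps)
  have ideal_I: "ideal I ?K"
  proof (rule idealI)
    show "ring ?K" by (rule K.ring_axioms)
    show "subgroup I (add_monoid ?K)"
    proof (rule K.add.subgroupI)
      show "I \<subseteq> carrier ?K" unfolding I_def by blast
      have "null \<zero>\<^bsub>?K\<^esub> (\<lambda>x\<in>carrier M. \<zero>\<^bsub>M\<^esub>)"
        unfolding null_def A.K_ops by (simp add: X.EE.S_apply)
      then have "\<zero>\<^bsub>?K\<^esub> \<in> I" unfolding I_iff using pair.odd_zero K.zero_closed by blast
      then show "I \<noteq> {}" by blast
      fix s assume "s \<in> I"
      then obtain h where s: "s \<in> carrier ?K" and h: "h \<in> odd_maps G Q P P" "null s h"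
        unfolding I_iff by blast
      interpret h: linear_map Q M M h by (rule lin[OF h(1)])
      have "null (\<ominus>\<^bsub>?K\<^esub> s) (\<lambda>x\<in>carrier M. \<ominus>\<^bsub>M\<^esub> h x)"
        unfolding null_def A.K_minus(1)[OF s s]
        using nullD[OF h(2)] KS[OF s] by (simp add: X.EE.S_neg_apply d.neg M.M.minus_add)
      then show "\<ominus>\<^bsub>?K\<^esub> s \<in> I" unfolding I_iff using pair.odd_neg[OF h(1)] s K.a_inv_closed by blast
      fix t assume "t \<in> I"
      then obtain k where t: "t \<in> carrier ?K" and k: "k \<in> odd_maps G Q P P" "null t k"
        unfolding I_iff by blast
      interpret k: linear_map Q M M k by (rule lin[OF k(1)])
      have "null (s \<oplus>\<^bsub>?K\<^esub> t) (\<lambda>x\<in>carrier M. h x \<oplus>\<^bsub>M\<^esub> k x)"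
        unfolding null_def A.K_ops
        using nullD[OF h(2)] nullD[OF k(2)] by (simp add: X.EE.S_apply d.add M.M.a_ac)
      then show "s \<oplus>\<^bsub>?K\<^esub> t \<in> I"
        unfolding I_iff using pair.odd_add[OF h(1) k(1)] s t K.a_closed by blast
    qed
    fix s t assume "s \<in> I" and t: "t \<in> carrier ?K"
    then obtain h where s: "s \<in> carrier ?K" and h: "h \<in> odd_maps G Q P P" "null s h"
      unfolding I_iff by blast
    interpret h: linear_map Q M M h by (rule lin[OF h(1)])
    have tH: "t \<in> even_maps G Q P P" "\<And>x. x \<in> carrier M \<Longrightarrow> t (d x) = d (t x)"
      using K_Hom[OF t] unfolding mem_Hom by blast+
    interpret t: linear_map Q M M t using tH(1) by unfold_locales (simp add: mem_even_maps)
    have "null (t \<otimes>\<^bsub>?K\<^esub> s) (compose (carrier M) t h)"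
      unfolding null_def A.K_ops
      using nullD[OF h(2)] by (simp add: X.EE.S_apply compose_def t.add tH(2))
    then show ts: "t \<otimes>\<^bsub>?K\<^esub> s \<in> I"
      unfolding I_iff using triple.odd_then_even[OF h(1) tH(1)] s t K.m_closed by blast
    show "s \<otimes>\<^bsub>?K\<^esub> t \<in> I" using ts K.m_comm[OF s t] by simp
  qed
  have eK: "e \<in> carrier ?K"
    unfolding X.conjugate_invariant_iff using X.EE.e_in_S X.e_equivariant by blast
  have eS: "e \<in> carrier ?S" by (rule X.EE.e_in_S)
  obtain h where h: "h \<in> odd_maps G Q P P"
    and eq: "\<And>x. x \<in> carrier M \<Longrightarrow> compose (carrier M) e e x \<ominus>\<^bsub>M\<^esub> e x = d (h x) \<oplus>\<^bsub>M\<^esub> h (d x)"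
    using idem unfolding homotopy_rel_def by blast
  have "e \<otimes>\<^bsub>?S\<^esub> e \<ominus>\<^bsub>?S\<^esub> e \<in> I"
  proof -
    have "null (e \<otimes>\<^bsub>?S\<^esub> e \<ominus>\<^bsub>?S\<^esub> e) h"
      unfolding null_def using eq eS
      by (simp add: X.EE.S_minus_apply X.EE.S_apply X.EE.S_mult_closed compose_def)
    then show ?thesis unfolding I_iff using A.K_closed(4)[OF A.K_closed(1)[OF eK eK] eK] h by blast
  qed
  moreover obtain B where "M.generating B"
    using fg unfolding finitely_generated_def M.generating_def by blast
  ultimately obtain \<epsilon> where \<epsilon>: "\<epsilon> \<in> carrier ?K" "\<epsilon> \<otimes>\<^bsub>?S\<^esub> \<epsilon> = \<epsilon>" "\<epsilon> \<ominus>\<^bsub>?S\<^esub> e \<in> I"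
    using X.henselian_idempotent_lift[OF fin hens _ ideal_I] by blast
  have "compose (carrier M) \<epsilon> \<epsilon> = \<epsilon>" using \<epsilon>(2) by (simp add: bicommutant_def)
  moreover have "(\<epsilon>, e) \<in> homotopy_rel G Q \<phi> f P P"
  proof -
    obtain k where k: "k \<in> odd_maps G Q P P" "null (\<epsilon> \<ominus>\<^bsub>?S\<^esub> e) k" using \<epsilon>(3) unfolding I_iff by blast
    have "\<epsilon> x \<ominus>\<^bsub>M\<^esub> e x = d (k x) \<oplus>\<^bsub>M\<^esub> k (d x)" if "x \<in> carrier M" for x
      using nullD[OF k(2) that] X.EE.S_minus_apply[OF KS[OF \<epsilon>(1)] eS that] by simp
    then show ?thesis unfolding homotopy_rel_def using K_Hom[OF \<epsilon>(1)] e k(1) by blast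
  qed
  ultimately show ?thesis using K_Hom[OF \<epsilon>(1)] by blast
qed

end

theorem theorem1p1:
  fixes G :: "('g, 'x) monoid_scheme"
    and Q :: "('q, 'y) ring_scheme"
    and \<phi> :: "'g \<Rightarrow> 'q \<Rightarrow> 'q"
    and \<mm> :: "'q set"
    and f :: "'q"
  assumes "group G" and "finite (carrier G)"
    and "ring_action G Q \<phi>"
    and "noetherian_ring Q" and "local_ring Q \<mm>"
    and "finitely_generated (invariant_ring G Q \<phi>) (regular_module Q)"
    and "f \<in> \<mm>" and "\<forall>g \<in> carrier G. \<phi> g f = f"
    and "henselian Q \<mm>"
  shows "idempotent_complete
    (homotopy_mf G Q \<phi> f :: (('q, 'g, 'm) eqmf, ('m \<Rightarrow> 'm) set) category)"
  unfolding idempotent_complete_def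
proof (intro ballI impI)
  let ?C = "mf G Q \<phi> f :: (('q, 'g, 'm) eqmf, 'm \<Rightarrow> 'm) category"
  let ?H = "homotopy_mf G Q \<phi> f :: (('q, 'g, 'm) eqmf, ('m \<Rightarrow> 'm) set) category"
  let ?r = "homotopy_rel G Q \<phi> f :: ('q, 'g, 'm) eqmf \<Rightarrow> ('q, 'g, 'm) eqmf \<Rightarrow> (('m \<Rightarrow> 'm) \<times> ('m \<Rightarrow> 'm)) set"
  have H: "Ob ?H = Ob ?C" "\<And>X Y. Hom ?H X Y = Hom ?C X Y // ?r X Y"
    "\<And>X. Id ?H X = ?r X X `` {\<lambda>x\<in>carrier (und X). x}"
    by (simp_all add: homotopy_mf_def quotient_category_def mf_def)
  fix X E assume X: "X \<in> Ob ?H" and E: "E \<in> Hom ?H X X" and idem: "Comp ?H X X X E E = E"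
  interpret X: mf_object G Q \<phi> f X using X unfolding H by unfold_locales (simp add: mf_def)
  interpret XX: mf_pair G Q \<phi> f X X by (rule X.self_pair)
  interpret XXX: mf_triple G Q \<phi> f X X X ..
  obtain e where e: "e \<in> Hom ?C X X" and Ee: "E = ?r X X `` {e}"
    using E unfolding H by (rule quotientE)
  have "?r X X `` {compose (carrier (und X)) e e} = ?r X X `` {e}"
    using idem unfolding Ee XXX.Comp_homotopy_classes[OF e e] .
  then have "(compose (carrier (und X)) e e, e) \<in> ?r X X"
    using eq_equiv_class[OF _ XX.equiv_homotopy e] by blast
  then obtain \<epsilon> where \<epsilon>: "\<epsilon> \<in> Hom ?C X X" "compose (carrier (und X)) \<epsilon> \<epsilon> = \<epsilon>" "(\<epsilon>, e) \<in> ?r X X"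
    using X.lift_homotopy_idempotent[OF assms(2,9) e] by blast
  obtain Y \<pi> \<iota> where Y: "Y \<in> Ob ?C" and \<pi>: "\<pi> \<in> Hom ?C X Y" and \<iota>: "\<iota> \<in> Hom ?C Y X"
    and \<pi>\<iota>: "compose (carrier (und Y)) \<pi> \<iota> = (\<lambda>x\<in>carrier (und Y). x)"
    and \<iota>\<pi>: "compose (carrier (und X)) \<iota> \<pi> = \<epsilon>"
    using X.split_idempotent[OF \<epsilon>(1,2)] by blast
  interpret Y: mf_object G Q \<phi> f Y using Y by unfold_locales (simp add: mf_def)
  interpret XY: mf_pair G Q \<phi> f X Y ..
  interpret YX: mf_pair G Q \<phi> f Y X ..
  interpret XYX: mf_triple G Q \<phi> f X Y X ..
  interpret YXY: mf_triple G Q \<phi> f Y X Y ..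
  show "\<exists>Y \<in> Ob ?H. \<exists>\<pi> \<in> Hom ?H X Y. \<exists>\<iota> \<in> Hom ?H Y X.
      Comp ?H Y X Y \<pi> \<iota> = Id ?H Y \<and> Comp ?H X Y X \<iota> \<pi> = E"
  proof (intro bexI conjI)
    show "Comp ?H Y X Y (?r X Y `` {\<pi>}) (?r Y X `` {\<iota>}) = Id ?H Y"
      unfolding H YXY.Comp_homotopy_classes[OF \<iota> \<pi>] \<pi>\<iota> ..
    show "Comp ?H X Y X (?r Y X `` {\<iota>}) (?r X Y `` {\<pi>}) = E"
      unfolding XYX.Comp_homotopy_classes[OF \<pi> \<iota>] \<iota>\<pi> Ee
      by (rule equiv_class_eq[OF XX.equiv_homotopy \<epsilon>(3)])
    show "?r X Y `` {\<pi>} \<in> Hom ?H X Y" unfolding H by (rule quotientI[OF \<pi>])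
    show "?r Y X `` {\<iota>} \<in> Hom ?H Y X" unfolding H by (rule quotientI[OF \<iota>])
    show "Y \<in> Ob ?H" unfolding H by (rule Y)
  qed
qed

end
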